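(* Let $A$ be an associative unital $k$-algebra and $B\subset A$ a subalgebra. Let $D^\bullet(A/B)$ denote the relative differential envelope of $A$, i.e. the universal (initial) object in the category whose objects are algebra maps $f:A\to D^0\subset D$, where $D$ is a differential graded algebra and $d_D\circ f|_B=0$. Then $$D^\bullet(A/B)\;\simeq\;T_A^\bullet\,\Omega^1_{nc}(A/B)\;\simeq\;A\otimes_B T_B^\bullet(A/B),$$ where the first isomorphism is one of graded algebras and the second one of graded left $A$-modules.
   Context: $k$ is an algebraically closed field of characteristic zero. A differential graded algebra (DGA) is a graded algebra $D=\bigoplus_n D^n$ with a super-derivation $d:D^n\to D^{n+1}$, $d^2=0$. Morphisms from $f:A\to D^0$ to $g:A\to E^0$ are maps of DGAs $\psi:D\to E$ with $\psi\circ f=g$. $\Omega^1_{nc}(A/B)=\ker(A\otimes_BA\to A)$, the kernel of the multiplication map, an $A$-bimodule. $T_A^\bullet M$ denotes the tensor algebra of an $A$-bimodule $M$ over $A$. $A/B$ is the quotient $B$-bimodule, and $T_B^\bullet(A/B)$ is its tensor algebra over $B$. *)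

theory Defs
  imports "HOL-Algebra.Algebra" "HOL-Library.FuncSet"
begin

section \<open>Associative algebras and differential graded algebras over a field\<close>

definition char_zero :: "('k, 'x) ring_scheme \<Rightarrow> bool" where
  "char_zero K \<longleftrightarrow> (\<forall>n::nat. n > 0 \<longrightarrow> [n] \<cdot>\<^bsub>K\<^esub> \<one>\<^bsub>K\<^esub> \<noteq> \<zero>\<^bsub>K\<^esub>)"

text \<open>The library's locale \<^locale>\<open>algebra\<close> is restricted to commutative algebras.
  The zero algebra is allowed.\<close>

locale assoc_algebra = module K A + K?: field K + A?: ring A
  for K (structure) and A (structure) +
  assumes smult_mult_left:
    "\<lbrakk>c \<in> carrier K; x \<in> carrier A; y \<in> carrier A\<rbrakk>
      \<Longrightarrow> (c \<odot>\<^bsub>A\<^esub> x) \<otimes>\<^bsub>A\<^esub> y = c \<odot>\<^bsub>A\<^esub> (x \<otimes>\<^bsub>A\<^esub> y)"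
  and smult_mult_right:
    "\<lbrakk>c \<in> carrier K; x \<in> carrier A; y \<in> carrier A\<rbrakk>
      \<Longrightarrow> x \<otimes>\<^bsub>A\<^esub> (c \<odot>\<^bsub>A\<^esub> y) = c \<odot>\<^bsub>A\<^esub> (x \<otimes>\<^bsub>A\<^esub> y)"

definition unital_subalgebra :: "('k, 'x) ring_scheme \<Rightarrow> ('k, 'a, 'y) module_scheme \<Rightarrow> 'a set \<Rightarrow> bool" where
  "unital_subalgebra K A B \<longleftrightarrow> subring B A \<and> submodule B K A"

definition algebra_hom ::
    "('k, 'x) ring_scheme \<Rightarrow> ('k, 'a, 'y) module_scheme \<Rightarrow> ('k, 'b, 'z) module_scheme \<Rightarrow> ('a \<Rightarrow> 'b) set" where
  "algebra_hom K A D = {f \<in> ring_hom A D.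
     \<forall>c\<in>carrier K. \<forall>a\<in>carrier A. f (c \<odot>\<^bsub>A\<^esub> a) = c \<odot>\<^bsub>D\<^esub> f a}"

text \<open>The record serves both for graded algebras and for graded left modules over a (possibly
  noncommutative) ring; in the latter case the fields \<^const>\<open>monoid.mult\<close> and \<^const>\<open>one\<close>
  carry no information.\<close>

record ('r, 'm) graded_module = "('r, 'm) module" +
  homog :: "int \<Rightarrow> 'm set"

record ('k, 'd) dga = "('k, 'd) graded_module" +
  diff :: "'d \<Rightarrow> 'd"

locale graded_algebra = assoc_algebra K D
  for K (structure) and D :: "('k, 'd, 'z) graded_module_scheme" (structure) +
  assumes homog_submodule: "submodule (homog D n) K D"
  and homog_direct_sum: "x \<in> carrier D \<Longrightarrow>
    \<exists>!p. (\<forall>n. p n \<in> homog D n) \<and> finite {n. p n \<noteq> \<zero>\<^bsub>D\<^esub>} \<and> x = finsum D p {n. p n \<noteq> \<zero>\<^bsub>D\<^esub>}"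
  and homog_one: "\<one>\<^bsub>D\<^esub> \<in> homog D 0"
  and homog_mult: "\<lbrakk>x \<in> homog D m; y \<in> homog D n\<rbrakk> \<Longrightarrow> x \<otimes>\<^bsub>D\<^esub> y \<in> homog D (m + n)"

locale diff_graded_algebra = graded_algebra K D
  for K (structure) and D :: "('k, 'd, 'z) dga_scheme" (structure) +
  assumes diff_add: "\<lbrakk>x \<in> carrier D; y \<in> carrier D\<rbrakk> \<Longrightarrow> diff D (x \<oplus>\<^bsub>D\<^esub> y) = diff D x \<oplus>\<^bsub>D\<^esub> diff D y"
  and diff_smult: "\<lbrakk>c \<in> carrier K; x \<in> carrier D\<rbrakk> \<Longrightarrow> diff D (c \<odot>\<^bsub>D\<^esub> x) = c \<odot>\<^bsub>D\<^esub> diff D x"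
  and diff_homog: "x \<in> homog D n \<Longrightarrow> diff D x \<in> homog D (n + 1)"
  and diff_diff: "x \<in> carrier D \<Longrightarrow> diff D (diff D x) = \<zero>\<^bsub>D\<^esub>"
  and diff_Leibniz: "\<lbrakk>x \<in> homog D n; y \<in> carrier D\<rbrakk> \<Longrightarrow>
    diff D (x \<otimes>\<^bsub>D\<^esub> y) =
      (diff D x \<otimes>\<^bsub>D\<^esub> y) \<oplus>\<^bsub>D\<^esub> (if even n then x \<otimes>\<^bsub>D\<^esub> diff D y else \<ominus>\<^bsub>D\<^esub> (x \<otimes>\<^bsub>D\<^esub> diff D y))"

definition graded_module_iso ::
    "'r set \<Rightarrow> ('r, 'm, 'x) graded_module_scheme \<Rightarrow> ('r, 'n, 'y) graded_module_scheme \<Rightarrow> ('m \<Rightarrow> 'n) \<Rightarrow> bool" where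
  "graded_module_iso R M N \<phi> \<longleftrightarrow>
     bij_betw \<phi> (carrier M) (carrier N) \<and>
     (\<forall>x\<in>carrier M. \<forall>y\<in>carrier M. \<phi> (x \<oplus>\<^bsub>M\<^esub> y) = \<phi> x \<oplus>\<^bsub>N\<^esub> \<phi> y) \<and>
     (\<forall>r\<in>R. \<forall>x\<in>carrier M. \<phi> (r \<odot>\<^bsub>M\<^esub> x) = r \<odot>\<^bsub>N\<^esub> \<phi> x) \<and>
     (\<forall>n. \<phi> ` homog M n = homog N n)"

definition graded_algebra_iso ::
    "('k, 'w) ring_scheme \<Rightarrow> ('k, 'm, 'x) graded_module_scheme \<Rightarrow> ('k, 'n, 'y) graded_module_scheme \<Rightarrow> ('m \<Rightarrow> 'n) \<Rightarrow> bool" where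
  "graded_algebra_iso K D E \<phi> \<longleftrightarrow> \<phi> \<in> ring_hom D E \<and> graded_module_iso (carrier K) D E \<phi>"

section \<open>The relative differential envelope\<close>

definition envelope_object ::
    "('k, 'w) ring_scheme \<Rightarrow> ('k, 'a, 'x) module_scheme \<Rightarrow> 'a set \<Rightarrow> ('k, 'd) dga \<Rightarrow> ('a \<Rightarrow> 'd) \<Rightarrow> bool" where
  "envelope_object K A B D f \<longleftrightarrow>
     diff_graded_algebra K D \<and> f \<in> algebra_hom K A D \<and> f ` carrier A \<subseteq> homog D 0 \<and>
     (\<forall>b\<in>B. diff D (f b) = \<zero>\<^bsub>D\<^esub>)"

definition envelope_morphism ::
    "('k, 'w) ring_scheme \<Rightarrow> ('k, 'a, 'x) module_scheme \<Rightarrow>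
     ('k, 'd) dga \<Rightarrow> ('a \<Rightarrow> 'd) \<Rightarrow> ('k, 'e) dga \<Rightarrow> ('a \<Rightarrow> 'e) \<Rightarrow> ('d \<Rightarrow> 'e) \<Rightarrow> bool" where
  "envelope_morphism K A D f E g \<psi> \<longleftrightarrow>
     \<psi> \<in> algebra_hom K D E \<and> (\<forall>n. \<psi> ` homog D n \<subseteq> homog E n) \<and>
     (\<forall>x\<in>carrier D. \<psi> (diff D x) = diff E (\<psi> x)) \<and>
     (\<forall>a\<in>carrier A. \<psi> (f a) = g a)"

text \<open>Initiality with respect to all objects whose underlying set lives in the type \<open>'e\<close>.
  HOL cannot quantify over types inside a formula, hence the type argument.  Maps are functions
  restricted to their carrier, so that uniqueness is equality.\<close>

definition rel_diff_envelope ::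
    "'e itself \<Rightarrow> ('k, 'w) ring_scheme \<Rightarrow> ('k, 'a, 'x) module_scheme \<Rightarrow> 'a set \<Rightarrow>
     ('k, 'd) dga \<Rightarrow> ('a \<Rightarrow> 'd) \<Rightarrow> bool" where
  "rel_diff_envelope (_ :: 'e itself) K A B D f \<longleftrightarrow>
     envelope_object K A B D f \<and>
     (\<forall>(E :: ('k, 'e) dga) g. envelope_object K A B E g \<longrightarrow>
        (\<exists>!\<psi>. \<psi> \<in> extensional (carrier D) \<and> envelope_morphism K A D f E g \<psi>))"

section \<open>Abelian groups by generators and relations\<close>

text \<open>\<open>Q\<close> is a set of relators in the free abelian group on \<open>S\<close>; elements of the group presented
  by \<open>S\<close> and \<open>Q\<close> are cosets.\<close>

definition relators_span :: "'w set \<Rightarrow> ('w \<Rightarrow>\<^sub>0 int) set \<Rightarrow> ('w \<Rightarrow>\<^sub>0 int) set" where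
  "relators_span S Q = generate (free_Abelian_group S) Q"

definition presented_group :: "'w set \<Rightarrow> ('w \<Rightarrow>\<^sub>0 int) set \<Rightarrow> ('w \<Rightarrow>\<^sub>0 int) set monoid" where
  "presented_group S Q = free_Abelian_group S Mod relators_span S Q"

definition presented_class :: "'w set \<Rightarrow> ('w \<Rightarrow>\<^sub>0 int) set \<Rightarrow> ('w \<Rightarrow>\<^sub>0 int) \<Rightarrow> ('w \<Rightarrow>\<^sub>0 int) set" where
  "presented_class S Q x = relators_span S Q #>\<^bsub>free_Abelian_group S\<^esub> x"

text \<open>The additive endomorphism induced by a map of generators that respects the relators; the union
  is over representatives, all of which yield the same coset (as in \<^const>\<open>rcoset_mult\<close>).\<close>

definition presented_map ::
    "'w set \<Rightarrow> ('w \<Rightarrow>\<^sub>0 int) set \<Rightarrow> ('w \<Rightarrow> 'w) \<Rightarrow> ('w \<Rightarrow>\<^sub>0 int) set \<Rightarrow> ('w \<Rightarrow>\<^sub>0 int) set" where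
  "presented_map S Q h U = (\<Union>x\<in>U. presented_class S Q (frag_extend (\<lambda>w. frag_of (h w)) x))"

section \<open>Bimodules and their tensor product\<close>

record ('r, 'm) bimodule = "('r, 'm) module" +
  rsmult :: "'m \<Rightarrow> 'r \<Rightarrow> 'm"

definition bimodule_via :: "('r \<Rightarrow> 'm) \<Rightarrow> ('m, 'x) ring_scheme \<Rightarrow> ('r, 'm) bimodule" where
  "bimodule_via f T = \<lparr>carrier = carrier T, monoid.mult = monoid.mult T, one = one T,
     ring.zero = ring.zero T, add = add T,
     smult = (\<lambda>r x. f r \<otimes>\<^bsub>T\<^esub> x), rsmult = (\<lambda>x r. x \<otimes>\<^bsub>T\<^esub> f r)\<rparr>"

abbreviation self_bimodule :: "('a, 'x) ring_scheme \<Rightarrow> ('a, 'a) bimodule" where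
  "self_bimodule A \<equiv> bimodule_via (\<lambda>a. a) A"

definition quotient_bimodule :: "('a, 'x) ring_scheme \<Rightarrow> 'a set \<Rightarrow> ('a, 'a set) bimodule" where
  "quotient_bimodule A B = \<lparr>carrier = a_rcosets\<^bsub>A\<^esub> B, monoid.mult = undefined, one = undefined,
     ring.zero = B, add = set_add A,
     smult = (\<lambda>b U. \<Union>x\<in>U. B +>\<^bsub>A\<^esub> (b \<otimes>\<^bsub>A\<^esub> x)),
     rsmult = (\<lambda>U b. \<Union>x\<in>U. B +>\<^bsub>A\<^esub> (x \<otimes>\<^bsub>A\<^esub> b))\<rparr>"

type_synonym ('m, 'n) tensor = "('m \<times> 'n \<Rightarrow>\<^sub>0 int) set"

definition tensor_relators ::
    "'r set \<Rightarrow> ('r, 'm, 'x) bimodule_scheme \<Rightarrow> ('r, 'n, 'y) bimodule_scheme \<Rightarrow> ('m \<times> 'n \<Rightarrow>\<^sub>0 int) set" where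
  "tensor_relators B M N =
     {frag_of (x \<oplus>\<^bsub>M\<^esub> x', y) - frag_of (x, y) - frag_of (x', y) | x x' y.
        x \<in> carrier M \<and> x' \<in> carrier M \<and> y \<in> carrier N} \<union>
     {frag_of (x, y \<oplus>\<^bsub>N\<^esub> y') - frag_of (x, y) - frag_of (x, y') | x y y'.
        x \<in> carrier M \<and> y \<in> carrier N \<and> y' \<in> carrier N} \<union>
     {frag_of (rsmult M x b, y) - frag_of (x, b \<odot>\<^bsub>N\<^esub> y) | x b y.
        x \<in> carrier M \<and> b \<in> B \<and> y \<in> carrier N}"

definition tensor_class ::
    "'r set \<Rightarrow> ('r, 'm, 'x) bimodule_scheme \<Rightarrow> ('r, 'n, 'y) bimodule_scheme \<Rightarrow> ('m \<times> 'n \<Rightarrow>\<^sub>0 int) \<Rightarrow> ('m, 'n) tensor" where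
  "tensor_class B M N = presented_class (carrier M \<times> carrier N) (tensor_relators B M N)"

text \<open>\<open>M \<otimes>\<^sub>B N\<close>, with the left action inherited from \<open>M\<close> and the right action inherited from \<open>N\<close>.  The
  rings acting on the outer sides may be larger than \<open>B\<close>.\<close>

definition tensor_product ::
    "'r set \<Rightarrow> ('r, 'm, 'x) bimodule_scheme \<Rightarrow> ('r, 'n, 'y) bimodule_scheme \<Rightarrow> ('r, ('m, 'n) tensor) bimodule" where
  "tensor_product B M N =
     (let S = carrier M \<times> carrier N; Q = tensor_relators B M N; G = presented_group S Q in
      \<lparr>carrier = carrier G, monoid.mult = undefined, one = undefined, ring.zero = one G, add = monoid.mult G,
       smult = (\<lambda>r. presented_map S Q (\<lambda>(x, y). (r \<odot>\<^bsub>M\<^esub> x, y))),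
       rsmult = (\<lambda>U r. presented_map S Q (\<lambda>(x, y). (x, rsmult N y r)) U)\<rparr>)"

section \<open>Noncommutative relative differential forms of degree one\<close>

definition mult_map :: "('a, 'x) ring_scheme \<Rightarrow> ('a, 'a) tensor \<Rightarrow> 'a" where
  "mult_map A U = the_elem ((\<lambda>x. finsum A
     (\<lambda>(a, a'). [Poly_Mapping.lookup x (a, a')] \<cdot>\<^bsub>A\<^esub> (a \<otimes>\<^bsub>A\<^esub> a')) (Poly_Mapping.keys x)) ` U)"

definition Omega1_nc :: "('a, 'x) ring_scheme \<Rightarrow> 'a set \<Rightarrow> ('a, ('a, 'a) tensor) bimodule" where
  "Omega1_nc A B =
     (let P = tensor_product B (self_bimodule A) (self_bimodule A)
      in P\<lparr>carrier := {U \<in> carrier P. mult_map A U = \<zero>\<^bsub>A\<^esub>}\<rparr>)"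

section \<open>The tensor algebra of a bimodule\<close>

text \<open>\<open>T\<^sub>R M\<close> is the direct sum of \<open>R\<close> and the \<open>n\<close>-fold tensor powers \<open>M \<otimes>\<^sub>R \<dots> \<otimes>\<^sub>R M\<close> for \<open>n \<ge> 1\<close>.
  As types cannot depend on \<open>n\<close>, all summands are presented together: generators
  \<open>Scal r\<close> in degree \<open>0\<close>, and \<open>Tens [m\<^sub>1, \<dots>, m\<^sub>n]\<close> standing for \<open>m\<^sub>1 \<otimes> \<dots> \<otimes> m\<^sub>n\<close> in degree \<open>n \<ge> 1\<close>.  All
  relators are homogeneous, and those of degree \<open>n\<close> define the \<open>n\<close>-th summand.\<close>

datatype ('r, 'm) tword = Scal 'r | Tens "'m list"

type_synonym ('r, 'm) tensor_word_class = "(('r, 'm) tword \<Rightarrow>\<^sub>0 int) set"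

fun tword_degree :: "('r, 'm) tword \<Rightarrow> int" where
  "tword_degree (Scal r) = 0"
| "tword_degree (Tens ms) = int (length ms)"

definition twords :: "('r, 'x) ring_scheme \<Rightarrow> ('r, 'm, 'y) bimodule_scheme \<Rightarrow> ('r, 'm) tword set" where
  "twords R M = Scal ` carrier R \<union> Tens ` {ms \<in> lists (carrier M). ms \<noteq> []}"

fun tword_mult ::
    "('r, 'x) ring_scheme \<Rightarrow> ('r, 'm, 'y) bimodule_scheme \<Rightarrow> ('r, 'm) tword \<Rightarrow> ('r, 'm) tword \<Rightarrow> ('r, 'm) tword" where
  "tword_mult R M (Scal r) (Scal s) = Scal (r \<otimes>\<^bsub>R\<^esub> s)"
| "tword_mult R M (Scal r) (Tens ms) = Tens ((r \<odot>\<^bsub>M\<^esub> hd ms) # tl ms)"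
| "tword_mult R M (Tens ms) (Scal s) = Tens (butlast ms @ [rsmult M (last ms) s])"
| "tword_mult R M (Tens ms) (Tens ns) = Tens (ms @ ns)"

definition tword_relators ::
    "('r, 'x) ring_scheme \<Rightarrow> ('r, 'm, 'y) bimodule_scheme \<Rightarrow> (('r, 'm) tword \<Rightarrow>\<^sub>0 int) set" where
  "tword_relators R M =
     {frag_of (Scal (r \<oplus>\<^bsub>R\<^esub> s)) - frag_of (Scal r) - frag_of (Scal s) | r s.
        r \<in> carrier R \<and> s \<in> carrier R} \<union>
     {frag_of (Tens (us @ [m \<oplus>\<^bsub>M\<^esub> m'] @ vs)) - frag_of (Tens (us @ [m] @ vs)) - frag_of (Tens (us @ [m'] @ vs))
        | us vs m m'. us \<in> lists (carrier M) \<and> vs \<in> lists (carrier M) \<and> m \<in> carrier M \<and> m' \<in> carrier M} \<union>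
     {frag_of (Tens (us @ [rsmult M m r, m'] @ vs)) - frag_of (Tens (us @ [m, r \<odot>\<^bsub>M\<^esub> m'] @ vs))
        | us vs m m' r. us \<in> lists (carrier M) \<and> vs \<in> lists (carrier M) \<and>
            m \<in> carrier M \<and> m' \<in> carrier M \<and> r \<in> carrier R}"

definition tword_class ::
    "('r, 'x) ring_scheme \<Rightarrow> ('r, 'm, 'y) bimodule_scheme \<Rightarrow> (('r, 'm) tword \<Rightarrow>\<^sub>0 int) \<Rightarrow> ('r, 'm) tensor_word_class" where
  "tword_class R M = presented_class (twords R M) (tword_relators R M)"

definition tensor_scalar ::
    "('r, 'x) ring_scheme \<Rightarrow> ('r, 'm, 'y) bimodule_scheme \<Rightarrow> 'r \<Rightarrow> ('r, 'm) tensor_word_class" where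
  "tensor_scalar R M r = tword_class R M (frag_of (Scal r))"

text \<open>Here \<open>R\<close> is an algebra over a field, which acts on \<open>T\<^sub>R M\<close> through \<open>c \<mapsto> c \<cdot> 1\<close> in \<open>R\<close>.\<close>

definition tensor_algebra ::
    "('k, 'r, 'x) module_scheme \<Rightarrow> ('r, 'm, 'y) bimodule_scheme \<Rightarrow> ('k, ('r, 'm) tensor_word_class) graded_module" where
  "tensor_algebra R M =
     (let S = twords R M; Q = tword_relators R M; G = presented_group S Q in
      \<lparr>carrier = carrier G,
       monoid.mult = (\<lambda>U V. \<Union>x\<in>U. \<Union>y\<in>V. tword_class R M
         (frag_extend (\<lambda>u. frag_extend (\<lambda>v. frag_of (tword_mult R M u v)) y) x)),
       one = tensor_scalar R M \<one>\<^bsub>R\<^esub>, ring.zero = one G, add = monoid.mult G,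
       smult = (\<lambda>c. presented_map S Q (tword_mult R M (Scal (c \<odot>\<^bsub>R\<^esub> \<one>\<^bsub>R\<^esub>)))),
       homog = (\<lambda>n. tword_class R M `
         {x \<in> carrier (free_Abelian_group S). \<forall>w\<in>Poly_Mapping.keys x. tword_degree w = n})\<rparr>)"

definition tensor_algebra_bimodule ::
    "('k, 'r, 'x) module_scheme \<Rightarrow> ('r, 'm, 'y) bimodule_scheme \<Rightarrow> ('r, ('r, 'm) tensor_word_class) bimodule" where
  "tensor_algebra_bimodule R M = bimodule_via (tensor_scalar R M) (tensor_algebra R M)"

definition tensor_algebra_left_module ::
    "('k, 'r, 'x) module_scheme \<Rightarrow> ('r, 'm, 'y) bimodule_scheme \<Rightarrow> ('r, ('r, 'm) tensor_word_class) graded_module" where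
  "tensor_algebra_left_module R M =
     (let N = tensor_algebra_bimodule R M in
      \<lparr>carrier = carrier N, monoid.mult = monoid.mult N, one = one N, ring.zero = ring.zero N, add = add N, smult = smult N,
       homog = homog (tensor_algebra R M)\<rparr>)"

text \<open>\<open>A \<otimes>\<^sub>B T\<^sub>B(A/B)\<close> as a graded left \<open>A\<close>-module: its component of degree \<open>n\<close> is the image of
  \<open>A \<otimes>\<^sub>B T\<^sub>B\<^sup>n(A/B)\<close>, i.e. the subgroup generated by the \<open>a \<otimes> t\<close> with \<open>t\<close> homogeneous of degree \<open>n\<close>.\<close>

definition induced_tensor_algebra ::
    "('k, 'a, 'x) module_scheme \<Rightarrow> 'a set \<Rightarrow> ('a, ('a, ('a, 'a set) tensor_word_class) tensor) graded_module" where
  "induced_tensor_algebra A B =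
     (let R = A\<lparr>carrier := B\<rparr>; M = quotient_bimodule A B;
          N = tensor_algebra_bimodule R M; P = tensor_product B (self_bimodule A) N in
      \<lparr>carrier = carrier P, monoid.mult = monoid.mult P, one = one P, ring.zero = ring.zero P, add = add P, smult = smult P,
       homog = (\<lambda>n. generate (add_monoid P)
         {tensor_class B (self_bimodule A) N (frag_of (a, t)) | a t.
            a \<in> carrier A \<and> t \<in> homog (tensor_algebra R M) n})\<rparr>)"

end

theory Submission
  imports Defs
begin

text \<open>Write \<open>\<Omega>\<close> for \<open>\<Omega>\<^sup>1\<^sub>n\<^sub>c(A/B)\<close>, \<open>T\<close> for \<open>T\<^sub>A \<Omega>\<close> and \<open>\<delta>a = 1 \<otimes> a - a \<otimes> 1 \<in> \<Omega>\<close>.  Then \<open>\<delta>\<close> is a derivation that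
  vanishes on \<open>B\<close>, and an element \<open>\<Sum> x\<^sub>i \<otimes> y\<^sub>i\<close> of \<open>\<Omega>\<close>, for which \<open>\<Sum> x\<^sub>i y\<^sub>i = 0\<close>, equals \<open>\<Sum> x\<^sub>i \<delta>y\<^sub>i\<close>.  The proof
  shows that \<open>T\<close> itself carries a differential which makes it initial; initial objects being unique up
  to isomorphism, this gives the first isomorphism for every envelope.

  All maps out of a tensor algebra \<open>T\<^sub>R M\<close> come from one principle (locale \<open>tensor_module\<close>): a left
  \<open>R\<close>-module \<open>H\<close> together with a map of \<open>R\<close>-bimodules from \<open>M\<close> to the additive endomorphisms of \<open>H\<close>
  is a left module over \<open>T\<^sub>R M\<close>, and evaluation \<open>t \<mapsto> t e\<close> at an element \<open>e\<close> of \<open>H\<close> is the map wanted.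
  It is used five times.

  \<^item> With \<open>H = T\<^sub>R M\<close> it shows that the product of the tensor algebra is well defined and associative.

  \<^item> With \<open>H = T \<times> T\<close>, on which \<open>T\<close> acts by \<open>t (x, y) = (t x, dt x \<plusminus> t y)\<close>, it constructs the differential
  \<open>d\<close>.  On generators \<open>da = \<delta>a\<close>, and on \<open>\<Omega>\<close> the differential is induced by the map
  \<open>x \<otimes> y \<mapsto> \<delta>x \<delta>y\<close>, which is defined on all of \<open>A \<otimes>\<^sub>B A\<close> since \<open>\<delta>\<close> is linear over \<open>B\<close> on both sides.

  \<^item> With \<open>H = E\<close> for an object \<open>g : A \<rightarrow> E\<close> of the category, it constructs the morphism \<open>T \<rightarrow> E\<close>: it is
  \<open>g\<close> on \<open>A\<close> and sends \<open>\<Sum> x\<^sub>i \<otimes> y\<^sub>i\<close> in \<open>\<Omega>\<close> to \<open>\<Sum> g x\<^sub>i dg y\<^sub>i\<close>.  It is unique because \<open>T\<close> is generated by \<open>A\<close> and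
  \<open>dA\<close>.

  \<^item> With \<open>H = F = A \<otimes>\<^sub>B T\<^sub>B(A/B)\<close> it constructs the map of left \<open>A\<close>-modules \<open>\<chi> : T \<rightarrow> F\<close>, evaluation at \<open>1 \<otimes> 1\<close>.
  Here \<open>x \<otimes> y\<close> in \<open>A \<otimes>\<^sub>B A\<close> acts by \<open>a \<otimes> t \<mapsto> x \<otimes> [ya] t\<close>, where \<open>[c]\<close> is the class of \<open>c\<close> in \<open>A/B\<close>, so that \<open>\<delta>a\<close>
  sends \<open>1 \<otimes> t\<close> to \<open>1 \<otimes> [a] t\<close>.

  \<^item> Over \<open>B\<close>, with \<open>H = T\<close>, it constructs \<open>T\<^sub>B(A/B) \<rightarrow> T\<close>, \<open>[a\<^sub>1] \<dots> [a\<^sub>n] \<mapsto> \<delta>a\<^sub>1 \<dots> \<delta>a\<^sub>n\<close>, and hence the inverse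
  \<open>\<kappa>\<close> of \<open>\<chi>\<close>, namely \<open>a \<otimes> [a\<^sub>1] \<dots> [a\<^sub>n] \<mapsto> a \<delta>a\<^sub>1 \<dots> \<delta>a\<^sub>n\<close>.\<close>
section \<open>Additive maps and presented abelian groups\<close>

text \<open>Additive maps between structures with an addition; only the values on the carrier matter.\<close>

definition add_hom :: "('a, 'x) ring_scheme \<Rightarrow> ('b, 'y) ring_scheme \<Rightarrow> ('a \<Rightarrow> 'b) set" where
  "add_hom G H = {f \<in> carrier G \<rightarrow> carrier H.
     \<forall>x\<in>carrier G. \<forall>y\<in>carrier G. f (x \<oplus>\<^bsub>G\<^esub> y) = f x \<oplus>\<^bsub>H\<^esub> f y}"

lemma add_homI:
  "\<lbrakk>\<And>x. x \<in> carrier G \<Longrightarrow> f x \<in> carrier H;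
    \<And>x y. \<lbrakk>x \<in> carrier G; y \<in> carrier G\<rbrakk> \<Longrightarrow> f (x \<oplus>\<^bsub>G\<^esub> y) = f x \<oplus>\<^bsub>H\<^esub> f y\<rbrakk> \<Longrightarrow> f \<in> add_hom G H"
  by (auto simp: add_hom_def)

lemma add_hom_closed: "\<lbrakk>f \<in> add_hom G H; x \<in> carrier G\<rbrakk> \<Longrightarrow> f x \<in> carrier H"
  by (auto simp: add_hom_def)

lemma add_hom_add:
  "\<lbrakk>f \<in> add_hom G H; x \<in> carrier G; y \<in> carrier G\<rbrakk> \<Longrightarrow> f (x \<oplus>\<^bsub>G\<^esub> y) = f x \<oplus>\<^bsub>H\<^esub> f y"
  by (auto simp: add_hom_def)

lemma add_hom_zero:
  assumes "abelian_group G" "abelian_group H" "f \<in> add_hom G H"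
  shows "f \<zero>\<^bsub>G\<^esub> = \<zero>\<^bsub>H\<^esub>"
proof -
  interpret G: abelian_group G by fact
  interpret H: abelian_group H by fact
  have c: "f \<zero>\<^bsub>G\<^esub> \<in> carrier H" using assms(3) by (simp add: add_hom_closed)
  have "f \<zero>\<^bsub>G\<^esub> \<oplus>\<^bsub>H\<^esub> f \<zero>\<^bsub>G\<^esub> = f \<zero>\<^bsub>G\<^esub>"
    using add_hom_add[OF assms(3), of "\<zero>\<^bsub>G\<^esub>" "\<zero>\<^bsub>G\<^esub>"] by simp
  then show ?thesis using c by (metis H.add.r_cancel_one)
qed

lemma add_hom_minus:
  assumes "abelian_group G" "abelian_group H" "f \<in> add_hom G H" "x \<in> carrier G"
  shows "f (\<ominus>\<^bsub>G\<^esub> x) = \<ominus>\<^bsub>H\<^esub> f x"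
proof -
  interpret G: abelian_group G by fact
  interpret H: abelian_group H by fact
  have "f (\<ominus>\<^bsub>G\<^esub> x) \<oplus>\<^bsub>H\<^esub> f x = \<zero>\<^bsub>H\<^esub>"
    using add_hom_add[OF assms(3), of "\<ominus>\<^bsub>G\<^esub> x" x] assms add_hom_zero[OF assms(1-3)]
    by (simp add: G.l_neg)
  then show ?thesis
    using assms by (simp add: H.minus_equality add_hom_closed)
qed

lemma add_hom_diff:
  assumes "abelian_group G" "abelian_group H" "f \<in> add_hom G H" "x \<in> carrier G" "y \<in> carrier G"
  shows "f (x \<ominus>\<^bsub>G\<^esub> y) = f x \<ominus>\<^bsub>H\<^esub> f y"
proof -
  interpret G: abelian_group G by fact
  show ?thesis using assms by (simp add: a_minus_def add_hom_add add_hom_minus)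
qed

text \<open>The laws of abelian groups, registered with the method \<open>algebra\<close>, which knows those of rings.\<close>

lemmas (in abelian_group) abelian_group_simprules
  [algebra ab_group "ring.zero G" "add G" "a_inv G" "a_minus G"] =
  a_closed zero_closed a_inv_closed minus_closed a_assoc l_zero l_neg a_comm minus_eq
  r_zero r_neg r_neg2 r_neg1 minus_add minus_minus a_lcomm

lemma (in abelian_group) diff_eq_iff:
  assumes "x \<in> carrier G" "y \<in> carrier G" "z \<in> carrier G"
  shows "x \<ominus> y = z \<longleftrightarrow> x = z \<oplus> y"
proof
  assume "x \<ominus> y = z"
  then have "z \<oplus> y = (x \<ominus> y) \<oplus> y" by simp
  also have "\<dots> = x" using assms by algebra
  finally show "x = z \<oplus> y" by simp
next
  assume "x = z \<oplus> y"
  then have "x \<ominus> y = (z \<oplus> y) \<ominus> y" by simp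
  also have "\<dots> = z" using assms by algebra
  finally show "x \<ominus> y = z" .
qed

lemma (in abelian_group) telescope:
  "\<lbrakk>x \<in> carrier G; y \<in> carrier G; z \<in> carrier G\<rbrakk> \<Longrightarrow> (x \<ominus> y) \<oplus> (y \<ominus> z) = x \<ominus> z"
  by algebra

lemma add_hom_ident: "(\<lambda>x. x) \<in> add_hom G G"
  by (auto intro: add_homI)

lemma add_hom_comp: "g \<in> add_hom H L \<Longrightarrow> f \<in> add_hom G H \<Longrightarrow> (\<lambda>x. g (f x)) \<in> add_hom G L"
  by (auto simp: add_hom_def)

lemma (in abelian_group) add_hom_plus:
  "f \<in> add_hom Y G \<Longrightarrow> g \<in> add_hom Y G \<Longrightarrow> (\<lambda>x. f x \<oplus> g x) \<in> add_hom Y G"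
  by (auto simp: add_hom_def Pi_def a_ac)

lemma (in abelian_group) add_hom_neg:
  "f \<in> add_hom Y G \<Longrightarrow> (\<lambda>x. \<ominus> f x) \<in> add_hom Y G"
  by (auto simp: add_hom_def Pi_def minus_add)

lemma (in abelian_group) add_hom_sub:
  "f \<in> add_hom Y G \<Longrightarrow> g \<in> add_hom Y G \<Longrightarrow> (\<lambda>x. f x \<ominus> g x) \<in> add_hom Y G"
  unfolding a_minus_def by (intro add_hom_plus add_hom_neg)

lemma (in abelian_group) add_hom_0: "(\<lambda>x. \<zero>) \<in> add_hom Y G"
  by (auto simp: add_hom_def)

lemma (in ring) add_hom_lmult:
  "a \<in> carrier R \<Longrightarrow> f \<in> add_hom Y R \<Longrightarrow> (\<lambda>x. a \<otimes> f x) \<in> add_hom Y R"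
  by (auto simp: add_hom_def Pi_def r_distr)

lemma (in ring) add_hom_rmult:
  "a \<in> carrier R \<Longrightarrow> f \<in> add_hom Y R \<Longrightarrow> (\<lambda>x. f x \<otimes> a) \<in> add_hom Y R"
  by (auto simp: add_hom_def Pi_def l_distr)

lemmas frag_induct = free_Abelian_group_induct [consumes 1, case_names zero diff gen]

text \<open>The additive extension of a map \<open>h\<close> from the generators to an abelian group \<open>H\<close>, evaluated at a
  formal integer combination of generators.\<close>

definition frag_sum :: "('b, 'y) ring_scheme \<Rightarrow> ('w \<Rightarrow> 'b) \<Rightarrow> ('w \<Rightarrow>\<^sub>0 int) \<Rightarrow> 'b" where
  "frag_sum H h x = finsum H (\<lambda>w. [Poly_Mapping.lookup x w] \<cdot>\<^bsub>H\<^esub> h w) (Poly_Mapping.keys x)"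

context abelian_group
begin

lemma frag_sum_zero: "frag_sum G h 0 = \<zero>"
  by (simp add: frag_sum_def)

lemma frag_sum_of: "h w \<in> carrier G \<Longrightarrow> frag_sum G h (frag_of w) = h w"
  by (simp add: frag_sum_def finsum_insert[of "{}", simplified] add.int_pow_1)

lemma frag_sum_closed: "h \<in> Poly_Mapping.keys x \<rightarrow> carrier G \<Longrightarrow> frag_sum G h x \<in> carrier G"
  by (auto simp: frag_sum_def intro!: finsum_closed add.int_pow_closed)

lemma frag_sum_superset:
  assumes "h \<in> S \<rightarrow> carrier G" "finite S" "Poly_Mapping.keys x \<subseteq> S"
  shows "frag_sum G h x = finsum G (\<lambda>w. [Poly_Mapping.lookup x w] \<cdot> h w) S"
proof -
  have zero: "[(0::int)] \<cdot> a = \<zero>" for a by (simp add: add_pow_def int_pow_0)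
  show ?thesis
    unfolding frag_sum_def
  by (rule add.finprod_mono_neutral_cong_left)
     (use assms in \<open>auto simp: in_keys_iff zero intro!: add.int_pow_closed\<close>)
qed

lemma frag_sum_diff:
  assumes "h \<in> S \<rightarrow> carrier G" "Poly_Mapping.keys x \<subseteq> S" "Poly_Mapping.keys y \<subseteq> S"
  shows "frag_sum G h (x - y) = frag_sum G h x \<ominus> frag_sum G h y"
proof -
  let ?F = "Poly_Mapping.keys x \<union> Poly_Mapping.keys y"
  have F: "h \<in> ?F \<rightarrow> carrier G" "finite ?F" using assms by auto
  have hc: "\<And>w. w \<in> ?F \<Longrightarrow> h w \<in> carrier G" using F by auto
  have add: "frag_sum G h (u + v) = frag_sum G h u \<oplus> frag_sum G h v"
    if "Poly_Mapping.keys u \<subseteq> ?F" "Poly_Mapping.keys v \<subseteq> ?F" for u v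
  proof -
    have "Poly_Mapping.keys (u + v) \<subseteq> ?F" using that keys_add[of u v] by blast
    then show ?thesis
      using F that hc
      by (simp add: frag_sum_superset[OF F] Poly_Mapping.lookup_add add.int_pow_mult
          flip: finsum_addf cong: finsum_cong)
  qed
  have k: "Poly_Mapping.keys (x - y) \<subseteq> ?F" using keys_diff[of x y] by blast
  have c: "frag_sum G h (x - y) \<in> carrier G" "frag_sum G h x \<in> carrier G" "frag_sum G h y \<in> carrier G"
    using k hc by (auto intro!: frag_sum_closed)
  have "frag_sum G h x = frag_sum G h (x - y) \<oplus> frag_sum G h y"
    using add[of "x - y" y] k by simp
  then have "frag_sum G h x \<ominus> frag_sum G h y
      = frag_sum G h (x - y) \<oplus> (frag_sum G h y \<oplus> \<ominus> frag_sum G h y)"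
    using c by (simp add: a_minus_def a_assoc)
  then show ?thesis using c by (simp add: r_neg)
qed

end

lemma (in abelian_group) frag_sum_cong:
  assumes "\<And>w. w \<in> Poly_Mapping.keys x \<Longrightarrow> h w = g w" "\<And>w. w \<in> Poly_Mapping.keys x \<Longrightarrow> g w \<in> carrier G"
  shows "frag_sum G h x = frag_sum G g x"
  unfolding frag_sum_def
proof (rule finsum_cong')
  show "(\<lambda>w. [Poly_Mapping.lookup x w] \<cdot> g w) \<in> Poly_Mapping.keys x \<rightarrow> carrier G"
    using assms(2) by (auto intro!: add.int_pow_closed)
qed (use assms(1) in auto)

text \<open>The map out of a presented group induced by a map \<open>h\<close> of generators.  Elements of a presented group
  are cosets, on which \<open>frag_sum H h\<close> is constant as soon as it kills the relators.\<close>

definition lift_map :: "('b, 'y) ring_scheme \<Rightarrow> ('w \<Rightarrow> 'b) \<Rightarrow> ('w \<Rightarrow>\<^sub>0 int) set \<Rightarrow> 'b" where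
  "lift_map H h U = the_elem (frag_sum H h ` U)"

text \<open>A structure whose additive group is the abelian group presented by generators \<open>S\<close> and relators \<open>Q\<close>.
  The other fields of the record are arbitrary, so that tensor products and tensor algebras are both
  instances.\<close>

locale presented =
  fixes G :: "(('w \<Rightarrow>\<^sub>0 int) set, 'x) ring_scheme" (structure)
    and S :: "'w set" and Q :: "('w \<Rightarrow>\<^sub>0 int) set"
  assumes carrier_eq: "carrier G = carrier (presented_group S Q)"
    and add_eq: "add G = monoid.mult (presented_group S Q)"
    and zero_eq: "\<zero> = one (presented_group S Q)"
    and relators: "q \<in> Q \<Longrightarrow> Poly_Mapping.keys q \<subseteq> S"
begin

abbreviation "cls \<equiv> presented_class S Q"
abbreviation "gen w \<equiv> presented_class S Q (frag_of w)"

lemma span_subgroup: "subgroup (relators_span S Q) (free_Abelian_group S)"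
  unfolding relators_span_def
  by (rule group.generate_is_subgroup) (use relators in auto)

lemma span_normal: "relators_span S Q \<lhd> free_Abelian_group S"
  by (simp add: abelian_free_Abelian_group comm_group.subgroup_imp_normal span_subgroup)

lemma cls_eq: "cls x = (\<lambda>n. n + x) ` relators_span S Q"
  by (auto simp: presented_class_def r_coset_def)

lemma mem_cls: "x \<in> cls x"
  unfolding cls_eq
  by (rule image_eqI[of _ _ 0]) (use subgroup.one_closed[OF span_subgroup] in auto)

lemma cls_eqD: "y \<in> cls x \<Longrightarrow> Poly_Mapping.keys x \<subseteq> S \<Longrightarrow> Poly_Mapping.keys y \<subseteq> S"
  using subgroup.subset[OF span_subgroup] unfolding cls_eq
  by (force dest: subsetD[OF keys_add])

lemma cls_cong: "y \<in> cls x \<Longrightarrow> Poly_Mapping.keys x \<subseteq> S \<Longrightarrow> cls y = cls x"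
  using group.repr_independence[OF group_free_Abelian_group _ _ span_subgroup, of y x]
  unfolding presented_class_def by simp

lemma cls_closed: "Poly_Mapping.keys x \<subseteq> S \<Longrightarrow> cls x \<in> carrier G"
  by (auto simp: carrier_eq presented_group_def FactGroup_def RCOSETS_def presented_class_def)

lemma cls_surj:
  assumes "U \<in> carrier G"
  obtains x where "Poly_Mapping.keys x \<subseteq> S" "U = cls x"
  using assms by (auto simp: carrier_eq presented_group_def FactGroup_def RCOSETS_def presented_class_def)

lemma cls_add:
  "Poly_Mapping.keys x \<subseteq> S \<Longrightarrow> Poly_Mapping.keys y \<subseteq> S \<Longrightarrow> cls (x + y) = cls x \<oplus> cls y"
  using normal.rcos_sum[OF span_normal, of x y]
  by (simp add: add_eq presented_group_def FactGroup_def presented_class_def)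

lemma cls_zero: "cls 0 = \<zero>"
  using group.coset_mult_one[OF group_free_Abelian_group subgroup.subset[OF span_subgroup]]
  by (simp add: zero_eq presented_group_def FactGroup_def presented_class_def)

lemma is_abelian_group: "abelian_group G"
proof (rule abelian_groupI)
  fix U assume "U \<in> carrier G"
  then obtain x where x: "Poly_Mapping.keys x \<subseteq> S" "U = cls x" by (rule cls_surj)
  have "cls (- x) \<oplus> U = \<zero>" using x by (simp flip: cls_add cls_zero)
  then show "\<exists>y\<in>carrier G. y \<oplus> U = \<zero>" using x cls_closed[of "- x"] by auto
next
  have "cls 0 \<in> carrier G" by (rule cls_closed) simp
  then show "\<zero> \<in> carrier G" by (simp add: cls_zero)
next
  fix U V assume "U \<in> carrier G" "V \<in> carrier G"
  then obtain x y where xy: "Poly_Mapping.keys x \<subseteq> S" "U = cls x" "Poly_Mapping.keys y \<subseteq> S" "V = cls y"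
    using cls_surj by metis
  have "Poly_Mapping.keys (x + y) \<subseteq> S" using xy keys_add[of x y] by blast
  then show "U \<oplus> V \<in> carrier G" using xy cls_closed[of "x + y"] by (simp add: cls_add)
  show "U \<oplus> V = V \<oplus> U" using xy by (simp add: add.commute flip: cls_add)
  fix W assume "W \<in> carrier G"
  then obtain z where z: "Poly_Mapping.keys z \<subseteq> S" "W = cls z" by (rule cls_surj)
  have "Poly_Mapping.keys (y + z) \<subseteq> S" using xy z keys_add[of y z] by blast
  then show "U \<oplus> V \<oplus> W = U \<oplus> (V \<oplus> W)"
    using xy z \<open>Poly_Mapping.keys (x + y) \<subseteq> S\<close> by (simp add: add.assoc flip: cls_add)
next
  fix U assume "U \<in> carrier G"
  then obtain x where x: "Poly_Mapping.keys x \<subseteq> S" "U = cls x" by (rule cls_surj)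
  then show "\<zero> \<oplus> U = U" using cls_add[of 0 x] by (simp add: cls_zero)
qed

sublocale G: abelian_group G by (rule is_abelian_group)

lemma cls_diff:
  assumes "Poly_Mapping.keys x \<subseteq> S" "Poly_Mapping.keys y \<subseteq> S"
  shows "cls (x - y) = cls x \<ominus> cls y"
proof -
  have k: "Poly_Mapping.keys (x - y) \<subseteq> S" using assms keys_diff[of x y] by blast
  have "cls x = cls (x - y) \<oplus> cls y" using cls_add[OF k assms(2)] by simp
  then show ?thesis
    using cls_closed[OF k] cls_closed[OF assms(2)]
    by (simp add: a_minus_def G.a_assoc G.r_neg)
qed

lemma gen_closed: "w \<in> S \<Longrightarrow> gen w \<in> carrier G"
  by (rule cls_closed) simp

lemma cls_relator: "q \<in> Q \<Longrightarrow> cls q = \<zero>"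
proof -
  assume "q \<in> Q"
  then have "q \<in> relators_span S Q" unfolding relators_span_def by (rule generate.incl)
  then have "q \<in> cls 0" by (simp add: cls_eq)
  then show ?thesis using cls_cong[of q 0] by (simp add: cls_zero)
qed

lemma presented_induct [consumes 1, case_names zero diff gen]:
  assumes "U \<in> carrier G" "P \<zero>"
    "\<And>U V. \<lbrakk>U \<in> carrier G; V \<in> carrier G; P U; P V\<rbrakk> \<Longrightarrow> P (U \<ominus> V)"
    "\<And>w. w \<in> S \<Longrightarrow> P (gen w)"
  shows "P U"
proof -
  obtain x where x: "Poly_Mapping.keys x \<subseteq> S" "U = cls x" using assms(1) by (rule cls_surj)
  have "P (cls x)" using x(1)
    by (induction x rule: frag_induct)
       (use assms in \<open>auto simp: cls_zero cls_diff cls_closed\<close>)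
  then show ?thesis using x by simp
qed

lemma add_hom_eqI:
  assumes "abelian_group H" "f \<in> add_hom G H" "g \<in> add_hom G H"
    "\<And>w. w \<in> S \<Longrightarrow> f (gen w) = g (gen w)" "U \<in> carrier G"
  shows "f U = g U"
  using assms(5)
proof (induction rule: presented_induct)
  case zero
  then show ?case using assms by (simp add: add_hom_zero[OF G.abelian_group_axioms])
next
  case (diff U V)
  then show ?case using assms by (simp add: add_hom_diff[OF G.abelian_group_axioms])
qed (use assms in auto)

lemma add_hom_cls:
  assumes "abelian_group H" "f \<in> add_hom G H" "Poly_Mapping.keys x \<subseteq> S"
  shows "f (cls x) = frag_sum H (\<lambda>w. f (gen w)) x"
  using assms(3)
proof (induction x rule: frag_induct)
  case zero
  then show ?case using assms
    by (simp add: cls_zero add_hom_zero[OF G.abelian_group_axioms] abelian_group.frag_sum_zero)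
next
  case (diff x y)
  have "(\<lambda>w. f (gen w)) \<in> S \<rightarrow> carrier H"
    using assms(2) gen_closed by (auto intro: add_hom_closed)
  from abelian_group.frag_sum_diff[OF assms(1) this diff(1,2)]
  show ?case using diff assms
    by (simp add: cls_diff cls_closed add_hom_diff[OF G.abelian_group_axioms])
next
  case (gen a)
  then show ?case
    using assms by (simp add: abelian_group.frag_sum_of gen_closed add_hom_closed)
qed

text \<open>The class of an extension of a map between formal combinations is computed in the quotient.\<close>

lemma cls_frag_extend:
  assumes "\<And>w. w \<in> S \<Longrightarrow> Poly_Mapping.keys (h w) \<subseteq> S" "Poly_Mapping.keys x \<subseteq> S"
  shows "cls (frag_extend h x) = frag_sum G (\<lambda>w. cls (h w)) x \<and> Poly_Mapping.keys (frag_extend h x) \<subseteq> S"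
  using assms(2)
proof (induction x rule: frag_induct)
  case zero
  then show ?case by (simp add: cls_zero G.frag_sum_zero)
next
  case (diff x y)
  have "(\<lambda>w. cls (h w)) \<in> S \<rightarrow> carrier G" using assms cls_closed by auto
  from G.frag_sum_diff[OF this diff(1,2)] show ?case
    using diff keys_diff[of "frag_extend h x" "frag_extend h y"] by (auto simp: cls_diff frag_extend_diff)
next
  case (gen a)
  then show ?case using assms by (simp add: G.frag_sum_of cls_closed)
qed

lemma
  assumes H: "abelian_group H" and h: "\<And>w. w \<in> S \<Longrightarrow> h w \<in> carrier H"
    and q: "\<And>q. q \<in> Q \<Longrightarrow> frag_sum H h q = \<zero>\<^bsub>H\<^esub>"
  shows lift_map_cls: "Poly_Mapping.keys x \<subseteq> S \<Longrightarrow> lift_map H h (cls x) = frag_sum H h x"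
    and lift_map_add_hom: "lift_map H h \<in> add_hom G H"
    and lift_map_gen: "w \<in> S \<Longrightarrow> lift_map H h (gen w) = h w"
proof -
  interpret H: abelian_group H by fact
  have h': "h \<in> S \<rightarrow> carrier H" using h by auto
  have c: "frag_sum H h x \<in> carrier H" if "Poly_Mapping.keys x \<subseteq> S" for x
    using that h by (auto intro!: H.frag_sum_closed)
  have plus: "frag_sum H h (x + y) = frag_sum H h x \<oplus>\<^bsub>H\<^esub> frag_sum H h y"
    if "Poly_Mapping.keys x \<subseteq> S" "Poly_Mapping.keys y \<subseteq> S" for x y
    using H.frag_sum_diff[OF h', of x "- y"] H.frag_sum_diff[OF h', of 0 y] that c
    by (simp add: H.frag_sum_zero a_minus_def)
  have zero: "frag_sum H h n = \<zero>\<^bsub>H\<^esub>" if "n \<in> relators_span S Q" for n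
    using that unfolding relators_span_def
  proof (induction rule: generate.induct)
    case one then show ?case by (simp add: H.frag_sum_zero)
  next
    case (incl q) then show ?case by (rule q)
  next
    case (inv q)
    have "Poly_Mapping.keys q \<subseteq> S" using inv relators by blast
    then show ?case using H.frag_sum_diff[OF h', of 0 q] q[OF inv] by (simp add: H.frag_sum_zero a_minus_def)
  next
    case (eng h1 h2)
    have "Poly_Mapping.keys h1 \<subseteq> S" "Poly_Mapping.keys h2 \<subseteq> S"
      using subsetD[OF subgroup.subset[OF span_subgroup]] eng(1,2)
      unfolding relators_span_def by simp_all
    then show ?case using eng by (simp add: plus)
  qed
  show cl: "lift_map H h (cls x) = frag_sum H h x" if x: "Poly_Mapping.keys x \<subseteq> S" for x
  proof -
    have "frag_sum H h y = frag_sum H h x" if y: "y \<in> cls x" for y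
    proof -
      obtain n where n: "n \<in> relators_span S Q" "y = n + x" using y by (auto simp: cls_eq)
      moreover have "Poly_Mapping.keys n \<subseteq> S" using n subsetD[OF subgroup.subset[OF span_subgroup]] by simp
      ultimately show ?thesis using x plus[of n x] zero[of n] c by simp
    qed
    then have "frag_sum H h ` cls x = {frag_sum H h x}" using mem_cls[of x] by blast
    then show ?thesis by (simp add: lift_map_def)
  qed
  show "lift_map H h (gen w) = h w" if "w \<in> S"
    using that by (simp add: cl H.frag_sum_of h)
  show "lift_map H h \<in> add_hom G H"
  proof (rule add_homI)
    fix U V assume "U \<in> carrier G" "V \<in> carrier G"
    then obtain x y where xy: "Poly_Mapping.keys x \<subseteq> S" "U = cls x" "Poly_Mapping.keys y \<subseteq> S" "V = cls y"
      using cls_surj by metis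
    have "Poly_Mapping.keys (x + y) \<subseteq> S" using xy keys_add[of x y] by blast
    then show "lift_map H h (U \<oplus> V) = lift_map H h U \<oplus>\<^bsub>H\<^esub> lift_map H h V"
      using xy by (simp add: cl plus flip: cls_add)
  next
    fix U assume "U \<in> carrier G"
    then obtain x where "Poly_Mapping.keys x \<subseteq> S" "U = cls x" by (rule cls_surj)
    then show "lift_map H h U \<in> carrier H" by (simp add: cl c)
  qed
qed

text \<open>An induced endomorphism of a presented group, given as a union over representatives, agrees with any
  additive map that has the same values on the generators.\<close>

lemma presented_map_eq:
  assumes f: "f \<in> add_hom G G" and h: "\<And>w. w \<in> S \<Longrightarrow> h w \<in> S"
    and g: "\<And>w. w \<in> S \<Longrightarrow> f (gen w) = gen (h w)" and U: "U \<in> carrier G"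
  shows "presented_map S Q h U = f U"
proof -
  obtain x where x: "Poly_Mapping.keys x \<subseteq> S" "U = cls x" using U by (rule cls_surj)
  have "cls (frag_extend (\<lambda>w. frag_of (h w)) y) = f U" if y: "y \<in> U" for y
  proof -
    have k: "Poly_Mapping.keys y \<subseteq> S" and e: "cls y = U" using x y cls_eqD[of y x] cls_cong[of y x] by simp_all
    have "cls (frag_extend (\<lambda>w. frag_of (h w)) y) = frag_sum G (\<lambda>w. gen (h w)) y"
      by (rule conjunct1, rule cls_frag_extend) (use h k in auto)
    also have "\<dots> = frag_sum G (\<lambda>w. f (gen w)) y"
      unfolding frag_sum_def
    proof (rule G.finsum_cong')
      show "(\<lambda>w. [Poly_Mapping.lookup y w] \<cdot> f (gen w)) \<in> Poly_Mapping.keys y \<rightarrow> carrier G"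
        using k by (auto intro!: G.add.int_pow_closed gen_closed add_hom_closed[OF f])
    qed (use k g in auto)
    also have "\<dots> = f (cls y)" using add_hom_cls[OF is_abelian_group f k] by simp
    finally show ?thesis by (simp add: e)
  qed
  moreover have "U \<noteq> {}" using x mem_cls by auto
  ultimately show ?thesis by (auto simp: presented_map_def)
qed

end



section \<open>Bimodules and tensor products\<close>

text \<open>Unital bimodules over a ring that need not be commutative.\<close>

locale bimodule = R?: ring R + M?: abelian_group M
  for R :: "('r, 'x) ring_scheme" (structure) and M :: "('r, 'm, 'y) bimodule_scheme" (structure) +
  assumes smult_closed: "\<lbrakk>r \<in> carrier R; x \<in> carrier M\<rbrakk> \<Longrightarrow> r \<odot>\<^bsub>M\<^esub> x \<in> carrier M"
    and rsmult_closed: "\<lbrakk>x \<in> carrier M; r \<in> carrier R\<rbrakk> \<Longrightarrow> rsmult M x r \<in> carrier M"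
    and smult_l_distr: "\<lbrakk>r \<in> carrier R; s \<in> carrier R; x \<in> carrier M\<rbrakk>
      \<Longrightarrow> (r \<oplus>\<^bsub>R\<^esub> s) \<odot>\<^bsub>M\<^esub> x = r \<odot>\<^bsub>M\<^esub> x \<oplus>\<^bsub>M\<^esub> s \<odot>\<^bsub>M\<^esub> x"
    and smult_r_distr: "\<lbrakk>r \<in> carrier R; x \<in> carrier M; y \<in> carrier M\<rbrakk>
      \<Longrightarrow> r \<odot>\<^bsub>M\<^esub> (x \<oplus>\<^bsub>M\<^esub> y) = r \<odot>\<^bsub>M\<^esub> x \<oplus>\<^bsub>M\<^esub> r \<odot>\<^bsub>M\<^esub> y"
    and rsmult_r_distr: "\<lbrakk>x \<in> carrier M; r \<in> carrier R; s \<in> carrier R\<rbrakk>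
      \<Longrightarrow> rsmult M x (r \<oplus>\<^bsub>R\<^esub> s) = rsmult M x r \<oplus>\<^bsub>M\<^esub> rsmult M x s"
    and rsmult_l_distr: "\<lbrakk>x \<in> carrier M; y \<in> carrier M; r \<in> carrier R\<rbrakk>
      \<Longrightarrow> rsmult M (x \<oplus>\<^bsub>M\<^esub> y) r = rsmult M x r \<oplus>\<^bsub>M\<^esub> rsmult M y r"
    and smult_assoc: "\<lbrakk>r \<in> carrier R; s \<in> carrier R; x \<in> carrier M\<rbrakk>
      \<Longrightarrow> (r \<otimes>\<^bsub>R\<^esub> s) \<odot>\<^bsub>M\<^esub> x = r \<odot>\<^bsub>M\<^esub> (s \<odot>\<^bsub>M\<^esub> x)"
    and rsmult_assoc: "\<lbrakk>x \<in> carrier M; r \<in> carrier R; s \<in> carrier R\<rbrakk>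
      \<Longrightarrow> rsmult M x (r \<otimes>\<^bsub>R\<^esub> s) = rsmult M (rsmult M x r) s"
    and smult_rsmult: "\<lbrakk>r \<in> carrier R; x \<in> carrier M; s \<in> carrier R\<rbrakk>
      \<Longrightarrow> rsmult M (r \<odot>\<^bsub>M\<^esub> x) s = r \<odot>\<^bsub>M\<^esub> rsmult M x s"
    and smult_one: "x \<in> carrier M \<Longrightarrow> \<one>\<^bsub>R\<^esub> \<odot>\<^bsub>M\<^esub> x = x"
    and rsmult_one: "x \<in> carrier M \<Longrightarrow> rsmult M x \<one>\<^bsub>R\<^esub> = x"

lemma (in ring) self_bimodule: "bimodule R (self_bimodule R)"
proof (rule bimodule.intro)
  show "abelian_group (self_bimodule R)"
    by (rule abelian_groupI) (auto simp: bimodule_via_def a_ac intro: bexI[of _ "\<ominus> _"] l_neg)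
qed (auto simp: bimodule_axioms_def bimodule_via_def l_distr r_distr m_assoc ring_axioms)

text \<open>The additive group \<open>M \<otimes>\<^sub>B N\<close> needs little: a right action of the set \<open>B\<close> on \<open>M\<close> and a left action on
  \<open>N\<close>, with no laws.\<close>

locale tensor = M?: abelian_group M + N?: abelian_group N
  for B :: "'r set" and M :: "('r, 'm, 'x) bimodule_scheme" and N :: "('r, 'n, 'y) bimodule_scheme" +
  assumes rsmult_B: "\<lbrakk>x \<in> carrier M; b \<in> B\<rbrakk> \<Longrightarrow> rsmult M x b \<in> carrier M"
    and smult_B: "\<lbrakk>y \<in> carrier N; b \<in> B\<rbrakk> \<Longrightarrow> b \<odot>\<^bsub>N\<^esub> y \<in> carrier N"
begin

abbreviation "P \<equiv> tensor_product B M N"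
text \<open>The pure tensor \<open>x \<otimes> y\<close>.\<close>

definition pure :: "'m \<Rightarrow> 'n \<Rightarrow> ('m, 'n) tensor" where
  "pure x y = tensor_class B M N (frag_of (x, y))"

lemma P_fields: "carrier P = carrier (presented_group (carrier M \<times> carrier N) (tensor_relators B M N))"
  "add P = monoid.mult (presented_group (carrier M \<times> carrier N) (tensor_relators B M N))"
  "\<zero>\<^bsub>P\<^esub> = one (presented_group (carrier M \<times> carrier N) (tensor_relators B M N))"
  by (simp_all add: tensor_product_def Let_def)

lemma relators_keys:
  assumes "q \<in> tensor_relators B M N"
  shows "Poly_Mapping.keys q \<subseteq> carrier M \<times> carrier N"
proof -
  have 3: "Poly_Mapping.keys (frag_of u - frag_of v - frag_of w) \<subseteq> {u, v, w}" for u v w :: "'m \<times> 'n"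
    using keys_diff[of "frag_of u - frag_of v" "frag_of w"] keys_diff[of "frag_of u" "frag_of v"] by auto
  have 2: "Poly_Mapping.keys (frag_of u - frag_of v) \<subseteq> {u, v}" for u v :: "'m \<times> 'n"
    using keys_diff[of "frag_of u" "frag_of v"] by auto
  show ?thesis
    using assms rsmult_B smult_B unfolding tensor_relators_def
    by (elim UnE CollectE exE conjE) (auto dest!: subsetD[OF 3] subsetD[OF 2])
qed

sublocale P: presented P "carrier M \<times> carrier N" "tensor_relators B M N"
  by (rule presented.intro) (simp_all add: P_fields relators_keys)

lemma pure_eq_gen: "pure x y = P.gen (x, y)"
  by (simp add: pure_def tensor_class_def)

lemma pure_closed: "x \<in> carrier M \<Longrightarrow> y \<in> carrier N \<Longrightarrow> pure x y \<in> carrier P"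
  unfolding pure_eq_gen by (rule P.gen_closed) simp

lemma pure_eqI:
  assumes "q \<in> tensor_relators B M N" "q = frag_of (x, y) - frag_of (x', y')"
    "x \<in> carrier M" "y \<in> carrier N" "x' \<in> carrier M" "y' \<in> carrier N"
  shows "pure x y = pure x' y'"
  using P.cls_relator[OF assms(1)] assms(2-)
  by (simp add: P.cls_diff pure_closed P.G.diff_eq_iff flip: pure_eq_gen)

lemma pure_addI:
  assumes "q \<in> tensor_relators B M N" "q = frag_of (x, y) - frag_of (x1, y1) - frag_of (x2, y2)"
    "x \<in> carrier M" "y \<in> carrier N" "x1 \<in> carrier M" "y1 \<in> carrier N" "x2 \<in> carrier M" "y2 \<in> carrier N"
  shows "pure x y = pure x1 y1 \<oplus>\<^bsub>P\<^esub> pure x2 y2"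
proof -
  have k: "Poly_Mapping.keys (frag_of (x, y) - frag_of (x1, y1)) \<subseteq> carrier M \<times> carrier N"
    using assms keys_diff[of "frag_of (x, y)" "frag_of (x1, y1)"] by auto
  \<comment> \<open>The relator \<open>q\<close> vanishes in the quotient.\<close>
  show ?thesis
    using P.cls_relator[OF assms(1)] assms(2-) k
    by (simp add: P.cls_diff pure_closed P.G.diff_eq_iff P.G.a_comm flip: pure_eq_gen)
qed

lemma pure_add_left: "\<lbrakk>x \<in> carrier M; x' \<in> carrier M; y \<in> carrier N\<rbrakk>
    \<Longrightarrow> pure (x \<oplus>\<^bsub>M\<^esub> x') y = pure x y \<oplus>\<^bsub>P\<^esub> pure x' y"
  by (rule pure_addI[OF _ refl]) (auto simp: tensor_relators_def)

lemma pure_add_right: "\<lbrakk>x \<in> carrier M; y \<in> carrier N; y' \<in> carrier N\<rbrakk>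
    \<Longrightarrow> pure x (y \<oplus>\<^bsub>N\<^esub> y') = pure x y \<oplus>\<^bsub>P\<^esub> pure x y'"
  by (rule pure_addI[OF _ refl]) (auto simp: tensor_relators_def)

lemma pure_balanced: "\<lbrakk>x \<in> carrier M; b \<in> B; y \<in> carrier N\<rbrakk>
    \<Longrightarrow> pure (rsmult M x b) y = pure x (b \<odot>\<^bsub>N\<^esub> y)"
  by (rule pure_eqI[OF _ refl]) (auto simp: tensor_relators_def rsmult_B smult_B)

lemma pure_hom_left: "y \<in> carrier N \<Longrightarrow> (\<lambda>x. pure x y) \<in> add_hom M P"
  by (rule add_homI) (simp_all add: pure_closed pure_add_left)

lemma pure_hom_right: "x \<in> carrier M \<Longrightarrow> (\<lambda>y. pure x y) \<in> add_hom N P"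
  by (rule add_homI) (simp_all add: pure_closed pure_add_right)

lemma tensor_induct [consumes 1, case_names zero diff pure]:
  assumes "U \<in> carrier P" "Pr \<zero>\<^bsub>P\<^esub>"
    "\<And>U V. \<lbrakk>U \<in> carrier P; V \<in> carrier P; Pr U; Pr V\<rbrakk> \<Longrightarrow> Pr (U \<ominus>\<^bsub>P\<^esub> V)"
    "\<And>x y. x \<in> carrier M \<Longrightarrow> y \<in> carrier N \<Longrightarrow> Pr (pure x y)"
  shows "Pr U"
  using assms(1) by (induction rule: P.presented_induct) (use assms in \<open>auto simp: pure_eq_gen\<close>)

lemma tensor_hom_eqI:
  assumes "abelian_group H" "f \<in> add_hom P H" "g \<in> add_hom P H"
    "\<And>x y. x \<in> carrier M \<Longrightarrow> y \<in> carrier N \<Longrightarrow> f (pure x y) = g (pure x y)" "U \<in> carrier P"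
  shows "f U = g U"
  by (rule P.add_hom_eqI[OF assms(1-3) _ assms(5)]) (use assms(4) in \<open>auto simp: pure_eq_gen\<close>)

lemma
  assumes H: "abelian_group H"
    and l: "\<And>y. y \<in> carrier N \<Longrightarrow> (\<lambda>x. h x y) \<in> add_hom M H"
    and r: "\<And>x. x \<in> carrier M \<Longrightarrow> (\<lambda>y. h x y) \<in> add_hom N H"
    and bal: "\<And>x b y. \<lbrakk>x \<in> carrier M; b \<in> B; y \<in> carrier N\<rbrakk> \<Longrightarrow> h (rsmult M x b) y = h x (b \<odot>\<^bsub>N\<^esub> y)"
  shows tensor_lift_hom: "lift_map H (\<lambda>(x, y). h x y) \<in> add_hom P H"
    and tensor_lift_pure: "\<lbrakk>x \<in> carrier M; y \<in> carrier N\<rbrakk> \<Longrightarrow> lift_map H (\<lambda>(x, y). h x y) (pure x y) = h x y"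
proof -
  interpret H: abelian_group H by fact
  let ?h = "\<lambda>(x, y). h x y" and ?S = "carrier M \<times> carrier N"
  have c: "h x y \<in> carrier H" if "x \<in> carrier M" "y \<in> carrier N" for x y
    using add_hom_closed[OF l] that by blast
  have hS: "?h \<in> ?S \<rightarrow> carrier H" using c by auto
  have s2: "frag_sum H ?h (frag_of u - frag_of v) = ?h u \<ominus>\<^bsub>H\<^esub> ?h v" if "u \<in> ?S" "v \<in> ?S" for u v
    using that H.frag_sum_diff[OF hS, of "frag_of u" "frag_of v"] c by (auto simp: H.frag_sum_of)
  have s3: "frag_sum H ?h (frag_of u - frag_of v - frag_of w) = ?h u \<ominus>\<^bsub>H\<^esub> ?h v \<ominus>\<^bsub>H\<^esub> ?h w"
    if "u \<in> ?S" "v \<in> ?S" "w \<in> ?S" for u v w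
  proof -
    have "Poly_Mapping.keys (frag_of u - frag_of v) \<subseteq> ?S"
      using keys_diff[of "frag_of u" "frag_of v"] that by auto
    then show ?thesis
      using that H.frag_sum_diff[OF hS, of "frag_of u - frag_of v" "frag_of w"] c
      by (auto simp: H.frag_sum_of s2)
  qed
  have canc: "a \<oplus>\<^bsub>H\<^esub> b \<ominus>\<^bsub>H\<^esub> a \<ominus>\<^bsub>H\<^esub> b = \<zero>\<^bsub>H\<^esub>" if "a \<in> carrier H" "b \<in> carrier H" for a b
    using that by algebra
  have q: "frag_sum H ?h q = \<zero>\<^bsub>H\<^esub>" if "q \<in> tensor_relators B M N" for q
    using that rsmult_B smult_B c canc unfolding tensor_relators_def
    by (elim UnE CollectE exE conjE)
       (auto simp: s2 s3 bal H.diff_eq_iff add_hom_add[OF l] add_hom_add[OF r])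
  show "lift_map H ?h \<in> add_hom P H"
    by (rule P.lift_map_add_hom[OF H]) (use c q in auto)
  show "lift_map H ?h (pure x y) = h x y" if "x \<in> carrier M" "y \<in> carrier N"
    unfolding pure_eq_gen
    by (subst P.lift_map_gen[OF H]) (use c q that in auto)
qed

text \<open>An additive endomorphism of \<open>M\<close> that commutes with the right action of \<open>B\<close> acts on the tensor
  product, and so does, below, one of \<open>N\<close> that commutes with the left action.\<close>

lemma
  assumes r: "(\<lambda>x. r \<odot>\<^bsub>M\<^esub> x) \<in> add_hom M M"
    and b: "\<And>x b. \<lbrakk>x \<in> carrier M; b \<in> B\<rbrakk> \<Longrightarrow> r \<odot>\<^bsub>M\<^esub> rsmult M x b = rsmult M (r \<odot>\<^bsub>M\<^esub> x) b"
  shows tensor_smult_hom: "(\<lambda>U. r \<odot>\<^bsub>P\<^esub> U) \<in> add_hom P P"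
    and tensor_smult_pure: "\<lbrakk>x \<in> carrier M; y \<in> carrier N\<rbrakk> \<Longrightarrow> r \<odot>\<^bsub>P\<^esub> pure x y = pure (r \<odot>\<^bsub>M\<^esub> x) y"
proof -
  let ?f = "lift_map P (\<lambda>(x, y). pure (r \<odot>\<^bsub>M\<^esub> x) y)"
  note L = P.is_abelian_group add_hom_comp[OF pure_hom_left r] pure_hom_right[OF add_hom_closed[OF r]]
  have bal: "pure (r \<odot>\<^bsub>M\<^esub> rsmult M x b) y = pure (r \<odot>\<^bsub>M\<^esub> x) (b \<odot>\<^bsub>N\<^esub> y)"
    if "x \<in> carrier M" "b \<in> B" "y \<in> carrier N" for x b y
    using that by (simp add: b pure_balanced add_hom_closed[OF r])
  have f: "?f \<in> add_hom P P"
    by (rule tensor_lift_hom[OF L bal])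
  have fp: "?f (pure x y) = pure (r \<odot>\<^bsub>M\<^esub> x) y" if "x \<in> carrier M" "y \<in> carrier N" for x y
    by (rule tensor_lift_pure[OF L bal that])
  have eq: "r \<odot>\<^bsub>P\<^esub> U = ?f U" if U: "U \<in> carrier P" for U
  proof -
    have "presented_map (carrier M \<times> carrier N) (tensor_relators B M N) (\<lambda>(x, y). (r \<odot>\<^bsub>M\<^esub> x, y)) U = ?f U"
      by (rule P.presented_map_eq[OF f _ _ U])
         (use add_hom_closed[OF r] fp in \<open>auto simp flip: pure_eq_gen\<close>)
    then show ?thesis by (simp add: tensor_product_def Let_def)
  qed
  show "(\<lambda>U. r \<odot>\<^bsub>P\<^esub> U) \<in> add_hom P P"
    by (rule add_homI) (simp_all add: eq add_hom_closed[OF f] add_hom_add[OF f])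
  show "r \<odot>\<^bsub>P\<^esub> pure x y = pure (r \<odot>\<^bsub>M\<^esub> x) y" if "x \<in> carrier M" "y \<in> carrier N"
    using that by (simp add: eq pure_closed fp)
qed

lemma
  assumes r: "(\<lambda>y. rsmult N y r) \<in> add_hom N N"
    and b: "\<And>y b. \<lbrakk>y \<in> carrier N; b \<in> B\<rbrakk> \<Longrightarrow> rsmult N (b \<odot>\<^bsub>N\<^esub> y) r = b \<odot>\<^bsub>N\<^esub> rsmult N y r"
  shows tensor_rsmult_hom: "(\<lambda>U. rsmult P U r) \<in> add_hom P P"
    and tensor_rsmult_pure: "\<lbrakk>x \<in> carrier M; y \<in> carrier N\<rbrakk> \<Longrightarrow> rsmult P (pure x y) r = pure x (rsmult N y r)"
proof -
  let ?f = "lift_map P (\<lambda>(x, y). pure x (rsmult N y r))"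
  note L = P.is_abelian_group pure_hom_left[OF add_hom_closed[OF r]] add_hom_comp[OF pure_hom_right r]
  have bal: "pure (rsmult M x b) (rsmult N y r) = pure x (rsmult N (b \<odot>\<^bsub>N\<^esub> y) r)"
    if "x \<in> carrier M" "b \<in> B" "y \<in> carrier N" for x b y
    using that by (simp add: b pure_balanced add_hom_closed[OF r])
  have f: "?f \<in> add_hom P P"
    by (rule tensor_lift_hom[OF L bal])
  have fp: "?f (pure x y) = pure x (rsmult N y r)" if "x \<in> carrier M" "y \<in> carrier N" for x y
    by (rule tensor_lift_pure[OF L bal that])
  have eq: "rsmult P U r = ?f U" if U: "U \<in> carrier P" for U
  proof -
    have "presented_map (carrier M \<times> carrier N) (tensor_relators B M N) (\<lambda>(x, y). (x, rsmult N y r)) U = ?f U"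
      by (rule P.presented_map_eq[OF f _ _ U])
         (use add_hom_closed[OF r] fp in \<open>auto simp flip: pure_eq_gen\<close>)
    then show ?thesis by (simp add: tensor_product_def Let_def)
  qed
  show "(\<lambda>U. rsmult P U r) \<in> add_hom P P"
    by (rule add_homI) (simp_all add: eq add_hom_closed[OF f] add_hom_add[OF f])
  show "rsmult P (pure x y) r = pure x (rsmult N y r)" if "x \<in> carrier M" "y \<in> carrier N"
    using that by (simp add: eq pure_closed fp)
qed

end



section \<open>The tensor algebra of a bimodule\<close>

locale tensor_alg = bimodule R M
  for R :: "('k, 'r, 'x) module_scheme" (structure) and M :: "('r, 'm, 'y) bimodule_scheme"
begin

abbreviation "T \<equiv> tensor_algebra R M"
abbreviation "S \<equiv> twords R M"

lemma Scal_mem: "Scal r \<in> S \<longleftrightarrow> r \<in> carrier R"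
  by (auto simp: twords_def)

lemma Tens_mem: "Tens ms \<in> S \<longleftrightarrow> set ms \<subseteq> carrier M \<and> ms \<noteq> []"
  by (auto simp: twords_def)

lemma twords_cases [consumes 1, case_names Scal Tens]:
  assumes "w \<in> S"
  obtains r where "w = Scal r" "r \<in> carrier R"
  | m ms where "w = Tens (m # ms)" "m \<in> carrier M" "set ms \<subseteq> carrier M"
proof (cases w)
  case (Scal r)
  then show ?thesis using assms that by (auto simp: Scal_mem)
next
  case (Tens ms)
  then show ?thesis using assms that by (cases ms) (auto simp: Tens_mem)
qed

lemma T_fields: "carrier T = carrier (presented_group S (tword_relators R M))"
  "add T = monoid.mult (presented_group S (tword_relators R M))"
  "\<zero>\<^bsub>T\<^esub> = one (presented_group S (tword_relators R M))"
  by (simp_all add: tensor_algebra_def Let_def)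

lemma relators_keys:
  assumes "q \<in> tword_relators R M"
  shows "Poly_Mapping.keys q \<subseteq> S"
proof -
  have 3: "Poly_Mapping.keys (frag_of u - frag_of v - frag_of w) \<subseteq> {u, v, w}" for u v w :: "('r, 'm) tword"
    using keys_diff[of "frag_of u - frag_of v" "frag_of w"] keys_diff[of "frag_of u" "frag_of v"] by auto
  have 2: "Poly_Mapping.keys (frag_of u - frag_of v) \<subseteq> {u, v}" for u v :: "('r, 'm) tword"
    using keys_diff[of "frag_of u" "frag_of v"] by auto
  show ?thesis
    using assms unfolding tword_relators_def
    by (elim UnE CollectE exE conjE)
       (auto dest!: subsetD[OF 3] subsetD[OF 2] simp: Scal_mem Tens_mem rsmult_closed smult_closed)
qed

sublocale T: presented T S "tword_relators R M"
  by (rule presented.intro) (simp_all add: T_fields relators_keys)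

abbreviation "sc \<equiv> tensor_scalar R M"
text \<open>The class of the word \<open>m\<^sub>1 \<otimes> \<dots> \<otimes> m\<^sub>n\<close>.  The empty word is not a generator, so the list is meant to be
  nonempty.\<close>

definition tn :: "'m list \<Rightarrow> ('r, 'm) tensor_word_class" where "tn ms = T.gen (Tens ms)"

lemma sc_eq: "sc r = T.gen (Scal r)"
  by (simp add: tensor_scalar_def tword_class_def)

lemma sc_closed: "r \<in> carrier R \<Longrightarrow> sc r \<in> carrier T"
  unfolding sc_eq by (rule T.gen_closed) (simp add: Scal_mem)

lemma tn_closed: "set ms \<subseteq> carrier M \<Longrightarrow> ms \<noteq> [] \<Longrightarrow> tn ms \<in> carrier T"
  unfolding tn_def by (rule T.gen_closed) (simp add: Tens_mem)

lemma gen_addI: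
  assumes "q \<in> tword_relators R M" "q = frag_of u - frag_of v - frag_of w" "u \<in> S" "v \<in> S" "w \<in> S"
  shows "T.gen u = T.gen v \<oplus>\<^bsub>T\<^esub> T.gen w"
proof -
  have k: "Poly_Mapping.keys (frag_of u - frag_of v) \<subseteq> S"
    using assms keys_diff[of "frag_of u" "frag_of v"] by auto
  show ?thesis
    using T.cls_relator[OF assms(1)] assms(2-) k
    by (simp add: T.cls_diff T.gen_closed T.G.diff_eq_iff T.G.a_comm)
qed

lemma gen_eqI:
  assumes "q \<in> tword_relators R M" "q = frag_of u - frag_of v" "u \<in> S" "v \<in> S"
  shows "T.gen u = T.gen v"
  using T.cls_relator[OF assms(1)] assms(2-)
  by (simp add: T.cls_diff T.gen_closed T.G.diff_eq_iff)

lemma sc_hom: "sc \<in> add_hom R T"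
proof (rule add_homI)
  fix r s assume "r \<in> carrier R" "s \<in> carrier R"
  then show "sc (r \<oplus> s) = sc r \<oplus>\<^bsub>T\<^esub> sc s"
    unfolding sc_eq by (intro gen_addI[OF _ refl]) (auto simp: tword_relators_def Scal_mem)
qed (rule sc_closed)

lemma tn_hom:
  assumes "set us \<subseteq> carrier M" "set vs \<subseteq> carrier M"
  shows "(\<lambda>m. tn (us @ m # vs)) \<in> add_hom M T"
proof (rule add_homI)
  fix m m' assume m: "m \<in> carrier M" "m' \<in> carrier M"
  then show "tn (us @ (m \<oplus>\<^bsub>M\<^esub> m') # vs) = tn (us @ m # vs) \<oplus>\<^bsub>T\<^esub> tn (us @ m' # vs)"
    unfolding tn_def
  proof (intro gen_addI[OF _ refl])
    have lists: "us \<in> lists (carrier M)" "vs \<in> lists (carrier M)" using assms by auto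
    let ?q = "frag_of (Tens (us @ (m \<oplus>\<^bsub>M\<^esub> m') # vs)) - frag_of (Tens (us @ m # vs))
      - frag_of (Tens (us @ m' # vs)) :: ('r, 'm) tword \<Rightarrow>\<^sub>0 int"
    show "?q \<in> tword_relators R M"
      unfolding tword_relators_def
    proof (rule UnI1, rule UnI2, rule CollectI, intro exI conjI)
      show "?q = frag_of (Tens (us @ [m \<oplus>\<^bsub>M\<^esub> m'] @ vs)) - frag_of (Tens (us @ [m] @ vs))
        - frag_of (Tens (us @ [m'] @ vs))"
        by simp
    qed (use m lists in auto)
  qed (use assms in \<open>auto simp: Tens_mem\<close>)
qed (use assms in \<open>simp add: tn_closed\<close>)

lemma tn_balanced:
  assumes "set us \<subseteq> carrier M" "set vs \<subseteq> carrier M" "m \<in> carrier M" "m' \<in> carrier M" "r \<in> carrier R"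
  shows "tn (us @ rsmult M m r # m' # vs) = tn (us @ m # (r \<odot>\<^bsub>M\<^esub> m') # vs)"
  unfolding tn_def
proof (rule gen_eqI[OF _ refl])
  have lists: "us \<in> lists (carrier M)" "vs \<in> lists (carrier M)" using assms by auto
  show "frag_of (Tens (us @ rsmult M m r # m' # vs)) - frag_of (Tens (us @ m # (r \<odot>\<^bsub>M\<^esub> m') # vs))
      \<in> tword_relators R M"
    unfolding tword_relators_def
  proof (rule UnI2, rule CollectI, intro exI conjI)
    show "frag_of (Tens (us @ rsmult M m r # m' # vs)) - frag_of (Tens (us @ m # (r \<odot>\<^bsub>M\<^esub> m') # vs)) =
      frag_of (Tens (us @ [rsmult M m r, m'] @ vs)) - frag_of (Tens (us @ [m, r \<odot>\<^bsub>M\<^esub> m'] @ vs))"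
      by simp
  qed (use assms lists in auto)
qed (use assms in \<open>auto simp: Tens_mem rsmult_closed smult_closed\<close>)

text \<open>The universal property of the underlying group: a map of words that is additive in the scalar and in each
  letter, and balanced between neighbouring letters, extends to the tensor algebra.\<close>

lemma
  assumes H: "abelian_group H"
    and h0: "(\<lambda>r. h (Scal r)) \<in> add_hom R H"
    and h1: "\<And>us vs. \<lbrakk>set us \<subseteq> carrier M; set vs \<subseteq> carrier M\<rbrakk> \<Longrightarrow> (\<lambda>m. h (Tens (us @ m # vs))) \<in> add_hom M H"
    and bal: "\<And>us vs m m' r. \<lbrakk>set us \<subseteq> carrier M; set vs \<subseteq> carrier M; m \<in> carrier M; m' \<in> carrier M; r \<in> carrier R\<rbrakk>
      \<Longrightarrow> h (Tens (us @ rsmult M m r # m' # vs)) = h (Tens (us @ m # (r \<odot>\<^bsub>M\<^esub> m') # vs))"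
  shows tword_lift_hom: "lift_map H h \<in> add_hom T H"
    and tword_lift_gen: "w \<in> S \<Longrightarrow> lift_map H h (T.gen w) = h w"
proof -
  interpret H: abelian_group H by fact
  have c: "h w \<in> carrier H" if "w \<in> S" for w
    using that
  proof (cases rule: twords_cases)
    case (Scal r) then show ?thesis using add_hom_closed[OF h0] by simp
  next
    case (Tens m ms) then show ?thesis using add_hom_closed[OF h1[of "[]" ms]] by simp
  qed
  have hS: "h \<in> S \<rightarrow> carrier H" using c by auto
  have s2: "frag_sum H h (frag_of u - frag_of v) = h u \<ominus>\<^bsub>H\<^esub> h v" if "u \<in> S" "v \<in> S" for u v
    using that H.frag_sum_diff[OF hS, of "frag_of u" "frag_of v"] c by (simp add: H.frag_sum_of)
  have s3: "frag_sum H h (frag_of u - frag_of v - frag_of w) = h u \<ominus>\<^bsub>H\<^esub> h v \<ominus>\<^bsub>H\<^esub> h w"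
    if "u \<in> S" "v \<in> S" "w \<in> S" for u v w
  proof -
    have "Poly_Mapping.keys (frag_of u - frag_of v) \<subseteq> S"
      using keys_diff[of "frag_of u" "frag_of v"] that by auto
    then show ?thesis
      using that H.frag_sum_diff[OF hS, of "frag_of u - frag_of v" "frag_of w"] c
      by (simp add: H.frag_sum_of s2)
  qed
  have canc: "a \<oplus>\<^bsub>H\<^esub> b \<ominus>\<^bsub>H\<^esub> a \<ominus>\<^bsub>H\<^esub> b = \<zero>\<^bsub>H\<^esub>" if "a \<in> carrier H" "b \<in> carrier H" for a b
    using that by algebra
  have q: "frag_sum H h q = \<zero>\<^bsub>H\<^esub>" if "q \<in> tword_relators R M" for q
    using that unfolding tword_relators_def
  proof (elim UnE CollectE exE conjE)
    fix r s assume "q = frag_of (Scal (r \<oplus> s)) - frag_of (Scal r) - frag_of (Scal s)"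
      and rs: "r \<in> carrier R" "s \<in> carrier R"
    then show ?thesis
      by (simp add: s3 Scal_mem add_hom_add[OF h0] canc c)
  next
    fix us vs m m'
    assume q: "q = frag_of (Tens (us @ [m \<oplus>\<^bsub>M\<^esub> m'] @ vs)) - frag_of (Tens (us @ [m] @ vs))
        - frag_of (Tens (us @ [m'] @ vs))"
      and uv: "us \<in> lists (carrier M)" "vs \<in> lists (carrier M)" and m: "m \<in> carrier M" "m' \<in> carrier M"
    have "set us \<subseteq> carrier M" "set vs \<subseteq> carrier M" using uv by auto
    then show ?thesis
      using m by (simp add: q s3 Tens_mem add_hom_add[OF h1] canc c)
  next
    fix us vs m m' r
    assume q: "q = frag_of (Tens (us @ [rsmult M m r, m'] @ vs)) - frag_of (Tens (us @ [m, r \<odot>\<^bsub>M\<^esub> m'] @ vs))"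
      and uv: "us \<in> lists (carrier M)" "vs \<in> lists (carrier M)" and m: "m \<in> carrier M" "m' \<in> carrier M"
      and r: "r \<in> carrier R"
    have "set us \<subseteq> carrier M" "set vs \<subseteq> carrier M" using uv by auto
    then show ?thesis
      using m r by (simp add: q s2 Tens_mem bal rsmult_closed smult_closed c H.diff_eq_iff)
  qed
  show "lift_map H h \<in> add_hom T H"
    by (rule T.lift_map_add_hom[OF H]) (use c q in auto)
  show "lift_map H h (T.gen w) = h w" if "w \<in> S"
    by (subst T.lift_map_gen[OF H]) (use c q that in auto)
qed

text \<open>Left multiplication by a word \<open>u\<close>.  It is used for \<open>u\<close> a scalar or a single letter, which generate
  everything; for these the relators are respected.\<close>

definition lmul :: "('r, 'm) tword \<Rightarrow> ('r, 'm) tensor_word_class \<Rightarrow> ('r, 'm) tensor_word_class" where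
  "lmul u = lift_map T (\<lambda>w. T.gen (tword_mult R M u w))"

lemma
  assumes r: "r \<in> carrier R"
  shows lmul_Scal_hom: "lmul (Scal r) \<in> add_hom T T"
    and lmul_Scal_gen: "w \<in> S \<Longrightarrow> lmul (Scal r) (T.gen w) = T.gen (tword_mult R M (Scal r) w)"
proof -
  have 0: "(\<lambda>s. T.gen (tword_mult R M (Scal r) (Scal s))) \<in> add_hom R T"
  proof -
    have "(\<lambda>s. sc (r \<otimes> s)) \<in> add_hom R T"
      by (rule add_hom_comp[OF sc_hom]) (rule add_homI, use r in \<open>auto simp: r_distr\<close>)
    then show ?thesis by (simp add: sc_eq)
  qed
  have 1: "(\<lambda>m. T.gen (tword_mult R M (Scal r) (Tens (us @ m # vs)))) \<in> add_hom M T"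
    if "set us \<subseteq> carrier M" "set vs \<subseteq> carrier M" for us vs
  proof (cases us)
    case Nil
    have "(\<lambda>m. tn ([] @ (r \<odot>\<^bsub>M\<^esub> m) # vs)) \<in> add_hom M T"
      by (rule add_hom_comp[OF tn_hom]) (use r that in \<open>auto intro!: add_homI simp: smult_closed smult_r_distr\<close>)
    then show ?thesis by (simp add: Nil tn_def)
  next
    case (Cons u us')
    then show ?thesis
      using tn_hom[of "(r \<odot>\<^bsub>M\<^esub> u) # us'" vs] that r by (simp add: tn_def smult_closed)
  qed
  have 2: "T.gen (tword_mult R M (Scal r) (Tens (us @ rsmult M m s # m' # vs)))
      = T.gen (tword_mult R M (Scal r) (Tens (us @ m # (s \<odot>\<^bsub>M\<^esub> m') # vs)))"
    if "set us \<subseteq> carrier M" "set vs \<subseteq> carrier M" "m \<in> carrier M" "m' \<in> carrier M" "s \<in> carrier R" for us vs m m' s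
  proof (cases us)
    case Nil
    then show ?thesis
      using tn_balanced[of "[]" vs "r \<odot>\<^bsub>M\<^esub> m" m' s] that r
      by (simp add: tn_def smult_closed smult_rsmult)
  next
    case (Cons u us')
    then show ?thesis
      using tn_balanced[of "(r \<odot>\<^bsub>M\<^esub> u) # us'" vs m m' s] that r by (simp add: tn_def smult_closed)
  qed
  show "lmul (Scal r) \<in> add_hom T T"
    unfolding lmul_def by (rule tword_lift_hom[OF T.is_abelian_group 0 1 2])
  show "lmul (Scal r) (T.gen w) = T.gen (tword_mult R M (Scal r) w)" if "w \<in> S"
    unfolding lmul_def by (rule tword_lift_gen[OF T.is_abelian_group 0 1 2 that])
qed

lemma
  assumes a: "a \<in> carrier M"
  shows lmul_Tens_hom: "lmul (Tens [a]) \<in> add_hom T T"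
    and lmul_Tens_gen: "w \<in> S \<Longrightarrow> lmul (Tens [a]) (T.gen w) = T.gen (tword_mult R M (Tens [a]) w)"
proof -
  have 0: "(\<lambda>s. T.gen (tword_mult R M (Tens [a]) (Scal s))) \<in> add_hom R T"
  proof -
    have "(\<lambda>s. tn ([] @ (rsmult M a s) # [])) \<in> add_hom R T"
      by (rule add_hom_comp[OF tn_hom]) (use a in \<open>auto intro!: add_homI simp: rsmult_closed rsmult_r_distr\<close>)
    then show ?thesis by (simp add: tn_def)
  qed
  have 1: "(\<lambda>m. T.gen (tword_mult R M (Tens [a]) (Tens (us @ m # vs)))) \<in> add_hom M T"
    if "set us \<subseteq> carrier M" "set vs \<subseteq> carrier M" for us vs
    using tn_hom[of "a # us" vs] that a by (simp add: tn_def)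
  have 2: "T.gen (tword_mult R M (Tens [a]) (Tens (us @ rsmult M m s # m' # vs)))
      = T.gen (tword_mult R M (Tens [a]) (Tens (us @ m # (s \<odot>\<^bsub>M\<^esub> m') # vs)))"
    if "set us \<subseteq> carrier M" "set vs \<subseteq> carrier M" "m \<in> carrier M" "m' \<in> carrier M" "s \<in> carrier R" for us vs m m' s
    using tn_balanced[of "a # us" vs m m' s] that a by (simp add: tn_def)
  show "lmul (Tens [a]) \<in> add_hom T T"
    unfolding lmul_def by (rule tword_lift_hom[OF T.is_abelian_group 0 1 2])
  show "lmul (Tens [a]) (T.gen w) = T.gen (tword_mult R M (Tens [a]) w)" if "w \<in> S"
    unfolding lmul_def by (rule tword_lift_gen[OF T.is_abelian_group 0 1 2 that])
qed

lemma lmul_simps: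
  "\<lbrakk>r \<in> carrier R; s \<in> carrier R\<rbrakk> \<Longrightarrow> lmul (Scal r) (sc s) = sc (r \<otimes> s)"
  "\<lbrakk>r \<in> carrier R; m \<in> carrier M; set ms \<subseteq> carrier M\<rbrakk> \<Longrightarrow> lmul (Scal r) (tn (m # ms)) = tn ((r \<odot>\<^bsub>M\<^esub> m) # ms)"
  "\<lbrakk>a \<in> carrier M; s \<in> carrier R\<rbrakk> \<Longrightarrow> lmul (Tens [a]) (sc s) = tn [rsmult M a s]"
  "\<lbrakk>a \<in> carrier M; m \<in> carrier M; set ms \<subseteq> carrier M\<rbrakk> \<Longrightarrow> lmul (Tens [a]) (tn (m # ms)) = tn (a # m # ms)"
  by (simp_all add: sc_eq tn_def lmul_Scal_gen lmul_Tens_gen Scal_mem Tens_mem)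

text \<open>The tensor algebra is generated from the scalars by left multiplication with single letters.\<close>

lemma tensor_alg_induct0 [consumes 1, case_names zero diff sc lmul]:
  assumes "U \<in> carrier T" "P \<zero>\<^bsub>T\<^esub>"
    "\<And>U V. \<lbrakk>U \<in> carrier T; V \<in> carrier T; P U; P V\<rbrakk> \<Longrightarrow> P (U \<ominus>\<^bsub>T\<^esub> V)"
    "\<And>r. r \<in> carrier R \<Longrightarrow> P (sc r)"
    "\<And>m U. \<lbrakk>m \<in> carrier M; U \<in> carrier T; P U\<rbrakk> \<Longrightarrow> P (lmul (Tens [m]) U)"
  shows "P U"
  using assms(1)
proof (induction rule: T.presented_induct)
  case (gen w)
  have t: "P (tn (m # ms))" if "m \<in> carrier M" "set ms \<subseteq> carrier M" for m ms
    using that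
  proof (induction ms arbitrary: m)
    case Nil
    then show ?case using assms(5)[of m "sc \<one>"] assms(4)[of \<one>]
      by (simp add: lmul_simps sc_closed rsmult_one)
  next
    case (Cons m' ms)
    then show ?case using assms(5)[of m "tn (m' # ms)"]
      by (simp add: lmul_simps tn_closed)
  qed
  from gen show ?case
    by (cases rule: twords_cases) (use t assms(4) in \<open>auto simp: sc_eq tn_def\<close>)
qed (use assms in auto)

lemma tensor_alg_eqI:
  assumes H: "abelian_group H" "f \<in> add_hom T H" "g \<in> add_hom T H"
    and "\<And>r. r \<in> carrier R \<Longrightarrow> f (sc r) = g (sc r)"
    and "\<And>m ms. \<lbrakk>m \<in> carrier M; set ms \<subseteq> carrier M\<rbrakk> \<Longrightarrow> f (tn (m # ms)) = g (tn (m # ms))"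
    and "U \<in> carrier T"
  shows "f U = g U"
  by (rule T.add_hom_eqI[OF H _ assms(6)])
     (erule twords_cases, use assms in \<open>auto simp: sc_eq tn_def\<close>)

end

text \<open>A left module over the tensor algebra: a left \<open>R\<close>-module \<open>H\<close> with a bimodule map from \<open>M\<close> to the
  additive endomorphisms of \<open>H\<close>.  The bimodule laws are what is needed for the values below to respect
  the relators.\<close>

locale tensor_module = tensor_alg R M + H: abelian_group H
  for R :: "('k, 'r, 'x) module_scheme" (structure) and M :: "('r, 'm, 'y) bimodule_scheme"
    and H :: "('h, 'z) ring_scheme" +
  fixes act :: "'r \<Rightarrow> 'h \<Rightarrow> 'h" and op :: "'m \<Rightarrow> 'h \<Rightarrow> 'h"
  assumes act_hom: "r \<in> carrier R \<Longrightarrow> act r \<in> add_hom H H"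
    and act_hom': "x \<in> carrier H \<Longrightarrow> (\<lambda>r. act r x) \<in> add_hom R H"
    and act_mult: "\<lbrakk>r \<in> carrier R; s \<in> carrier R; x \<in> carrier H\<rbrakk> \<Longrightarrow> act (r \<otimes> s) x = act r (act s x)"
    and act_one: "x \<in> carrier H \<Longrightarrow> act \<one> x = x"
    and op_hom: "m \<in> carrier M \<Longrightarrow> op m \<in> add_hom H H"
    and op_hom': "x \<in> carrier H \<Longrightarrow> (\<lambda>m. op m x) \<in> add_hom M H"
    and op_smult: "\<lbrakk>r \<in> carrier R; m \<in> carrier M; x \<in> carrier H\<rbrakk> \<Longrightarrow> op (r \<odot>\<^bsub>M\<^esub> m) x = act r (op m x)"
    and op_rsmult: "\<lbrakk>r \<in> carrier R; m \<in> carrier M; x \<in> carrier H\<rbrakk> \<Longrightarrow> op (rsmult M m r) x = op m (act r x)"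
begin

text \<open>The value of a word at \<open>e\<close>: its letters are applied one after the other, the last one first.\<close>

fun word_val :: "'h \<Rightarrow> ('r, 'm) tword \<Rightarrow> 'h" where
  "word_val e (Scal r) = act r e"
| "word_val e (Tens ms) = foldr op ms e"

text \<open>The map \<open>t \<mapsto> t e\<close> on the tensor algebra.\<close>

definition eval_at :: "'h \<Rightarrow> ('r, 'm) tensor_word_class \<Rightarrow> 'h" where
  "eval_at e = lift_map H (word_val e)"

lemma op_closed: "\<lbrakk>m \<in> carrier M; x \<in> carrier H\<rbrakk> \<Longrightarrow> op m x \<in> carrier H"
  using add_hom_closed[OF op_hom] .

lemma act_closed: "\<lbrakk>r \<in> carrier R; x \<in> carrier H\<rbrakk> \<Longrightarrow> act r x \<in> carrier H"
  using add_hom_closed[OF act_hom] .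

lemma foldr_op_hom: "set ms \<subseteq> carrier M \<Longrightarrow> (\<lambda>x. foldr op ms x) \<in> add_hom H H"
proof (induction ms)
  case Nil then show ?case by (simp add: add_hom_ident)
next
  case (Cons m ms)
  then show ?case by (auto intro: add_hom_comp[OF op_hom])
qed

lemma word_val_hom: "w \<in> S \<Longrightarrow> (\<lambda>e. word_val e w) \<in> add_hom H H"
  by (erule twords_cases) (simp_all add: act_hom add_hom_comp[OF op_hom foldr_op_hom])

lemma
  assumes e: "e \<in> carrier H"
  shows eval_at_hom: "eval_at e \<in> add_hom T H"
    and eval_at_gen: "w \<in> S \<Longrightarrow> eval_at e (T.gen w) = word_val e w"
proof -
  have c: "foldr op ms e \<in> carrier H" if "set ms \<subseteq> carrier M" for ms
    by (rule add_hom_closed[OF foldr_op_hom[OF that] e])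
  have 0: "(\<lambda>r. word_val e (Scal r)) \<in> add_hom R H"
    using act_hom'[OF e] by simp
  have 1: "(\<lambda>m. word_val e (Tens (us @ m # vs))) \<in> add_hom M H"
    if "set us \<subseteq> carrier M" "set vs \<subseteq> carrier M" for us vs
    using add_hom_comp[OF foldr_op_hom[OF that(1)] op_hom'[OF c[OF that(2)]]] by simp
  have 2: "word_val e (Tens (us @ rsmult M m r # m' # vs)) = word_val e (Tens (us @ m # (r \<odot>\<^bsub>M\<^esub> m') # vs))"
    if "set us \<subseteq> carrier M" "set vs \<subseteq> carrier M" "m \<in> carrier M" "m' \<in> carrier M" "r \<in> carrier R" for us vs m m' r
    using that c by (simp add: op_rsmult op_smult op_closed)
  show "eval_at e \<in> add_hom T H"
    unfolding eval_at_def by (rule tword_lift_hom[OF H.abelian_group_axioms 0 1 2])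
  show "eval_at e (T.gen w) = word_val e w" if "w \<in> S"
    unfolding eval_at_def by (rule tword_lift_gen[OF H.abelian_group_axioms 0 1 2 that])
qed

lemma eval_at_sc: "\<lbrakk>e \<in> carrier H; r \<in> carrier R\<rbrakk> \<Longrightarrow> eval_at e (sc r) = act r e"
  by (simp add: sc_eq eval_at_gen Scal_mem)

lemma eval_at_tn: "\<lbrakk>e \<in> carrier H; set ms \<subseteq> carrier M; ms \<noteq> []\<rbrakk> \<Longrightarrow> eval_at e (tn ms) = foldr op ms e"
  by (simp add: tn_def eval_at_gen Tens_mem)

lemma foldr_op_closed: "\<lbrakk>set ms \<subseteq> carrier M; x \<in> carrier H\<rbrakk> \<Longrightarrow> foldr op ms x \<in> carrier H"
  using add_hom_closed[OF foldr_op_hom] .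

lemma eval_at_lmul_Scal:
  assumes "e \<in> carrier H" "r \<in> carrier R" "U \<in> carrier T"
  shows "eval_at e (lmul (Scal r) U) = act r (eval_at e U)"
  by (rule tensor_alg_eqI[OF H.abelian_group_axioms add_hom_comp[OF eval_at_hom lmul_Scal_hom]
        add_hom_comp[OF act_hom eval_at_hom] _ _ assms(3)])
     (use assms in \<open>simp_all add: lmul_simps eval_at_sc eval_at_tn smult_closed act_mult op_smult foldr_op_closed\<close>)

lemma eval_at_lmul_Tens:
  assumes "e \<in> carrier H" "m \<in> carrier M" "U \<in> carrier T"
  shows "eval_at e (lmul (Tens [m]) U) = op m (eval_at e U)"
  by (rule tensor_alg_eqI[OF H.abelian_group_axioms add_hom_comp[OF eval_at_hom lmul_Tens_hom]
        add_hom_comp[OF op_hom eval_at_hom] _ _ assms(3)])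
     (use assms in \<open>simp_all add: lmul_simps eval_at_sc eval_at_tn rsmult_closed op_rsmult\<close>)

lemma eval_at_arg_hom:
  assumes "U \<in> carrier T"
  shows "(\<lambda>e. eval_at e U) \<in> add_hom H H"
  using assms
proof (induction rule: T.presented_induct)
  case zero
  show ?case
    by (rule add_homI) (simp_all add: add_hom_zero[OF T.is_abelian_group H.abelian_group_axioms eval_at_hom])
next
  case (diff U V)
  show ?case
  proof (rule add_homI)
    fix x assume "x \<in> carrier H"
    then show "eval_at x (U \<ominus>\<^bsub>T\<^esub> V) \<in> carrier H"
      using diff by (simp add: add_hom_closed[OF eval_at_hom])
    fix y assume "y \<in> carrier H"
    then show "eval_at (x \<oplus>\<^bsub>H\<^esub> y) (U \<ominus>\<^bsub>T\<^esub> V) = eval_at x (U \<ominus>\<^bsub>T\<^esub> V) \<oplus>\<^bsub>H\<^esub> eval_at y (U \<ominus>\<^bsub>T\<^esub> V)"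
      using diff \<open>x \<in> carrier H\<close> add_hom_closed[OF diff(3)] add_hom_closed[OF diff(4)]
      by (simp add: add_hom_diff[OF T.is_abelian_group H.abelian_group_axioms eval_at_hom]
          add_hom_add[OF diff(3)] add_hom_add[OF diff(4)])
         (simp add: H.minus_eq H.minus_add H.a_ac)
  qed
next
  case (gen w)
  show ?case
    by (rule add_homI)
       (use gen add_hom_closed[OF word_val_hom[OF gen]] add_hom_add[OF word_val_hom[OF gen]]
        in \<open>simp_all add: eval_at_gen\<close>)
qed

end

context tensor_alg
begin

text \<open>The left multiplications make the tensor algebra a module over itself in the above sense, before its
  product is known to be well defined.\<close>

lemma tensor_module_self: "tensor_module R M T (\<lambda>r. lmul (Scal r)) (\<lambda>m. lmul (Tens [m]))"
proof
  fix x assume x: "x \<in> carrier T"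
  have sch: "lmul (Scal r) y \<in> carrier T" if "r \<in> carrier R" "y \<in> carrier T" for r y
    using add_hom_closed[OF lmul_Scal_hom] that by blast
  have tch: "lmul (Tens [m]) y \<in> carrier T" if "m \<in> carrier M" "y \<in> carrier T" for m y
    using add_hom_closed[OF lmul_Tens_hom] that by blast
  show "(\<lambda>r. lmul (Scal r) x) \<in> add_hom R T"
  proof (rule add_homI)
    fix r s assume rs: "r \<in> carrier R" "s \<in> carrier R"
    show "lmul (Scal (r \<oplus> s)) x = lmul (Scal r) x \<oplus>\<^bsub>T\<^esub> lmul (Scal s) x"
      by (rule tensor_alg_eqI[OF T.is_abelian_group lmul_Scal_hom T.G.add_hom_plus[OF lmul_Scal_hom lmul_Scal_hom] _ _ x])
         (use rs add_hom_add[OF tn_hom[of "[]"]] in \<open>simp_all add: lmul_simps l_distr add_hom_add[OF sc_hom] smult_l_distr smult_closed\<close>)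
  qed (use sch x in simp)
  show "(\<lambda>m. lmul (Tens [m]) x) \<in> add_hom M T"
  proof (rule add_homI)
    fix m n assume mn: "m \<in> carrier M" "n \<in> carrier M"
    show "lmul (Tens [m \<oplus>\<^bsub>M\<^esub> n]) x = lmul (Tens [m]) x \<oplus>\<^bsub>T\<^esub> lmul (Tens [n]) x"
      by (rule tensor_alg_eqI[OF T.is_abelian_group lmul_Tens_hom T.G.add_hom_plus[OF lmul_Tens_hom lmul_Tens_hom] _ _ x])
         (use mn add_hom_add[OF tn_hom[of "[]"]] in \<open>simp_all add: lmul_simps rsmult_l_distr rsmult_closed\<close>)
  qed (use tch x in simp)
  show "lmul (Scal \<one>) x = x"
    by (rule tensor_alg_eqI[OF T.is_abelian_group lmul_Scal_hom add_hom_ident _ _ x])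
       (simp_all add: lmul_simps smult_one)
  fix r assume r: "r \<in> carrier R"
  show "lmul (Scal (r \<otimes> s)) x = lmul (Scal r) (lmul (Scal s) x)" if s: "s \<in> carrier R" for s
    by (rule tensor_alg_eqI[OF T.is_abelian_group lmul_Scal_hom add_hom_comp[OF lmul_Scal_hom lmul_Scal_hom] _ _ x])
       (use r s in \<open>simp_all add: lmul_simps m_assoc smult_assoc smult_closed\<close>)
  fix m assume m: "m \<in> carrier M"
  show "lmul (Tens [r \<odot>\<^bsub>M\<^esub> m]) x = lmul (Scal r) (lmul (Tens [m]) x)"
    by (rule tensor_alg_eqI[OF T.is_abelian_group lmul_Tens_hom add_hom_comp[OF lmul_Scal_hom lmul_Tens_hom] _ _ x])
       (use r m in \<open>simp_all add: lmul_simps smult_closed rsmult_closed smult_rsmult\<close>)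
  show "lmul (Tens [rsmult M m r]) x = lmul (Tens [m]) (lmul (Scal r) x)"
    by (rule tensor_alg_eqI[OF T.is_abelian_group lmul_Tens_hom add_hom_comp[OF lmul_Tens_hom lmul_Scal_hom] _ _ x])
       (use r m tn_balanced[of "[]"] in \<open>simp_all add: lmul_simps smult_closed rsmult_closed rsmult_assoc\<close>)
qed (auto intro: lmul_Scal_hom lmul_Tens_hom)

sublocale L: tensor_module R M T "\<lambda>r. lmul (Scal r)" "\<lambda>m. lmul (Tens [m])"
  by (rule tensor_module_self)

text \<open>The action of a word on a word is their product as words.  If a word ends in a letter and is followed by a
  scalar, the scalar is absorbed by the last letter.\<close>

lemma word_mult_gen:
  assumes "u \<in> S" "v \<in> S"
  shows "tword_mult R M u v \<in> S \<and> L.word_val (T.gen v) u = T.gen (tword_mult R M u v)"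
  using assms(1)
proof (cases rule: twords_cases)
  case (Scal r)
  from assms(2) show ?thesis
    by (cases rule: twords_cases) (use Scal in \<open>simp_all add: Scal_mem Tens_mem lmul_Scal_gen smult_closed\<close>)
next
  case u: (Tens m ms)
  from assms(2) show ?thesis
  proof (cases rule: twords_cases)
    case (Scal s)
    have fold: "foldr (\<lambda>m. lmul (Tens [m])) ms (tn [rsmult M l s]) = tn (ms @ [rsmult M l s])"
      if "set ms \<subseteq> carrier M" "l \<in> carrier M" for ms l
      using that
    proof (induction ms)
      case (Cons m ms)
      then show ?case
        using lmul_simps(4)[of m "hd (ms @ [rsmult M l s])" "tl (ms @ [rsmult M l s])"] Scal
        by (cases ms) (simp_all add: rsmult_closed)
    qed simp
    obtain ns l where ns: "m # ms = ns @ [l]" by (metis rev_exhaust list.distinct(1))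
    have "set (m # ms) \<subseteq> carrier M" using u by simp
    then have "set ns \<subseteq> carrier M" "l \<in> carrier M" unfolding ns by auto
    moreover have "foldr (\<lambda>m. lmul (Tens [m])) (m # ms) (sc s) = foldr (\<lambda>m. lmul (Tens [m])) ns (tn [rsmult M l s])"
      using Scal \<open>l \<in> carrier M\<close> by (simp add: ns lmul_simps)
    ultimately show ?thesis
      using Scal u fold[of ns l] \<open>set (m # ms) \<subseteq> _\<close> by (simp add: ns Tens_mem rsmult_closed sc_eq tn_def)
  next
    case (Tens n ns)
    have "foldr (\<lambda>m. lmul (Tens [m])) ms (tn (n # ns)) = tn (ms @ n # ns)" if "set ms \<subseteq> carrier M" for ms
      using that
    proof (induction ms)
      case (Cons m ms)
      then show ?case
        using lmul_simps(4)[of m "hd (ms @ n # ns)" "tl (ms @ n # ns)"] Tens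
        by (cases ms) simp_all
    qed simp
    from this[of "m # ms"] show ?thesis
      using Tens u by (simp add: Tens_mem tn_def)
  qed
qed

text \<open>The product, a union over all representatives of both factors, is the action of the left factor on the
  right one.\<close>

lemma mult_eq:
  assumes U: "U \<in> carrier T" and V: "V \<in> carrier T"
  shows "U \<otimes>\<^bsub>T\<^esub> V = L.eval_at V U"
proof -
  obtain x0 where x0: "Poly_Mapping.keys x0 \<subseteq> S" "U = T.cls x0" using U by (rule T.cls_surj)
  obtain y0 where y0: "Poly_Mapping.keys y0 \<subseteq> S" "V = T.cls y0" using V by (rule T.cls_surj)
  let ?m = "tword_mult R M"
  have main: "T.cls (frag_extend (\<lambda>u. frag_extend (\<lambda>v. frag_of (?m u v)) y) x) = L.eval_at V U"
    if "x \<in> U" "y \<in> V" for x y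
  proof -
    have x: "Poly_Mapping.keys x \<subseteq> S" "U = T.cls x"
      using that(1) x0 T.cls_eqD[of x x0] T.cls_cong[of x x0] by simp_all
    have y: "Poly_Mapping.keys y \<subseteq> S" "V = T.cls y"
      using that(2) y0 T.cls_eqD[of y y0] T.cls_cong[of y y0] by simp_all
    have inner: "T.cls (frag_extend (\<lambda>v. frag_of (?m u v)) y) = L.eval_at V (T.gen u) \<and>
       Poly_Mapping.keys (frag_extend (\<lambda>v. frag_of (?m u v)) y) \<subseteq> S" if u: "u \<in> S" for u
    proof -
      have k: "Poly_Mapping.keys (frag_of (?m u v)) \<subseteq> S" if "v \<in> S" for v
        using word_mult_gen[OF u that] by simp
      have "T.cls (frag_extend (\<lambda>v. frag_of (?m u v)) y) = frag_sum T (\<lambda>v. T.gen (?m u v)) y"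
        using T.cls_frag_extend[OF k y(1)] by simp
      also have "\<dots> = frag_sum T (\<lambda>v. L.word_val (T.gen v) u) y"
      proof (rule T.G.frag_sum_cong)
        fix v assume "v \<in> Poly_Mapping.keys y"
        then have "v \<in> S" using y by auto
        then show "T.gen (?m u v) = L.word_val (T.gen v) u" using word_mult_gen[OF u] by simp
        show "L.word_val (T.gen v) u \<in> carrier T"
          using add_hom_closed[OF L.word_val_hom[OF u] T.gen_closed[OF \<open>v \<in> S\<close>]] .
      qed
      also have "\<dots> = L.word_val V u"
        using T.add_hom_cls[OF T.is_abelian_group L.word_val_hom[OF u] y(1)] y(2) by simp
      finally show ?thesis
        using T.cls_frag_extend[OF k y(1)] u V by (simp add: L.eval_at_gen)
    qed
    have "T.cls (frag_extend (\<lambda>u. frag_extend (\<lambda>v. frag_of (?m u v)) y) x)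
        = frag_sum T (\<lambda>u. T.cls (frag_extend (\<lambda>v. frag_of (?m u v)) y)) x"
      by (rule conjunct1, rule T.cls_frag_extend[OF _ x(1)]) (use inner in blast)
    also have "\<dots> = frag_sum T (\<lambda>u. L.eval_at V (T.gen u)) x"
    proof (rule T.G.frag_sum_cong)
      fix u assume "u \<in> Poly_Mapping.keys x"
      then have "u \<in> S" using x by auto
      then show "T.cls (frag_extend (\<lambda>v. frag_of (?m u v)) y) = L.eval_at V (T.gen u)"
        using inner by blast
      show "L.eval_at V (T.gen u) \<in> carrier T"
        using add_hom_closed[OF L.eval_at_hom[OF V] T.gen_closed[OF \<open>u \<in> S\<close>]] .
    qed
    also have "\<dots> = L.eval_at V U"
      using T.add_hom_cls[OF T.is_abelian_group L.eval_at_hom[OF V] x(1)] x(2) by simp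
    finally show ?thesis .
  qed
  have "U \<otimes>\<^bsub>T\<^esub> V = (\<Union>x\<in>U. \<Union>y\<in>V. T.cls (frag_extend (\<lambda>u. frag_extend (\<lambda>v. frag_of (?m u v)) y) x))"
    by (simp add: tensor_algebra_def Let_def tword_class_def)
  also have "\<dots> = (\<Union>x\<in>U. \<Union>y\<in>V. L.eval_at V U)"
    by (intro SUP_cong refl main)
  also have "\<dots> = L.eval_at V U"
  proof -
    have "x0 \<in> U" "y0 \<in> V" using T.mem_cls x0 y0 by auto
    then show ?thesis by blast
  qed
  finally show ?thesis .
qed

lemma sc_mult_lmul: "\<lbrakk>r \<in> carrier R; V \<in> carrier T\<rbrakk> \<Longrightarrow> sc r \<otimes>\<^bsub>T\<^esub> V = lmul (Scal r) V"
  by (simp add: mult_eq sc_closed L.eval_at_sc)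

lemma tn_mult_lmul: "\<lbrakk>m \<in> carrier M; V \<in> carrier T\<rbrakk> \<Longrightarrow> tn [m] \<otimes>\<^bsub>T\<^esub> V = lmul (Tens [m]) V"
  by (simp add: mult_eq tn_closed L.eval_at_tn)

lemma one_eq: "\<one>\<^bsub>T\<^esub> = sc \<one>"
  by (simp add: tensor_algebra_def Let_def)

lemma ring_T: "ring T"
proof (rule ringI)
  have lc: "L.eval_at V U \<in> carrier T" if "U \<in> carrier T" "V \<in> carrier T" for U V
    using add_hom_closed[OF L.eval_at_hom] that by blast
  show "abelian_group T" by (rule T.is_abelian_group)
  show "monoid T"
  proof (rule monoidI)
    show "U \<otimes>\<^bsub>T\<^esub> V \<in> carrier T" if "U \<in> carrier T" "V \<in> carrier T" for U V
      using that lc by (simp add: mult_eq)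
    show "\<one>\<^bsub>T\<^esub> \<in> carrier T" by (simp add: one_eq sc_closed)
    show "U \<otimes>\<^bsub>T\<^esub> V \<otimes>\<^bsub>T\<^esub> W = U \<otimes>\<^bsub>T\<^esub> (V \<otimes>\<^bsub>T\<^esub> W)"
      if "U \<in> carrier T" "V \<in> carrier T" "W \<in> carrier T" for U V W
    proof -
      have "L.eval_at W (L.eval_at V U) = L.eval_at (L.eval_at W V) U"
        using that(1)
      proof (induction rule: tensor_alg_induct0)
        case zero
        then show ?case using that lc
          by (simp add: add_hom_zero[OF T.is_abelian_group T.is_abelian_group L.eval_at_hom])
      next
        case (diff U1 U2)
        then show ?case using that lc
          by (simp add: add_hom_diff[OF T.is_abelian_group T.is_abelian_group L.eval_at_hom])
      next
        case (sc r)
        then show ?case using that lc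
          by (simp add: L.eval_at_sc L.eval_at_lmul_Scal)
      next
        case (lmul m U1)
        then show ?case using that lc
          by (simp add: L.eval_at_lmul_Tens)
      qed
      then show ?thesis using that lc by (simp add: mult_eq)
    qed
    show "\<one>\<^bsub>T\<^esub> \<otimes>\<^bsub>T\<^esub> U = U" if "U \<in> carrier T" for U
      using that by (simp add: one_eq sc_mult_lmul L.act_one)
    show "U \<otimes>\<^bsub>T\<^esub> \<one>\<^bsub>T\<^esub> = U" if "U \<in> carrier T" for U
    proof -
      have "L.eval_at (sc \<one>) U = U"
        using that
      proof (induction rule: tensor_alg_induct0)
        case zero
        then show ?case
          by (simp add: sc_closed add_hom_zero[OF T.is_abelian_group T.is_abelian_group L.eval_at_hom])
      next
        case (diff U1 U2)
        then show ?case
          by (simp add: sc_closed add_hom_diff[OF T.is_abelian_group T.is_abelian_group L.eval_at_hom])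
      qed (simp_all add: sc_closed L.eval_at_sc L.eval_at_lmul_Tens lmul_simps)
      then show ?thesis using that by (simp add: one_eq mult_eq sc_closed)
    qed
  qed
  show "(U \<oplus>\<^bsub>T\<^esub> V) \<otimes>\<^bsub>T\<^esub> W = U \<otimes>\<^bsub>T\<^esub> W \<oplus>\<^bsub>T\<^esub> V \<otimes>\<^bsub>T\<^esub> W"
    if "U \<in> carrier T" "V \<in> carrier T" "W \<in> carrier T" for U V W
    using that by (simp add: mult_eq add_hom_add[OF L.eval_at_hom])
  show "W \<otimes>\<^bsub>T\<^esub> (U \<oplus>\<^bsub>T\<^esub> V) = W \<otimes>\<^bsub>T\<^esub> U \<oplus>\<^bsub>T\<^esub> W \<otimes>\<^bsub>T\<^esub> V"
    if "U \<in> carrier T" "V \<in> carrier T" "W \<in> carrier T" for U V W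
    using that by (simp add: mult_eq add_hom_add[OF L.eval_at_arg_hom])
qed

sublocale TR: ring T by (rule ring_T)

text \<open>The canonical map from \<open>M\<close> to the component of degree \<open>1\<close>.\<close>

abbreviation emb :: "'m \<Rightarrow> ('r, 'm) tensor_word_class" where "emb m \<equiv> tn [m]"

lemma emb_hom: "(\<lambda>m. emb m) \<in> add_hom M T"
  using tn_hom[of "[]" "[]"] by simp

lemma emb_closed: "m \<in> carrier M \<Longrightarrow> emb m \<in> carrier T"
  by (simp add: tn_closed)

lemma sc_mult: "\<lbrakk>r \<in> carrier R; s \<in> carrier R\<rbrakk> \<Longrightarrow> sc (r \<otimes> s) = sc r \<otimes>\<^bsub>T\<^esub> sc s"
  by (simp add: sc_mult_lmul sc_closed lmul_simps)

lemma emb_smult: "\<lbrakk>r \<in> carrier R; m \<in> carrier M\<rbrakk> \<Longrightarrow> emb (r \<odot>\<^bsub>M\<^esub> m) = sc r \<otimes>\<^bsub>T\<^esub> emb m"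
  by (simp add: sc_mult_lmul tn_closed lmul_simps)

lemma emb_rsmult: "\<lbrakk>r \<in> carrier R; m \<in> carrier M\<rbrakk> \<Longrightarrow> emb (rsmult M m r) = emb m \<otimes>\<^bsub>T\<^esub> sc r"
  by (simp add: tn_mult_lmul sc_closed lmul_simps)

lemma tn_Cons: "\<lbrakk>m \<in> carrier M; set ms \<subseteq> carrier M; ms \<noteq> []\<rbrakk> \<Longrightarrow> tn (m # ms) = emb m \<otimes>\<^bsub>T\<^esub> tn ms"
  by (cases ms) (simp_all add: tn_mult_lmul tn_closed lmul_simps)

lemma tensor_alg_induct [consumes 1, case_names zero diff sc emb]:
  assumes "U \<in> carrier T" "P \<zero>\<^bsub>T\<^esub>"
    "\<And>U V. \<lbrakk>U \<in> carrier T; V \<in> carrier T; P U; P V\<rbrakk> \<Longrightarrow> P (U \<ominus>\<^bsub>T\<^esub> V)"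
    "\<And>r. r \<in> carrier R \<Longrightarrow> P (sc r)"
    "\<And>m U. \<lbrakk>m \<in> carrier M; U \<in> carrier T; P U\<rbrakk> \<Longrightarrow> P (emb m \<otimes>\<^bsub>T\<^esub> U)"
  shows "P U"
  using assms by (auto intro: tensor_alg_induct0[of U P] simp: tn_mult_lmul)

section \<open>The grading of the tensor algebra\<close>

abbreviation "hom_T n \<equiv> homog T n"

lemma homog_eq:
  "hom_T n = T.cls ` {x. Poly_Mapping.keys x \<subseteq> S \<and> (\<forall>w\<in>Poly_Mapping.keys x. tword_degree w = n)}"
  by (simp add: tensor_algebra_def Let_def tword_class_def)

lemma homog_closed: "U \<in> hom_T n \<Longrightarrow> U \<in> carrier T"
  by (auto simp: homog_eq intro: T.cls_closed)

lemma homog_gen: "w \<in> S \<Longrightarrow> T.gen w \<in> hom_T (tword_degree w)"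
  unfolding homog_eq by (rule imageI) simp

lemma homog_sc: "r \<in> carrier R \<Longrightarrow> sc r \<in> hom_T 0"
  using homog_gen[of "Scal r"] by (simp add: sc_eq Scal_mem)

lemma homog_tn: "set ms \<subseteq> carrier M \<Longrightarrow> ms \<noteq> [] \<Longrightarrow> tn ms \<in> hom_T (int (length ms))"
  using homog_gen[of "Tens ms"] by (simp add: tn_def Tens_mem)

lemma homog_emb: "m \<in> carrier M \<Longrightarrow> emb m \<in> hom_T 1"
  using homog_tn[of "[m]"] by simp

lemma homog_zero: "\<zero>\<^bsub>T\<^esub> \<in> hom_T n"
  unfolding homog_eq by (rule image_eqI[of _ _ 0]) (simp_all add: T.cls_zero)

lemma homog_diff:
  assumes "U \<in> hom_T n" "V \<in> hom_T n"
  shows "U \<ominus>\<^bsub>T\<^esub> V \<in> hom_T n"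
proof -
  obtain x where x: "U = T.cls x" "Poly_Mapping.keys x \<subseteq> S" "\<forall>w\<in>Poly_Mapping.keys x. tword_degree w = n"
    using assms(1) by (auto simp: homog_eq)
  obtain y where y: "V = T.cls y" "Poly_Mapping.keys y \<subseteq> S" "\<forall>w\<in>Poly_Mapping.keys y. tword_degree w = n"
    using assms(2) by (auto simp: homog_eq)
  show ?thesis
    unfolding homog_eq
    by (rule image_eqI[of _ _ "x - y"])
       (use x y keys_diff[of x y] in \<open>auto simp: T.cls_diff\<close>)
qed

lemma homog_neg: "U \<in> hom_T n \<Longrightarrow> \<ominus>\<^bsub>T\<^esub> U \<in> hom_T n"
  using homog_diff[OF homog_zero, of U n] by (simp add: a_minus_def homog_closed)

lemma homog_add: "U \<in> hom_T n \<Longrightarrow> V \<in> hom_T n \<Longrightarrow> U \<oplus>\<^bsub>T\<^esub> V \<in> hom_T n"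
  using homog_diff[OF _ homog_neg[of V n], of U] by (simp add: a_minus_def homog_closed)

lemma homog_induct [consumes 1, case_names zero diff gen]:
  assumes "U \<in> hom_T n" "P \<zero>\<^bsub>T\<^esub>"
    "\<And>U V. \<lbrakk>U \<in> hom_T n; V \<in> hom_T n; P U; P V\<rbrakk> \<Longrightarrow> P (U \<ominus>\<^bsub>T\<^esub> V)"
    "\<And>w. \<lbrakk>w \<in> S; tword_degree w = n\<rbrakk> \<Longrightarrow> P (T.gen w)"
  shows "P U"
proof -
  let ?S = "{w \<in> S. tword_degree w = n}"
  obtain x where x: "U = T.cls x" "Poly_Mapping.keys x \<subseteq> ?S"
    using assms(1) by (auto simp: homog_eq)
  have cl: "T.cls y \<in> hom_T n" "Poly_Mapping.keys y \<subseteq> S" if "Poly_Mapping.keys y \<subseteq> ?S" for y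
    using that by (auto simp: homog_eq)
  have "P (T.cls x)" using x(2)
    by (induction x rule: frag_induct) (use assms(2-) cl in \<open>auto simp: T.cls_zero T.cls_diff\<close>)
  then show ?thesis using x by simp
qed

lemma homog_mult_aux:
  assumes "w \<in> S" "V \<in> hom_T n"
  shows "T.gen w \<otimes>\<^bsub>T\<^esub> V \<in> hom_T (tword_degree w + n)"
  using assms(2)
proof (induction rule: homog_induct)
  case zero
  then show ?case using assms(1) by (simp add: T.gen_closed homog_zero)
next
  case (diff U V)
  then show ?case
    using assms(1) homog_diff[OF diff(3,4)] homog_closed[OF diff(1)] homog_closed[OF diff(2)]
    by (simp add: a_minus_def TR.r_distr TR.r_minus T.gen_closed)
next
  case (gen v)
  have e: "T.gen w \<otimes>\<^bsub>T\<^esub> T.gen v = T.gen (tword_mult R M w v)" and m: "tword_mult R M w v \<in> S"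
    using word_mult_gen[OF assms(1) gen(1)] assms(1) gen(1)
    by (simp_all add: mult_eq T.gen_closed L.eval_at_gen)
  have "tword_degree (tword_mult R M w v) = tword_degree w + n"
    using assms(1) gen by (auto elim!: twords_cases)
  then show ?case using homog_gen[OF m] by (simp add: e)
qed

lemma homog_mult:
  assumes "U \<in> hom_T m" "V \<in> hom_T n"
  shows "U \<otimes>\<^bsub>T\<^esub> V \<in> hom_T (m + n)"
  using assms(1)
proof (induction rule: homog_induct)
  case zero
  then show ?case using assms(2) by (simp add: homog_closed homog_zero)
next
  case (diff U U')
  then show ?case
    using homog_diff[OF diff(3,4)] homog_closed[OF diff(1)] homog_closed[OF diff(2)] homog_closed[OF assms(2)]
    by (simp add: a_minus_def TR.l_distr TR.l_minus)
next
  case (gen w)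
  then show ?case using homog_mult_aux[OF gen(1) assms(2)] by simp
qed

text \<open>The projection onto the component of degree \<open>n\<close>; it exists because all relators are homogeneous.\<close>

definition proj :: "int \<Rightarrow> ('r, 'm) tensor_word_class \<Rightarrow> ('r, 'm) tensor_word_class" where
  "proj n = lift_map T (\<lambda>w. if tword_degree w = n then T.gen w else \<zero>\<^bsub>T\<^esub>)"

lemma
  shows proj_hom: "proj n \<in> add_hom T T"
    and proj_gen: "w \<in> S \<Longrightarrow> proj n (T.gen w) = (if tword_degree w = n then T.gen w else \<zero>\<^bsub>T\<^esub>)"
proof -
  let ?h = "\<lambda>w. if tword_degree w = n then T.gen w else \<zero>\<^bsub>T\<^esub>"
  have 0: "(\<lambda>r. ?h (Scal r)) \<in> add_hom R T"
    using sc_hom by (cases "n = 0") (simp_all add: sc_eq [abs_def] T.G.add_hom_0)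
  have 1: "(\<lambda>m. ?h (Tens (us @ m # vs))) \<in> add_hom M T"
    if "set us \<subseteq> carrier M" "set vs \<subseteq> carrier M" for us vs
    using tn_hom[OF that]
    by (cases "1 + (int (length us) + int (length vs)) = n") (simp_all add: tn_def T.G.add_hom_0)
  have 2: "?h (Tens (us @ rsmult M m r # m' # vs)) = ?h (Tens (us @ m # (r \<odot>\<^bsub>M\<^esub> m') # vs))"
    if "set us \<subseteq> carrier M" "set vs \<subseteq> carrier M" "m \<in> carrier M" "m' \<in> carrier M" "r \<in> carrier R" for us vs m m' r
    using tn_balanced[OF that] by (simp add: tn_def)
  show "proj n \<in> add_hom T T"
    unfolding proj_def by (rule tword_lift_hom[OF T.is_abelian_group 0 1 2])
  show "proj n (T.gen w) = ?h w" if "w \<in> S"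
    unfolding proj_def by (rule tword_lift_gen[OF T.is_abelian_group 0 1 2 that])
qed

lemma proj_homog: "U \<in> hom_T m \<Longrightarrow> proj n U = (if m = n then U else \<zero>\<^bsub>T\<^esub>)"
proof (induction rule: homog_induct)
  case zero
  then show ?case by (simp add: add_hom_zero[OF T.is_abelian_group T.is_abelian_group proj_hom])
next
  case (diff U V)
  then show ?case
    using homog_closed[OF diff(1)] homog_closed[OF diff(2)] T.G.diff_eq_iff[of "\<zero>\<^bsub>T\<^esub>" "\<zero>\<^bsub>T\<^esub>" "\<zero>\<^bsub>T\<^esub>"]
    by (simp add: add_hom_diff[OF T.is_abelian_group T.is_abelian_group proj_hom])
next
  case (gen w)
  then show ?case by (simp add: proj_gen)
qed

lemma proj_in_homog: "U \<in> carrier T \<Longrightarrow> proj n U \<in> hom_T n"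
proof (induction rule: T.presented_induct)
  case zero
  then show ?case by (simp add: add_hom_zero[OF T.is_abelian_group T.is_abelian_group proj_hom] homog_zero)
next
  case (diff U V)
  then show ?case
    by (simp add: add_hom_diff[OF T.is_abelian_group T.is_abelian_group proj_hom] homog_diff)
next
  case (gen w)
  then show ?case using homog_gen[of w] by (auto simp: proj_gen homog_zero)
qed

text \<open>A class is the sum of its homogeneous components, over any finite set of degrees that contains the degrees
  of the words in a representative.\<close>

lemma sum_proj:
  assumes "finite F" "Poly_Mapping.keys x \<subseteq> {w \<in> S. tword_degree w \<in> F}"
  shows "finsum T (\<lambda>n. proj n (T.cls x)) F = T.cls x"
  using assms(2)
proof (induction x rule: frag_induct)
  case zero
  then show ?case
    by (simp add: T.cls_zero add_hom_zero[OF T.is_abelian_group T.is_abelian_group proj_hom])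
next
  case (diff x y)
  have k: "Poly_Mapping.keys x \<subseteq> S" "Poly_Mapping.keys y \<subseteq> S" using diff by auto
  have hom: "(\<lambda>U. finsum T (\<lambda>n. proj n U) F) \<in> add_hom T T"
  proof (rule add_homI)
    fix U V assume "U \<in> carrier T" "V \<in> carrier T"
    then show "finsum T (\<lambda>n. proj n (U \<oplus>\<^bsub>T\<^esub> V)) F = finsum T (\<lambda>n. proj n U) F \<oplus>\<^bsub>T\<^esub> finsum T (\<lambda>n. proj n V) F"
      by (simp add: add_hom_add[OF proj_hom] add_hom_closed[OF proj_hom] Pi_def flip: T.G.finsum_addf)
  qed (auto intro: T.G.finsum_closed add_hom_closed[OF proj_hom])
  show ?case
    using diff k
    by (simp add: T.cls_diff T.cls_closed add_hom_diff[OF T.is_abelian_group T.is_abelian_group hom])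
next
  case (gen w)
  then have "finsum T (\<lambda>n. proj n (T.gen w)) F = finsum T (\<lambda>n. if tword_degree w = n then T.gen w else \<zero>\<^bsub>T\<^esub>) F"
    by (simp add: proj_gen)
  also have "\<dots> = T.gen w"
    using gen assms(1) by (intro T.G.add.finprod_singleton) (auto simp: T.gen_closed)
  finally show ?case .
qed

lemma add_hom_finsum:
  assumes "f \<in> add_hom T T" "finite F" "p \<in> F \<rightarrow> carrier T"
  shows "f (finsum T p F) = finsum T (\<lambda>i. f (p i)) F"
  using assms(2,3)
proof (induction F rule: finite_induct)
  case empty
  then show ?case by (simp add: add_hom_zero[OF T.is_abelian_group T.is_abelian_group assms(1)])
next
  case (insert i F)
  then show ?case
    by (simp add: Pi_def add_hom_add[OF assms(1)] add_hom_closed[OF assms(1)])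
qed

lemma direct_sum:
  assumes "U \<in> carrier T"
  shows "\<exists>!p. (\<forall>n. p n \<in> hom_T n) \<and> finite {n. p n \<noteq> \<zero>\<^bsub>T\<^esub>} \<and> U = finsum T p {n. p n \<noteq> \<zero>\<^bsub>T\<^esub>}"
proof (rule ex1I[of _ "\<lambda>n. proj n U"])
  obtain x where x: "Poly_Mapping.keys x \<subseteq> S" "U = T.cls x" using assms by (rule T.cls_surj)
  let ?F = "tword_degree ` Poly_Mapping.keys x"
  have sum: "finsum T (\<lambda>n. proj n U) G = U" if "finite G" "?F \<subseteq> G" for G
    unfolding x(2) by (rule sum_proj) (use x(1) that in auto)
  have sub: "{n. proj n U \<noteq> \<zero>\<^bsub>T\<^esub>} \<subseteq> ?F"
  proof
    fix n assume n: "n \<in> {n. proj n U \<noteq> \<zero>\<^bsub>T\<^esub>}"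
    show "n \<in> ?F"
    proof (rule ccontr)
      assume "n \<notin> ?F"
      have "proj n U \<oplus>\<^bsub>T\<^esub> finsum T (\<lambda>n. proj n U) ?F = finsum T (\<lambda>n. proj n U) (insert n ?F)"
        using \<open>n \<notin> ?F\<close> assms by (subst T.G.finsum_insert) (auto intro: add_hom_closed[OF proj_hom])
      then have "proj n U \<oplus>\<^bsub>T\<^esub> U = U" using sum[of ?F] sum[of "insert n ?F"] by auto
      then have "proj n U = \<zero>\<^bsub>T\<^esub>"
        using assms add_hom_closed[OF proj_hom assms] T.G.add.r_cancel_one' by metis
      then show False using n by simp
    qed
  qed
  have fin: "finite {n. proj n U \<noteq> \<zero>\<^bsub>T\<^esub>}" using sub by (rule finite_subset) simp
  have "finsum T (\<lambda>n. proj n U) {n. proj n U \<noteq> \<zero>\<^bsub>T\<^esub>} = finsum T (\<lambda>n. proj n U) ?F"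
    by (rule T.G.add.finprod_mono_neutral_cong_left)
       (use sub assms in \<open>auto intro: add_hom_closed[OF proj_hom]\<close>)
  then show "(\<forall>n. proj n U \<in> hom_T n) \<and> finite {n. proj n U \<noteq> \<zero>\<^bsub>T\<^esub>} \<and>
      U = finsum T (\<lambda>n. proj n U) {n. proj n U \<noteq> \<zero>\<^bsub>T\<^esub>}"
    using fin sum[of ?F] proj_in_homog[OF assms] by simp
next
  fix p assume p: "(\<forall>n. p n \<in> hom_T n) \<and> finite {n. p n \<noteq> \<zero>\<^bsub>T\<^esub>} \<and> U = finsum T p {n. p n \<noteq> \<zero>\<^bsub>T\<^esub>}"
  let ?F = "{n. p n \<noteq> \<zero>\<^bsub>T\<^esub>}"
  have ph: "p m \<in> hom_T m" for m using p by blast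
  have pc: "p m \<in> carrier T" for m using homog_closed[OF ph] .
  show "p = (\<lambda>n. proj n U)"
  proof
    fix n
    have "proj n U = finsum T (\<lambda>m. proj n (p m)) ?F"
      using p pc add_hom_finsum[OF proj_hom, of ?F p n] by simp
    also have "\<dots> = finsum T (\<lambda>m. if n = m then p m else \<zero>\<^bsub>T\<^esub>) ?F"
      by (rule T.G.finsum_cong') (simp_all add: Pi_def pc proj_homog[OF ph])
    also have "\<dots> = p n"
    proof (cases "n \<in> ?F")
      case True
      then show ?thesis using p pc by (intro T.G.add.finprod_singleton) simp_all
    next
      case False
      then have "finsum T (\<lambda>m. if n = m then p m else \<zero>\<^bsub>T\<^esub>) ?F = finsum T (\<lambda>m. \<zero>\<^bsub>T\<^esub>) ?F"
        by (intro T.G.finsum_cong') (simp_all, metis)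
      then show ?thesis using False by simp
    qed
    finally show "p n = proj n U" by simp
  qed
qed

end

context tensor_module
begin

lemma eval_at_sc_mult:
  "\<lbrakk>e \<in> carrier H; r \<in> carrier R; U \<in> carrier T\<rbrakk> \<Longrightarrow> eval_at e (sc r \<otimes>\<^bsub>T\<^esub> U) = act r (eval_at e U)"
  by (simp add: sc_mult_lmul eval_at_lmul_Scal)

lemma eval_at_emb_mult:
  "\<lbrakk>e \<in> carrier H; m \<in> carrier M; U \<in> carrier T\<rbrakk> \<Longrightarrow> eval_at e (emb m \<otimes>\<^bsub>T\<^esub> U) = op m (eval_at e U)"
  by (simp add: tn_mult_lmul eval_at_lmul_Tens)

lemma eval_at_emb: "\<lbrakk>e \<in> carrier H; m \<in> carrier M\<rbrakk> \<Longrightarrow> eval_at e (emb m) = op m e"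
  by (simp add: eval_at_tn)

end



section \<open>Noncommutative differential forms\<close>

text \<open>A ring with a subring, the setting of everything that does not involve scalars from the field.\<close>

locale ring_extension = ring A for A :: "('k, 'a, 'x) module_scheme" (structure) +
  fixes B :: "'a set"
  assumes sub: "subring B A"
begin

lemma B_carrier: "b \<in> B \<Longrightarrow> b \<in> carrier A"
  using subringE(1)[OF sub] by blast

lemma one_B: "\<one> \<in> B"
  using subringE(3)[OF sub] .

lemma self_fields [simp]:
  "carrier (self_bimodule A) = carrier A" "add (self_bimodule A) = add A"
  "\<zero>\<^bsub>self_bimodule A\<^esub> = \<zero>"
  "r \<odot>\<^bsub>self_bimodule A\<^esub> x = r \<otimes> x" "rsmult (self_bimodule A) x r = x \<otimes> r"
  by (simp_all add: bimodule_via_def)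

sublocale AA: tensor B "self_bimodule A" "self_bimodule A"
proof -
  interpret S: bimodule A "self_bimodule A" by (rule self_bimodule)
  show "tensor B (self_bimodule A) (self_bimodule A)"
    by unfold_locales (simp_all add: B_carrier)
qed

abbreviation "AA \<equiv> tensor_product B (self_bimodule A) (self_bimodule A)"
abbreviation "tp \<equiv> AA.pure"
abbreviation "mu \<equiv> mult_map A"
abbreviation "\<Omega> \<equiv> Omega1_nc A B"

lemma add_hom_self [simp]:
  "add_hom (self_bimodule A) H = add_hom A H" "add_hom H (self_bimodule A) = add_hom H A"
  by (simp_all add: add_hom_def)

lemma add_hom_mult_left: "a \<in> carrier A \<Longrightarrow> (\<lambda>x. a \<otimes> x) \<in> add_hom A A"
  by (rule add_homI) (simp_all add: r_distr)

lemma add_hom_mult_right: "a \<in> carrier A \<Longrightarrow> (\<lambda>x. x \<otimes> a) \<in> add_hom A A"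
  by (rule add_homI) (simp_all add: l_distr)

lemmas tp_closed = AA.pure_closed [simplified]
lemmas tp_hom_left = AA.pure_hom_left [simplified]
lemmas tp_hom_right = AA.pure_hom_right [simplified]
lemmas tp_balanced = AA.pure_balanced [simplified]
lemmas AA_hom_eqI = AA.tensor_hom_eqI [simplified]

lemma AA_lift:
  assumes "abelian_group H"
    and "\<And>y. y \<in> carrier A \<Longrightarrow> (\<lambda>x. h x y) \<in> add_hom A H"
    and "\<And>x. x \<in> carrier A \<Longrightarrow> (\<lambda>y. h x y) \<in> add_hom A H"
    and "\<And>x b y. \<lbrakk>x \<in> carrier A; b \<in> B; y \<in> carrier A\<rbrakk> \<Longrightarrow> h (x \<otimes> b) y = h x (b \<otimes> y)"
  shows "lift_map H (\<lambda>(x, y). h x y) \<in> add_hom AA H"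
    and "\<lbrakk>x \<in> carrier A; y \<in> carrier A\<rbrakk> \<Longrightarrow> lift_map H (\<lambda>(x, y). h x y) (tp x y) = h x y"
  using AA.tensor_lift_hom[of H h] AA.tensor_lift_pure[of H h] assms by simp_all

text \<open>The multiplication map is the map induced by \<open>(a, a') \<mapsto> a a'\<close>.\<close>

lemma mu_eq: "mu = lift_map A (\<lambda>(a, a'). a \<otimes> a')"
  by (simp add: fun_eq_iff mult_map_def lift_map_def frag_sum_def split_def)

lemma mu_hom: "mu \<in> add_hom AA A"
  unfolding mu_eq
  by (rule AA_lift) (simp_all add: abelian_group_axioms add_hom_mult_left add_hom_mult_right m_assoc B_carrier)

lemma mu_tp: "\<lbrakk>x \<in> carrier A; y \<in> carrier A\<rbrakk> \<Longrightarrow> mu (tp x y) = x \<otimes> y"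
  unfolding mu_eq
  by (rule AA_lift) (simp_all add: abelian_group_axioms add_hom_mult_left add_hom_mult_right m_assoc B_carrier)

lemma
  assumes "a \<in> carrier A"
  shows lact_hom: "(\<lambda>U. a \<odot>\<^bsub>AA\<^esub> U) \<in> add_hom AA AA"
    and lact_tp: "\<lbrakk>x \<in> carrier A; y \<in> carrier A\<rbrakk> \<Longrightarrow> a \<odot>\<^bsub>AA\<^esub> tp x y = tp (a \<otimes> x) y"
    and ract_hom: "(\<lambda>U. rsmult AA U a) \<in> add_hom AA AA"
    and ract_tp: "\<lbrakk>x \<in> carrier A; y \<in> carrier A\<rbrakk> \<Longrightarrow> rsmult AA (tp x y) a = tp x (y \<otimes> a)"
  using assms AA.tensor_smult_hom[of a] AA.tensor_smult_pure[of a] AA.tensor_rsmult_hom[of a] AA.tensor_rsmult_pure[of a]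
  by (simp_all add: add_hom_mult_left add_hom_mult_right m_assoc B_carrier)

lemma lact_closed: "\<lbrakk>a \<in> carrier A; U \<in> carrier AA\<rbrakk> \<Longrightarrow> a \<odot>\<^bsub>AA\<^esub> U \<in> carrier AA"
  using add_hom_closed[OF lact_hom] .

lemma ract_closed: "\<lbrakk>a \<in> carrier A; U \<in> carrier AA\<rbrakk> \<Longrightarrow> rsmult AA U a \<in> carrier AA"
  using add_hom_closed[OF ract_hom] .

lemma bimodule_AA: "bimodule A AA"
proof -
  note eqI = AA_hom_eqI[OF AA.P.is_abelian_group]
  note plus = AA.P.G.add_hom_plus
  show ?thesis
  proof
    fix r x assume r: "r \<in> carrier A" and x: "x \<in> carrier AA"
    show "r \<odot>\<^bsub>AA\<^esub> x \<in> carrier AA" "rsmult AA x r \<in> carrier AA"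
      using r x lact_closed ract_closed by auto
    show "r \<odot>\<^bsub>AA\<^esub> (x \<oplus>\<^bsub>AA\<^esub> y) = r \<odot>\<^bsub>AA\<^esub> x \<oplus>\<^bsub>AA\<^esub> r \<odot>\<^bsub>AA\<^esub> y" if "y \<in> carrier AA" for y
      using add_hom_add[OF lact_hom] r x that by simp
    show "rsmult AA (x \<oplus>\<^bsub>AA\<^esub> y) r = rsmult AA x r \<oplus>\<^bsub>AA\<^esub> rsmult AA y r" if "y \<in> carrier AA" for y
      using add_hom_add[OF ract_hom] r x that by simp
    fix s assume s: "s \<in> carrier A"
    show "(r \<oplus> s) \<odot>\<^bsub>AA\<^esub> x = r \<odot>\<^bsub>AA\<^esub> x \<oplus>\<^bsub>AA\<^esub> s \<odot>\<^bsub>AA\<^esub> x"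
      by (rule eqI[OF lact_hom plus[OF lact_hom lact_hom] _ x])
         (use r s in \<open>simp_all add: lact_tp l_distr add_hom_add[OF tp_hom_left]\<close>)
    show "rsmult AA x (r \<oplus> s) = rsmult AA x r \<oplus>\<^bsub>AA\<^esub> rsmult AA x s"
      by (rule eqI[OF ract_hom plus[OF ract_hom ract_hom] _ x])
         (use r s in \<open>simp_all add: ract_tp r_distr add_hom_add[OF tp_hom_right]\<close>)
    show "(r \<otimes> s) \<odot>\<^bsub>AA\<^esub> x = r \<odot>\<^bsub>AA\<^esub> (s \<odot>\<^bsub>AA\<^esub> x)"
      by (rule eqI[OF lact_hom add_hom_comp[OF lact_hom lact_hom] _ x])
         (use r s in \<open>simp_all add: lact_tp m_assoc\<close>)
    show "rsmult AA x (r \<otimes> s) = rsmult AA (rsmult AA x r) s"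
      by (rule eqI[OF ract_hom add_hom_comp[OF ract_hom ract_hom] _ x])
         (use r s in \<open>simp_all add: ract_tp m_assoc\<close>)
    show "rsmult AA (r \<odot>\<^bsub>AA\<^esub> x) s = r \<odot>\<^bsub>AA\<^esub> rsmult AA x s"
      by (rule eqI[OF add_hom_comp[OF ract_hom lact_hom] add_hom_comp[OF lact_hom ract_hom] _ x])
         (use r s in \<open>simp_all add: ract_tp lact_tp\<close>)
  next
    fix x assume x: "x \<in> carrier AA"
    show "\<one> \<odot>\<^bsub>AA\<^esub> x = x"
      by (rule eqI[OF lact_hom add_hom_ident _ x]) (simp_all add: lact_tp)
    show "rsmult AA x \<one> = x"
      by (rule eqI[OF ract_hom add_hom_ident _ x]) (simp_all add: ract_tp)
  qed
qed

lemma mu_lact: "\<lbrakk>a \<in> carrier A; U \<in> carrier AA\<rbrakk> \<Longrightarrow> mu (a \<odot>\<^bsub>AA\<^esub> U) = a \<otimes> mu U"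
  by (rule AA_hom_eqI[OF abelian_group_axioms add_hom_comp[OF mu_hom lact_hom] add_hom_comp[OF add_hom_mult_left mu_hom]])
     (simp_all add: lact_tp mu_tp m_assoc)

lemma mu_ract: "\<lbrakk>a \<in> carrier A; U \<in> carrier AA\<rbrakk> \<Longrightarrow> mu (rsmult AA U a) = mu U \<otimes> a"
  by (rule AA_hom_eqI[OF abelian_group_axioms add_hom_comp[OF mu_hom ract_hom] add_hom_comp[OF add_hom_mult_right mu_hom]])
     (simp_all add: ract_tp mu_tp m_assoc)

lemma Omega_carrier: "U \<in> carrier \<Omega> \<longleftrightarrow> U \<in> carrier AA \<and> mu U = \<zero>"
  by (simp add: Omega1_nc_def Let_def)

lemma Omega_fields:
  "add \<Omega> = add AA" "\<zero>\<^bsub>\<Omega>\<^esub> = \<zero>\<^bsub>AA\<^esub>" "smult \<Omega> = smult AA" "rsmult \<Omega> = rsmult AA"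
  by (simp_all add: Omega1_nc_def Let_def)

lemma Omega_abelian_group: "abelian_group \<Omega>"
proof (rule abelian_groupI)
  fix U assume "U \<in> carrier \<Omega>"
  then have U: "U \<in> carrier AA" "mu U = \<zero>" by (auto simp: Omega_carrier)
  then show "\<exists>y\<in>carrier \<Omega>. y \<oplus>\<^bsub>\<Omega>\<^esub> U = \<zero>\<^bsub>\<Omega>\<^esub>"
    by (intro bexI[of _ "\<ominus>\<^bsub>AA\<^esub> U"])
       (simp_all add: Omega_fields Omega_carrier AA.P.G.l_neg add_hom_minus[OF AA.P.is_abelian_group abelian_group_axioms mu_hom])
qed (auto simp: Omega_carrier Omega_fields AA.P.G.a_ac add_hom_add[OF mu_hom]
    add_hom_zero[OF AA.P.is_abelian_group abelian_group_axioms mu_hom])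

lemma bimodule_Omega: "bimodule A \<Omega>"
proof -
  interpret AA: bimodule A AA by (rule bimodule_AA)
  interpret O: abelian_group \<Omega> by (rule Omega_abelian_group)
  show ?thesis
    by unfold_locales
       (auto simp: Omega_carrier Omega_fields mu_lact mu_ract AA.smult_closed AA.rsmult_closed AA.smult_l_distr
         AA.smult_r_distr AA.rsmult_l_distr AA.rsmult_r_distr AA.smult_assoc AA.rsmult_assoc AA.smult_rsmult
         AA.smult_one AA.rsmult_one)
qed

sublocale TA: tensor_alg A \<Omega>
  by (rule tensor_alg.intro) (rule bimodule_Omega)

abbreviation "T \<equiv> tensor_algebra A \<Omega>"

lemma add_hom_to_Omega:
  "\<lbrakk>f \<in> add_hom G AA; \<And>x. x \<in> carrier G \<Longrightarrow> mu (f x) = \<zero>\<rbrakk> \<Longrightarrow> f \<in> add_hom G \<Omega>"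
  by (auto simp: add_hom_def Omega_fields Omega_carrier)

text \<open>The universal derivation \<open>\<delta>a = 1 \<otimes> a - a \<otimes> 1\<close>.\<close>

definition delta :: "'a \<Rightarrow> ('a, 'a) tensor" where
  "delta a = tp \<one> a \<ominus>\<^bsub>AA\<^esub> tp a \<one>"

lemma delta_hom_AA: "delta \<in> add_hom A AA"
  unfolding delta_def [abs_def] by (intro AA.P.G.add_hom_sub tp_hom_left tp_hom_right) simp_all

lemma delta_hom: "delta \<in> add_hom A \<Omega>"
  by (rule add_hom_to_Omega[OF delta_hom_AA])
     (simp add: delta_def tp_closed mu_tp add_hom_diff[OF AA.P.is_abelian_group abelian_group_axioms mu_hom] diff_eq_iff)

lemma delta_closed: "x \<in> carrier A \<Longrightarrow> delta x \<in> carrier \<Omega>" "x \<in> carrier A \<Longrightarrow> delta x \<in> carrier AA"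
  using add_hom_closed[OF delta_hom] add_hom_closed[OF delta_hom_AA] by auto

lemma lact_diff: "\<lbrakk>a \<in> carrier A; U \<in> carrier AA; V \<in> carrier AA\<rbrakk> \<Longrightarrow>
    a \<odot>\<^bsub>AA\<^esub> (U \<ominus>\<^bsub>AA\<^esub> V) = a \<odot>\<^bsub>AA\<^esub> U \<ominus>\<^bsub>AA\<^esub> a \<odot>\<^bsub>AA\<^esub> V"
  using add_hom_diff[OF AA.P.is_abelian_group AA.P.is_abelian_group lact_hom] .

lemma ract_diff: "\<lbrakk>a \<in> carrier A; U \<in> carrier AA; V \<in> carrier AA\<rbrakk> \<Longrightarrow>
    rsmult AA (U \<ominus>\<^bsub>AA\<^esub> V) a = rsmult AA U a \<ominus>\<^bsub>AA\<^esub> rsmult AA V a"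
  using add_hom_diff[OF AA.P.is_abelian_group AA.P.is_abelian_group ract_hom] .

lemma delta_mult:
  assumes "x \<in> carrier A" "y \<in> carrier A"
  shows "delta (x \<otimes> y) = rsmult AA (delta x) y \<oplus>\<^bsub>AA\<^esub> x \<odot>\<^bsub>AA\<^esub> delta y"
proof -
  have "rsmult AA (delta x) y \<oplus>\<^bsub>AA\<^esub> x \<odot>\<^bsub>AA\<^esub> delta y =
     (tp \<one> (x \<otimes> y) \<ominus>\<^bsub>AA\<^esub> tp x y) \<oplus>\<^bsub>AA\<^esub> (tp x y \<ominus>\<^bsub>AA\<^esub> tp (x \<otimes> y) \<one>)"
    using assms by (simp add: delta_def lact_diff ract_diff tp_closed lact_tp ract_tp)
  also have "\<dots> = delta (x \<otimes> y)"
    using assms by (simp add: delta_def AA.P.G.telescope tp_closed)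
  finally show ?thesis by simp
qed

text \<open>As \<open>1 \<otimes> b = b \<otimes> 1\<close> in \<open>A \<otimes>\<^sub>B A\<close>.\<close>

lemma delta_B: "b \<in> B \<Longrightarrow> delta b = \<zero>\<^bsub>AA\<^esub>"
  using tp_balanced[of \<one> b \<one>] B_carrier[of b]
  by (simp add: delta_def AA.P.G.diff_eq_iff tp_closed)

text \<open>The projection \<open>x \<otimes> y \<mapsto> x \<delta>y\<close> of \<open>A \<otimes>\<^sub>B A\<close> onto \<open>\<Omega>\<close>.  It is the identity on \<open>\<Omega>\<close>, which says that every
  element of \<open>\<Omega>\<close> is a combination of elements \<open>x \<delta>y\<close>.\<close>

definition sigma :: "('a, 'a) tensor \<Rightarrow> ('a, 'a) tensor" where
  "sigma U = U \<ominus>\<^bsub>AA\<^esub> tp (mu U) \<one>"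

lemma sigma_hom_AA: "sigma \<in> add_hom AA AA"
  unfolding sigma_def [abs_def]
  by (intro AA.P.G.add_hom_sub add_hom_ident add_hom_comp[OF tp_hom_left mu_hom]) simp

lemma sigma_hom: "sigma \<in> add_hom AA \<Omega>"
  by (rule add_hom_to_Omega[OF sigma_hom_AA])
     (simp add: sigma_def tp_closed mu_tp add_hom_closed[OF mu_hom]
       add_hom_diff[OF AA.P.is_abelian_group abelian_group_axioms mu_hom] diff_eq_iff)

lemma sigma_tp: "\<lbrakk>x \<in> carrier A; y \<in> carrier A\<rbrakk> \<Longrightarrow> sigma (tp x y) = x \<odot>\<^bsub>\<Omega>\<^esub> delta y"
  by (simp add: sigma_def delta_def Omega_fields mu_tp lact_diff tp_closed lact_tp)

lemma sigma_Omega: "U \<in> carrier \<Omega> \<Longrightarrow> sigma U = U"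
  using add_hom_zero[OF abelian_group_axioms AA.P.is_abelian_group tp_hom_left, of \<one>]
    AA.P.G.diff_eq_iff[of U "\<zero>\<^bsub>AA\<^esub>" U]
  by (simp add: sigma_def Omega_carrier)

end

text \<open>A derivation along a ring homomorphism, vanishing on \<open>B\<close>.\<close>

locale derivation = ring_extension A B + E: ring E
  for A :: "('k, 'a, 'x) module_scheme" (structure) and B :: "'a set" and E :: "('e, 'z) ring_scheme" +
  fixes g :: "'a \<Rightarrow> 'e" and dd :: "'a \<Rightarrow> 'e"
  assumes g_hom: "g \<in> ring_hom A E"
    and dd_hom: "dd \<in> add_hom A E"
    and dd_mult: "\<lbrakk>x \<in> carrier A; y \<in> carrier A\<rbrakk> \<Longrightarrow> dd (x \<otimes> y) = dd x \<otimes>\<^bsub>E\<^esub> g y \<oplus>\<^bsub>E\<^esub> g x \<otimes>\<^bsub>E\<^esub> dd y"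
    and dd_B: "b \<in> B \<Longrightarrow> dd b = \<zero>\<^bsub>E\<^esub>"
begin

lemma g_add_hom: "g \<in> add_hom A E"
  by (rule add_homI) (simp_all add: ring_hom_closed[OF g_hom] ring_hom_add[OF g_hom])

lemma g_closed: "x \<in> carrier A \<Longrightarrow> g x \<in> carrier E"
  using add_hom_closed[OF g_add_hom] .

lemma dd_closed: "x \<in> carrier A \<Longrightarrow> dd x \<in> carrier E"
  using add_hom_closed[OF dd_hom] .

lemma dd_mult_B: "\<lbrakk>x \<in> carrier A; b \<in> B\<rbrakk> \<Longrightarrow> dd (x \<otimes> b) = dd x \<otimes>\<^bsub>E\<^esub> g b"
  and dd_B_mult: "\<lbrakk>b \<in> B; x \<in> carrier A\<rbrakk> \<Longrightarrow> dd (b \<otimes> x) = g b \<otimes>\<^bsub>E\<^esub> dd x"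
  by (simp_all add: dd_mult dd_B B_carrier dd_closed g_closed)

text \<open>The map \<open>x \<otimes> y \<mapsto> g x dd y\<close>.  It is defined on \<open>A \<otimes>\<^sub>B A\<close>, but in general it is right linear only on \<open>\<Omega>\<close>.\<close>

definition form :: "('a, 'a) tensor \<Rightarrow> 'e" where
  "form = lift_map E (\<lambda>(x, y). g x \<otimes>\<^bsub>E\<^esub> dd y)"

lemma form_hom: "form \<in> add_hom AA E"
  and form_tp: "\<lbrakk>x \<in> carrier A; y \<in> carrier A\<rbrakk> \<Longrightarrow> form (tp x y) = g x \<otimes>\<^bsub>E\<^esub> dd y"
proof -
  have 1: "(\<lambda>x. g x \<otimes>\<^bsub>E\<^esub> dd y) \<in> add_hom A E" if "y \<in> carrier A" for y
    by (rule E.add_hom_rmult[OF dd_closed[OF that] g_add_hom])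
  have 2: "(\<lambda>y. g x \<otimes>\<^bsub>E\<^esub> dd y) \<in> add_hom A E" if "x \<in> carrier A" for x
    by (rule E.add_hom_lmult[OF g_closed[OF that] dd_hom])
  have 3: "g (x \<otimes> b) \<otimes>\<^bsub>E\<^esub> dd y = g x \<otimes>\<^bsub>E\<^esub> dd (b \<otimes> y)" if "x \<in> carrier A" "b \<in> B" "y \<in> carrier A" for x b y
    using that by (simp add: ring_hom_mult[OF g_hom] B_carrier dd_B_mult E.m_assoc g_closed dd_closed)
  show "form \<in> add_hom AA E" unfolding form_def by (rule AA_lift(1)[OF E.abelian_group_axioms 1 2 3])
  show "form (tp x y) = g x \<otimes>\<^bsub>E\<^esub> dd y" if "x \<in> carrier A" "y \<in> carrier A"
    unfolding form_def by (rule AA_lift(2)[OF E.abelian_group_axioms 1 2 3 that])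
qed

lemma form_closed: "U \<in> carrier AA \<Longrightarrow> form U \<in> carrier E"
  using add_hom_closed[OF form_hom] .

lemma form_lact:
  assumes "a \<in> carrier A" "U \<in> carrier AA"
  shows "form (a \<odot>\<^bsub>AA\<^esub> U) = g a \<otimes>\<^bsub>E\<^esub> form U"
  by (rule AA_hom_eqI[OF E.abelian_group_axioms add_hom_comp[OF form_hom lact_hom] E.add_hom_lmult[OF _ form_hom] _ assms(2)])
     (use assms in \<open>simp_all add: lact_tp form_tp ring_hom_mult[OF g_hom] E.m_assoc g_closed dd_closed\<close>)

text \<open>The second summand, which comes from the Leibniz rule, disappears on \<open>\<Omega>\<close>, where \<open>mu\<close> vanishes.\<close>

lemma form_ract:
  assumes "a \<in> carrier A" "U \<in> carrier AA"
  shows "form (rsmult AA U a) = form U \<otimes>\<^bsub>E\<^esub> g a \<oplus>\<^bsub>E\<^esub> g (mu U) \<otimes>\<^bsub>E\<^esub> dd a"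
  by (rule AA_hom_eqI[OF E.abelian_group_axioms add_hom_comp[OF form_hom ract_hom]
        E.add_hom_plus[OF E.add_hom_rmult[OF _ form_hom] E.add_hom_rmult[OF _ add_hom_comp[OF g_add_hom mu_hom]]] _ assms(2)])
     (use assms in \<open>simp_all add: ract_tp form_tp mu_tp ring_hom_mult[OF g_hom] E.m_assoc g_closed dd_closed dd_mult E.r_distr\<close>)

end

context ring_extension
begin

abbreviation "sc \<equiv> tensor_scalar A \<Omega>"
text \<open>The derivation \<open>\<delta>\<close> with values in the tensor algebra.\<close>

definition D :: "'a \<Rightarrow> ('a, ('a, 'a) tensor) tensor_word_class" where "D a = TA.emb (delta a)"

lemma sc_ring_hom: "sc \<in> ring_hom A T"
  by (rule ring_hom_memI) (simp_all add: TA.sc_closed TA.sc_mult TA.one_eq add_hom_add[OF TA.sc_hom])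

lemma D_hom: "D \<in> add_hom A T"
  unfolding D_def [abs_def] by (rule add_hom_comp[OF TA.emb_hom delta_hom])

sublocale univ: derivation A B T sc D
proof
  show "sc \<in> ring_hom A T" by (rule sc_ring_hom)
  show "D \<in> add_hom A T" by (rule D_hom)
  show "D (x \<otimes> y) = D x \<otimes>\<^bsub>T\<^esub> sc y \<oplus>\<^bsub>T\<^esub> sc x \<otimes>\<^bsub>T\<^esub> D y" if "x \<in> carrier A" "y \<in> carrier A" for x y
    using that delta_mult[OF that] TA.smult_closed TA.rsmult_closed
    by (simp add: D_def delta_closed add_hom_add[OF TA.emb_hom] flip: Omega_fields TA.emb_smult TA.emb_rsmult)
  show "D b = \<zero>\<^bsub>T\<^esub>" if "b \<in> B" for b
    using add_hom_zero[OF Omega_abelian_group TA.T.is_abelian_group TA.emb_hom] that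
    by (simp add: D_def delta_B Omega_fields)
qed

text \<open>The map \<open>x \<otimes> y \<mapsto> x \<delta>y\<close> with values in the tensor algebra.\<close>

abbreviation "J \<equiv> univ.form"

lemma J_sigma: "U \<in> carrier AA \<Longrightarrow> J U = TA.emb (sigma U)"
  by (rule AA_hom_eqI[OF TA.T.is_abelian_group univ.form_hom add_hom_comp[OF TA.emb_hom sigma_hom]])
     (simp_all add: univ.form_tp sigma_tp TA.emb_smult delta_closed D_def)

lemma J_Omega: "U \<in> carrier \<Omega> \<Longrightarrow> J U = TA.emb U"
  using J_sigma[of U] by (simp add: sigma_Omega Omega_carrier)

end



section \<open>The differential on the tensor algebra\<close>

context ring_extension
begin

text \<open>The differential of one-forms: \<open>x \<otimes> y \<mapsto> \<delta>x \<delta>y\<close>, defined on all of \<open>A \<otimes>\<^sub>B A\<close>.\<close>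

definition d1 :: "('a, 'a) tensor \<Rightarrow> ('a, ('a, 'a) tensor) tensor_word_class" where
  "d1 = lift_map T (\<lambda>(x, y). D x \<otimes>\<^bsub>T\<^esub> D y)"

lemma d1_hom: "d1 \<in> add_hom AA T"
  and d1_tp: "\<lbrakk>x \<in> carrier A; y \<in> carrier A\<rbrakk> \<Longrightarrow> d1 (tp x y) = D x \<otimes>\<^bsub>T\<^esub> D y"
proof -
  have 1: "(\<lambda>x. D x \<otimes>\<^bsub>T\<^esub> D y) \<in> add_hom A T" if "y \<in> carrier A" for y
    by (rule TA.TR.add_hom_rmult[OF univ.dd_closed[OF that] D_hom])
  have 2: "(\<lambda>y. D x \<otimes>\<^bsub>T\<^esub> D y) \<in> add_hom A T" if "x \<in> carrier A" for x
    by (rule TA.TR.add_hom_lmult[OF univ.dd_closed[OF that] D_hom])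
  have 3: "D (x \<otimes> b) \<otimes>\<^bsub>T\<^esub> D y = D x \<otimes>\<^bsub>T\<^esub> D (b \<otimes> y)" if "x \<in> carrier A" "b \<in> B" "y \<in> carrier A" for x b y
    using that by (simp add: univ.dd_mult_B univ.dd_B_mult TA.TR.m_assoc univ.dd_closed TA.sc_closed B_carrier)
  show "d1 \<in> add_hom AA T"
    unfolding d1_def by (rule AA_lift(1)[OF TA.T.is_abelian_group 1 2 3])
  show "d1 (tp x y) = D x \<otimes>\<^bsub>T\<^esub> D y" if "x \<in> carrier A" "y \<in> carrier A"
    unfolding d1_def by (rule AA_lift(2)[OF TA.T.is_abelian_group 1 2 3 that])
qed

lemma d1_closed: "U \<in> carrier AA \<Longrightarrow> d1 U \<in> carrier T"
  using add_hom_closed[OF d1_hom] .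

lemma d1_lact:
  assumes "a \<in> carrier A" "U \<in> carrier AA"
  shows "d1 (a \<odot>\<^bsub>AA\<^esub> U) = D a \<otimes>\<^bsub>T\<^esub> J U \<oplus>\<^bsub>T\<^esub> sc a \<otimes>\<^bsub>T\<^esub> d1 U"
  by (rule AA_hom_eqI[OF TA.T.is_abelian_group add_hom_comp[OF d1_hom lact_hom]
        TA.T.G.add_hom_plus[OF TA.TR.add_hom_lmult[OF _ univ.form_hom] TA.TR.add_hom_lmult[OF _ d1_hom]] _ assms(2)])
     (use assms in \<open>simp_all add: lact_tp d1_tp univ.form_tp univ.dd_closed TA.sc_closed univ.dd_mult
       TA.TR.m_assoc TA.TR.l_distr\<close>)

text \<open>On \<open>\<Omega>\<close>, where \<open>mu U = 0\<close> and \<open>J U = U\<close>, this is the Leibniz rule \<open>d(U a) = dU a - U \<delta>a\<close>.\<close>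

lemma d1_ract:
  assumes "a \<in> carrier A" "U \<in> carrier AA"
  shows "d1 (rsmult AA U a) = d1 U \<otimes>\<^bsub>T\<^esub> sc a \<oplus>\<^bsub>T\<^esub> (D (mu U) \<ominus>\<^bsub>T\<^esub> J U) \<otimes>\<^bsub>T\<^esub> D a"
proof (rule AA_hom_eqI[OF TA.T.is_abelian_group add_hom_comp[OF d1_hom ract_hom]
        TA.T.G.add_hom_plus[OF TA.TR.add_hom_rmult[OF _ d1_hom]
          TA.TR.add_hom_rmult[OF _ TA.T.G.add_hom_sub[OF add_hom_comp[OF D_hom mu_hom] univ.form_hom]]] _ assms(2)])
  fix x y assume xy: "x \<in> carrier A" "y \<in> carrier A"
  have c: "D x \<in> carrier T" "D y \<in> carrier T" "D a \<in> carrier T"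
     "sc x \<in> carrier T" "sc y \<in> carrier T" "sc a \<in> carrier T"
    using xy assms by (simp_all add: univ.dd_closed TA.sc_closed)
  have e: "(D x \<otimes>\<^bsub>T\<^esub> sc y \<oplus>\<^bsub>T\<^esub> sc x \<otimes>\<^bsub>T\<^esub> D y) \<ominus>\<^bsub>T\<^esub> sc x \<otimes>\<^bsub>T\<^esub> D y = D x \<otimes>\<^bsub>T\<^esub> sc y"
    using c by algebra
  show "d1 (rsmult AA (tp x y) a)
      = d1 (tp x y) \<otimes>\<^bsub>T\<^esub> sc a \<oplus>\<^bsub>T\<^esub> (D (mu (tp x y)) \<ominus>\<^bsub>T\<^esub> J (tp x y)) \<otimes>\<^bsub>T\<^esub> D a"
    using xy assms c
    by (simp add: ract_tp d1_tp univ.form_tp mu_tp univ.dd_mult e TA.TR.m_assoc TA.TR.r_distr)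
qed (use assms in \<open>simp_all add: univ.dd_closed TA.sc_closed\<close>)

abbreviation "TT \<equiv> RDirProd T T"

lemma TT_fields: "carrier TT = carrier T \<times> carrier T"
  "(x, y) \<oplus>\<^bsub>TT\<^esub> (x', y') = (x \<oplus>\<^bsub>T\<^esub> x', y \<oplus>\<^bsub>T\<^esub> y')"
  by (simp_all add: RDirProd_def DirProd_def monoid.defs)

text \<open>The actions of a scalar \<open>r\<close> and of a one-form \<open>m\<close> on \<open>T \<times> T\<close>, by the matrices with rows \<open>(r, 0)\<close>,
  \<open>(\<delta>r, r)\<close> and \<open>(m, 0)\<close>, \<open>(dm, -m)\<close>.  That they are multiplicative is the Leibniz rule.\<close>

definition dact :: "'a \<Rightarrow> _ \<Rightarrow> _" where
  "dact r p = (sc r \<otimes>\<^bsub>T\<^esub> fst p, D r \<otimes>\<^bsub>T\<^esub> fst p \<oplus>\<^bsub>T\<^esub> sc r \<otimes>\<^bsub>T\<^esub> snd p)"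

definition dop :: "('a, 'a) tensor \<Rightarrow> _ \<Rightarrow> _" where
  "dop m p = (TA.emb m \<otimes>\<^bsub>T\<^esub> fst p, d1 m \<otimes>\<^bsub>T\<^esub> fst p \<ominus>\<^bsub>T\<^esub> TA.emb m \<otimes>\<^bsub>T\<^esub> snd p)"

lemma Omega_AA: "m \<in> carrier \<Omega> \<Longrightarrow> m \<in> carrier AA"
  by (simp add: Omega_carrier)

lemma dd_module: "tensor_module A \<Omega> TT dact dop"
proof (intro tensor_module.intro tensor_module_axioms.intro)
  show "tensor_alg A \<Omega>" by (rule TA.tensor_alg_axioms)
  show "abelian_group TT"
    using RDirProd_ring[OF TA.ring_T TA.ring_T] by (rule ring.is_abelian_group)
  have scc: "sc r \<in> carrier T" "D r \<in> carrier T" if "r \<in> carrier A" for r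
    using that by (simp_all add: TA.sc_closed univ.dd_closed)
  fix r assume r: "r \<in> carrier A"
  show "dact r \<in> add_hom TT TT"
  proof (rule add_homI)
    fix p assume p: "p \<in> carrier TT"
    then show "dact r p \<in> carrier TT" using r scc by (auto simp: TT_fields dact_def)
    fix q assume q: "q \<in> carrier TT"
    show "dact r (p \<oplus>\<^bsub>TT\<^esub> q) = dact r p \<oplus>\<^bsub>TT\<^esub> dact r q"
      using r scc[OF r] p q by (auto simp: TT_fields dact_def TA.TR.r_distr TA.T.G.a_ac)
  qed
next
  have scc: "sc r \<in> carrier T" "D r \<in> carrier T" if "r \<in> carrier A" for r
    using that by (simp_all add: TA.sc_closed univ.dd_closed)
  have mc: "TA.emb m \<in> carrier T" "d1 m \<in> carrier T" if "m \<in> carrier \<Omega>" for m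
    using that by (simp_all add: TA.emb_closed d1_closed Omega_AA)
  fix p assume p: "p \<in> carrier TT"
  obtain x y where xy: "p = (x, y)" "x \<in> carrier T" "y \<in> carrier T" using p by (auto simp: TT_fields)
  show "(\<lambda>r. dact r p) \<in> add_hom A TT"
  proof (rule add_homI)
    fix r assume r: "r \<in> carrier A"
    then show "dact r p \<in> carrier TT" using r scc xy by (auto simp: TT_fields dact_def)
    fix s assume s: "s \<in> carrier A"
    show "dact (r \<oplus> s) p = dact r p \<oplus>\<^bsub>TT\<^esub> dact s p"
      using r s scc[OF r] scc[OF s] xy
      by (simp add: TT_fields dact_def TA.TR.l_distr TA.T.G.a_ac add_hom_add[OF TA.sc_hom] add_hom_add[OF D_hom])
  qed
  show "dact \<one> p = p"
    using xy by (simp add: dact_def univ.dd_B one_B flip: TA.one_eq)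
  show "(\<lambda>m. dop m p) \<in> add_hom \<Omega> TT"
  proof (rule add_homI)
    fix m assume m: "m \<in> carrier \<Omega>"
    then show "dop m p \<in> carrier TT" using m mc xy by (auto simp: TT_fields dop_def)
    fix n assume n: "n \<in> carrier \<Omega>"
    have "d1 (m \<oplus>\<^bsub>\<Omega>\<^esub> n) = d1 m \<oplus>\<^bsub>T\<^esub> d1 n"
      using add_hom_add[OF d1_hom] m n by (simp add: Omega_fields Omega_AA)
    then show "dop (m \<oplus>\<^bsub>\<Omega>\<^esub> n) p = dop m p \<oplus>\<^bsub>TT\<^esub> dop n p"
      using mc[OF m] mc[OF n] m n xy
      by (simp add: TT_fields dop_def add_hom_add[OF TA.emb_hom] TA.TR.l_distr)
         (simp add: TA.T.G.minus_eq TA.T.G.minus_add TA.T.G.a_ac)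
  qed
  fix r assume r: "r \<in> carrier A"
  show "dact (r \<otimes> s) p = dact r (dact s p)" if s: "s \<in> carrier A" for s
    using r s scc[OF r] scc[OF s] xy
    by (simp add: dact_def TA.sc_mult univ.dd_mult TA.TR.m_assoc TA.TR.l_distr TA.TR.r_distr TA.T.G.a_ac)
  fix m assume m: "m \<in> carrier \<Omega>"
  note c = scc[OF r] mc[OF m] xy(2,3)
  show "dop (r \<odot>\<^bsub>\<Omega>\<^esub> m) p = dact r (dop m p)"
  proof -
    have "d1 (r \<odot>\<^bsub>\<Omega>\<^esub> m) = D r \<otimes>\<^bsub>T\<^esub> TA.emb m \<oplus>\<^bsub>T\<^esub> sc r \<otimes>\<^bsub>T\<^esub> d1 m"
      using r m by (simp add: Omega_fields d1_lact Omega_AA J_Omega)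
    moreover have "(D r \<otimes>\<^bsub>T\<^esub> TA.emb m \<oplus>\<^bsub>T\<^esub> sc r \<otimes>\<^bsub>T\<^esub> d1 m) \<otimes>\<^bsub>T\<^esub> x \<ominus>\<^bsub>T\<^esub> sc r \<otimes>\<^bsub>T\<^esub> TA.emb m \<otimes>\<^bsub>T\<^esub> y
      = D r \<otimes>\<^bsub>T\<^esub> (TA.emb m \<otimes>\<^bsub>T\<^esub> x) \<oplus>\<^bsub>T\<^esub> sc r \<otimes>\<^bsub>T\<^esub> (d1 m \<otimes>\<^bsub>T\<^esub> x \<ominus>\<^bsub>T\<^esub> TA.emb m \<otimes>\<^bsub>T\<^esub> y)"
      using c by algebra
    ultimately show ?thesis
      using r m c xy(1) by (simp add: dact_def dop_def TA.emb_smult TA.TR.m_assoc)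
  qed
  show "dop (rsmult \<Omega> m r) p = dop m (dact r p)"
  proof -
    have D0: "D \<zero> = \<zero>\<^bsub>T\<^esub>"
      using add_hom_zero[OF abelian_group_axioms TA.T.is_abelian_group D_hom] .
    have "d1 (rsmult \<Omega> m r) = d1 m \<otimes>\<^bsub>T\<^esub> sc r \<ominus>\<^bsub>T\<^esub> TA.emb m \<otimes>\<^bsub>T\<^esub> D r"
      using r m c
      by (simp add: Omega_fields d1_ract Omega_AA J_Omega)
         (simp add: Omega_carrier D0 TA.T.G.minus_eq TA.TR.l_minus)
    moreover have "(d1 m \<otimes>\<^bsub>T\<^esub> sc r \<ominus>\<^bsub>T\<^esub> TA.emb m \<otimes>\<^bsub>T\<^esub> D r) \<otimes>\<^bsub>T\<^esub> x \<ominus>\<^bsub>T\<^esub> TA.emb m \<otimes>\<^bsub>T\<^esub> sc r \<otimes>\<^bsub>T\<^esub> y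
      = d1 m \<otimes>\<^bsub>T\<^esub> (sc r \<otimes>\<^bsub>T\<^esub> x) \<ominus>\<^bsub>T\<^esub> TA.emb m \<otimes>\<^bsub>T\<^esub> (D r \<otimes>\<^bsub>T\<^esub> x \<oplus>\<^bsub>T\<^esub> sc r \<otimes>\<^bsub>T\<^esub> y)"
      using c by algebra
    ultimately show ?thesis
      using r m c xy(1) by (simp add: dact_def dop_def TA.emb_rsmult TA.TR.m_assoc)
  qed
next
  fix m assume m: "m \<in> carrier \<Omega>"
  have mc: "TA.emb m \<in> carrier T" "d1 m \<in> carrier T"
    using m by (simp_all add: TA.emb_closed d1_closed Omega_AA)
  show "dop m \<in> add_hom TT TT"
  proof (rule add_homI)
    fix p assume p: "p \<in> carrier TT"
    then show "dop m p \<in> carrier TT" using m mc by (auto simp: TT_fields dop_def)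
    fix q assume q: "q \<in> carrier TT"
    obtain x y x' y' where xy: "p = (x, y)" "q = (x', y')" "x \<in> carrier T" "y \<in> carrier T"
       "x' \<in> carrier T" "y' \<in> carrier T" using p q by (auto simp: TT_fields)
    then show "dop m (p \<oplus>\<^bsub>TT\<^esub> q) = dop m p \<oplus>\<^bsub>TT\<^esub> dop m q"
      using mc by (simp add: TT_fields dop_def TA.TR.r_distr)
         (simp add: TA.T.G.minus_eq TA.T.G.minus_add TA.T.G.a_ac)
  qed
qed

sublocale dd: tensor_module A \<Omega> TT dact dop by (rule dd_module)

text \<open>Evaluation at \<open>(1, 0)\<close> sends \<open>t\<close> to \<open>(t, dt)\<close>.\<close>

definition d :: "('a, ('a, 'a) tensor) tensor_word_class \<Rightarrow> ('a, ('a, 'a) tensor) tensor_word_class" where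
  "d t = snd (dd.eval_at (\<one>\<^bsub>T\<^esub>, \<zero>\<^bsub>T\<^esub>) t)"

lemma dd_base: "(\<one>\<^bsub>T\<^esub>, \<zero>\<^bsub>T\<^esub>) \<in> carrier TT"
  by (simp add: TT_fields)

lemma dd_eval: "t \<in> carrier T \<Longrightarrow> dd.eval_at (\<one>\<^bsub>T\<^esub>, \<zero>\<^bsub>T\<^esub>) t = (t, d t)"
proof -
  assume t: "t \<in> carrier T"
  have f: "fst \<in> add_hom TT T" by (rule add_homI) (auto simp: TT_fields)
  have "fst (dd.eval_at (\<one>\<^bsub>T\<^esub>, \<zero>\<^bsub>T\<^esub>) t) = t"
    using t
  proof (induction rule: TA.tensor_alg_induct)
    case zero
    then show ?case
      using add_hom_zero[OF TA.T.is_abelian_group TA.T.is_abelian_group add_hom_comp[OF f dd.eval_at_hom[OF dd_base]]] by simp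
  next
    case (diff U V)
    then show ?case
      using add_hom_diff[OF TA.T.is_abelian_group TA.T.is_abelian_group add_hom_comp[OF f dd.eval_at_hom[OF dd_base]]] by simp
  next
    case (sc r)
    then show ?case
      by (simp only: dd.eval_at_sc dd_base) (simp add: dact_def TA.sc_closed)
  next
    case (emb m U)
    have "fst (dop m p) = TA.emb m \<otimes>\<^bsub>T\<^esub> fst p" for p by (simp add: dop_def)
    then show ?case using emb by (simp add: dd.eval_at_emb_mult dd_base)
  qed
  then show ?thesis by (metis d_def prod.collapse)
qed

lemma d_hom: "d \<in> add_hom T T"
proof -
  have s: "snd \<in> add_hom TT T" by (rule add_homI) (auto simp: TT_fields)
  show ?thesis
    unfolding d_def [abs_def] by (rule add_hom_comp[OF s dd.eval_at_hom[OF dd_base]])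
qed

lemma d_closed: "t \<in> carrier T \<Longrightarrow> d t \<in> carrier T"
  using add_hom_closed[OF d_hom] .

lemma d_diff: "\<lbrakk>s \<in> carrier T; t \<in> carrier T\<rbrakk> \<Longrightarrow> d (s \<ominus>\<^bsub>T\<^esub> t) = d s \<ominus>\<^bsub>T\<^esub> d t"
  using add_hom_diff[OF TA.T.is_abelian_group TA.T.is_abelian_group d_hom] .

lemma d_zero: "d \<zero>\<^bsub>T\<^esub> = \<zero>\<^bsub>T\<^esub>"
  using add_hom_zero[OF TA.T.is_abelian_group TA.T.is_abelian_group d_hom] .

lemma d_sc: "r \<in> carrier A \<Longrightarrow> d (sc r) = D r"
  by (simp add: d_def dd.eval_at_sc dd_base dact_def univ.dd_closed TA.sc_closed)

lemma d_emb: "m \<in> carrier \<Omega> \<Longrightarrow> d (TA.emb m) = d1 m"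
  by (simp add: d_def dd.eval_at_emb dd_base dop_def d1_closed Omega_AA TA.emb_closed TA.T.G.minus_eq)

lemma d_sc_mult: "\<lbrakk>r \<in> carrier A; t \<in> carrier T\<rbrakk> \<Longrightarrow>
    d (sc r \<otimes>\<^bsub>T\<^esub> t) = D r \<otimes>\<^bsub>T\<^esub> t \<oplus>\<^bsub>T\<^esub> sc r \<otimes>\<^bsub>T\<^esub> d t"
  unfolding d_def [of "sc r \<otimes>\<^bsub>T\<^esub> t"] by (simp add: dd.eval_at_sc_mult dd_base dd_eval dact_def)

lemma d_emb_mult: "\<lbrakk>m \<in> carrier \<Omega>; t \<in> carrier T\<rbrakk> \<Longrightarrow>
    d (TA.emb m \<otimes>\<^bsub>T\<^esub> t) = d1 m \<otimes>\<^bsub>T\<^esub> t \<ominus>\<^bsub>T\<^esub> TA.emb m \<otimes>\<^bsub>T\<^esub> d t"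
  unfolding d_def [of "TA.emb m \<otimes>\<^bsub>T\<^esub> t"] by (simp add: dd.eval_at_emb_mult dd_base dd_eval dop_def)

lemma d_D: "x \<in> carrier A \<Longrightarrow> d (D x) = \<zero>\<^bsub>T\<^esub>"
proof -
  assume x: "x \<in> carrier A"
  have "d (D x) = d1 (tp \<one> x) \<ominus>\<^bsub>T\<^esub> d1 (tp x \<one>)"
    using x unfolding D_def
    by (simp add: d_emb delta_closed)
       (simp add: delta_def add_hom_diff[OF AA.P.is_abelian_group TA.T.is_abelian_group d1_hom] tp_closed)
  also have "\<dots> = \<zero>\<^bsub>T\<^esub>"
    using x TA.T.G.diff_eq_iff[of "\<zero>\<^bsub>T\<^esub>" "\<zero>\<^bsub>T\<^esub>" "\<zero>\<^bsub>T\<^esub>"]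
    by (simp add: d1_tp univ.dd_B one_B univ.dd_closed)
  finally show ?thesis .
qed

lemma D_homog: "x \<in> carrier A \<Longrightarrow> D x \<in> homog T 1"
  by (simp add: D_def TA.homog_emb delta_closed)

lemma d1_homog: "U \<in> carrier AA \<Longrightarrow> d1 U \<in> homog T 2"
proof (induction rule: AA.tensor_induct)
  case zero
  then show ?case
    by (simp add: add_hom_zero[OF AA.P.is_abelian_group TA.T.is_abelian_group d1_hom] TA.homog_zero)
next
  case (diff U V)
  then show ?case
    by (simp add: add_hom_diff[OF AA.P.is_abelian_group TA.T.is_abelian_group d1_hom] TA.homog_diff)
next
  case (pure x y)
  then show ?case using TA.homog_mult[OF D_homog D_homog, of x y] by (simp add: d1_tp)
qed

lemma d_homog: "t \<in> homog T n \<Longrightarrow> d t \<in> homog T (n + 1)"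
proof (induction rule: TA.homog_induct)
  case zero
  then show ?case by (simp add: d_zero TA.homog_zero)
next
  case (diff U V)
  then show ?case by (simp add: d_diff TA.homog_closed TA.homog_diff)
next
  case (gen w)
  have *: "d (TA.tn (m # ms)) \<in> homog T (int (length (m # ms)) + 1)"
    if "m \<in> carrier \<Omega>" "set ms \<subseteq> carrier \<Omega>" for m ms
    using that
  proof (induction ms arbitrary: m)
    case Nil
    then show ?case by (simp add: d_emb d1_homog Omega_AA)
  next
    case (Cons m' ms)
    let ?t = "TA.tn (m' # ms)"
    have t: "?t \<in> homog T (int (length (m' # ms)))" using Cons by (intro TA.homog_tn) auto
    have "d1 m \<otimes>\<^bsub>T\<^esub> ?t \<in> homog T (2 + int (length (m' # ms)))"
      by (rule TA.homog_mult[OF d1_homog t]) (use Cons in \<open>simp add: Omega_AA\<close>)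
    moreover have "TA.emb m \<otimes>\<^bsub>T\<^esub> d ?t \<in> homog T (1 + (int (length (m' # ms)) + 1))"
      by (rule TA.homog_mult[OF TA.homog_emb Cons.IH]) (use Cons in auto)
    ultimately show ?case
      using Cons.prems TA.homog_diff[of "d1 m \<otimes>\<^bsub>T\<^esub> ?t" _ "TA.emb m \<otimes>\<^bsub>T\<^esub> d ?t"]
      by (simp add: TA.tn_Cons[of m "m' # ms"] d_emb_mult TA.tn_closed algebra_simps)
  qed
  from gen(1) show ?case
  proof (cases rule: TA.twords_cases)
    case (Scal r)
    then show ?thesis using D_homog[of r] gen(2) by (simp add: d_sc flip: TA.sc_eq)
  next
    case (Tens m ms)
    have "n + 1 = 2 + int (length ms)" using gen(2) Tens by simp
    then show ?thesis using Tens *[of m ms] gen(2) by (simp flip: TA.tn_def)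
  qed
qed

abbreviation "sgn_T n x \<equiv> (if even (n::int) then x else \<ominus>\<^bsub>T\<^esub> x)"

lemma d_Leibniz:
  assumes "s \<in> homog T n" "t \<in> carrier T"
  shows "d (s \<otimes>\<^bsub>T\<^esub> t) = d s \<otimes>\<^bsub>T\<^esub> t \<oplus>\<^bsub>T\<^esub> sgn_T n (s \<otimes>\<^bsub>T\<^esub> d t)"
  using assms(1)
proof (induction rule: TA.homog_induct)
  case zero
  then show ?case using assms(2) by (simp add: d_zero d_closed)
next
  case (diff U V)
  have c: "U \<in> carrier T" "V \<in> carrier T" "d U \<in> carrier T" "d V \<in> carrier T" "d t \<in> carrier T"
    "U \<otimes>\<^bsub>T\<^esub> t \<in> carrier T" "V \<otimes>\<^bsub>T\<^esub> t \<in> carrier T"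
    using diff assms by (auto simp: TA.homog_closed d_closed)
  have m: "(U \<ominus>\<^bsub>T\<^esub> V) \<otimes>\<^bsub>T\<^esub> t = U \<otimes>\<^bsub>T\<^esub> t \<ominus>\<^bsub>T\<^esub> V \<otimes>\<^bsub>T\<^esub> t"
    using c assms(2) by algebra
  have "d ((U \<ominus>\<^bsub>T\<^esub> V) \<otimes>\<^bsub>T\<^esub> t) = d (U \<otimes>\<^bsub>T\<^esub> t) \<ominus>\<^bsub>T\<^esub> d (V \<otimes>\<^bsub>T\<^esub> t)"
    using c unfolding m by (simp add: d_diff)
  also have "\<dots> = d (U \<ominus>\<^bsub>T\<^esub> V) \<otimes>\<^bsub>T\<^esub> t \<oplus>\<^bsub>T\<^esub> sgn_T n ((U \<ominus>\<^bsub>T\<^esub> V) \<otimes>\<^bsub>T\<^esub> d t)"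
  proof (cases "even n")
    case True
    have "(d U \<otimes>\<^bsub>T\<^esub> t \<oplus>\<^bsub>T\<^esub> U \<otimes>\<^bsub>T\<^esub> d t) \<ominus>\<^bsub>T\<^esub> (d V \<otimes>\<^bsub>T\<^esub> t \<oplus>\<^bsub>T\<^esub> V \<otimes>\<^bsub>T\<^esub> d t)
       = (d U \<ominus>\<^bsub>T\<^esub> d V) \<otimes>\<^bsub>T\<^esub> t \<oplus>\<^bsub>T\<^esub> (U \<ominus>\<^bsub>T\<^esub> V) \<otimes>\<^bsub>T\<^esub> d t"
      using c assms(2) by algebra
    then show ?thesis using diff c True by (simp add: d_diff)
  next
    case False
    have "(d U \<otimes>\<^bsub>T\<^esub> t \<oplus>\<^bsub>T\<^esub> \<ominus>\<^bsub>T\<^esub> (U \<otimes>\<^bsub>T\<^esub> d t)) \<ominus>\<^bsub>T\<^esub> (d V \<otimes>\<^bsub>T\<^esub> t \<oplus>\<^bsub>T\<^esub> \<ominus>\<^bsub>T\<^esub> (V \<otimes>\<^bsub>T\<^esub> d t))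
       = (d U \<ominus>\<^bsub>T\<^esub> d V) \<otimes>\<^bsub>T\<^esub> t \<oplus>\<^bsub>T\<^esub> \<ominus>\<^bsub>T\<^esub> ((U \<ominus>\<^bsub>T\<^esub> V) \<otimes>\<^bsub>T\<^esub> d t)"
      using c assms(2) by algebra
    then show ?thesis using diff c False by (simp add: d_diff)
  qed
  finally show ?case .
next
  case (gen w)
  have *: "d (TA.tn (m # ms) \<otimes>\<^bsub>T\<^esub> t) = d (TA.tn (m # ms)) \<otimes>\<^bsub>T\<^esub> t
      \<oplus>\<^bsub>T\<^esub> sgn_T (int (length (m # ms))) (TA.tn (m # ms) \<otimes>\<^bsub>T\<^esub> d t)"
    if "m \<in> carrier \<Omega>" "set ms \<subseteq> carrier \<Omega>" for m ms
    using that
  proof (induction ms arbitrary: m)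
    case Nil
    then show ?case using assms(2) by (simp add: d_emb d_emb_mult TA.T.G.minus_eq)
  next
    case (Cons m' ms)
    define u where "u = TA.tn (m' # ms)"
    have c: "u \<in> carrier T" "d u \<in> carrier T" "TA.emb m \<in> carrier T" "d1 m \<in> carrier T"
      "d t \<in> carrier T" "t \<in> carrier T"
      using Cons assms(2) by (simp_all add: u_def TA.tn_closed d_closed d1_closed Omega_AA)
    have IH: "d (u \<otimes>\<^bsub>T\<^esub> t) = d u \<otimes>\<^bsub>T\<^esub> t \<oplus>\<^bsub>T\<^esub> sgn_T (int (length (m' # ms))) (u \<otimes>\<^bsub>T\<^esub> d t)"
      unfolding u_def by (rule Cons.IH) (use Cons.prems in auto)
    have tn: "TA.tn (m # m' # ms) = TA.emb m \<otimes>\<^bsub>T\<^esub> u"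
      using Cons.prems by (simp add: u_def TA.tn_Cons[of m "m' # ms"])
    have "d (TA.tn (m # m' # ms) \<otimes>\<^bsub>T\<^esub> t) = d1 m \<otimes>\<^bsub>T\<^esub> (u \<otimes>\<^bsub>T\<^esub> t) \<ominus>\<^bsub>T\<^esub> TA.emb m \<otimes>\<^bsub>T\<^esub> d (u \<otimes>\<^bsub>T\<^esub> t)"
      using Cons.prems c by (simp add: tn TA.TR.m_assoc d_emb_mult)
    also have "\<dots> = (d1 m \<otimes>\<^bsub>T\<^esub> u \<ominus>\<^bsub>T\<^esub> TA.emb m \<otimes>\<^bsub>T\<^esub> d u) \<otimes>\<^bsub>T\<^esub> t
       \<oplus>\<^bsub>T\<^esub> sgn_T (int (length (m # m' # ms))) (TA.emb m \<otimes>\<^bsub>T\<^esub> u \<otimes>\<^bsub>T\<^esub> d t)"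
    proof (cases "even (int (length (m' # ms)))")
      case True
      have "d1 m \<otimes>\<^bsub>T\<^esub> (u \<otimes>\<^bsub>T\<^esub> t) \<ominus>\<^bsub>T\<^esub> TA.emb m \<otimes>\<^bsub>T\<^esub> (d u \<otimes>\<^bsub>T\<^esub> t \<oplus>\<^bsub>T\<^esub> u \<otimes>\<^bsub>T\<^esub> d t) =
         (d1 m \<otimes>\<^bsub>T\<^esub> u \<ominus>\<^bsub>T\<^esub> TA.emb m \<otimes>\<^bsub>T\<^esub> d u) \<otimes>\<^bsub>T\<^esub> t \<oplus>\<^bsub>T\<^esub> \<ominus>\<^bsub>T\<^esub> (TA.emb m \<otimes>\<^bsub>T\<^esub> u \<otimes>\<^bsub>T\<^esub> d t)"
        using c by algebra
      then show ?thesis using True by (simp add: IH)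
    next
      case False
      have "d1 m \<otimes>\<^bsub>T\<^esub> (u \<otimes>\<^bsub>T\<^esub> t) \<ominus>\<^bsub>T\<^esub> TA.emb m \<otimes>\<^bsub>T\<^esub> (d u \<otimes>\<^bsub>T\<^esub> t \<oplus>\<^bsub>T\<^esub> \<ominus>\<^bsub>T\<^esub> (u \<otimes>\<^bsub>T\<^esub> d t)) =
         (d1 m \<otimes>\<^bsub>T\<^esub> u \<ominus>\<^bsub>T\<^esub> TA.emb m \<otimes>\<^bsub>T\<^esub> d u) \<otimes>\<^bsub>T\<^esub> t \<oplus>\<^bsub>T\<^esub> (TA.emb m \<otimes>\<^bsub>T\<^esub> u \<otimes>\<^bsub>T\<^esub> d t)"
        using c by algebra
      then show ?thesis using False by (simp add: IH)
    qed
    also have "d1 m \<otimes>\<^bsub>T\<^esub> u \<ominus>\<^bsub>T\<^esub> TA.emb m \<otimes>\<^bsub>T\<^esub> d u = d (TA.tn (m # m' # ms))"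
      using Cons.prems c by (simp add: tn d_emb_mult)
    finally show ?case by (simp add: tn)
  qed
  from gen(1) show ?case
  proof (cases rule: TA.twords_cases)
    case (Scal r)
    then show ?thesis using gen(2) assms(2) by (simp add: d_sc d_sc_mult flip: TA.sc_eq)
  next
    case (Tens m ms)
    then have "n = int (length (m # ms))" using gen(2) by simp
    then show ?thesis using Tens *[of m ms] by (simp flip: TA.tn_def)
  qed
qed

text \<open>By the Leibniz rule, as \<open>d \<delta>x = 0\<close>.\<close>

lemma d_d1: "U \<in> carrier AA \<Longrightarrow> d (d1 U) = \<zero>\<^bsub>T\<^esub>"
proof (rule AA_hom_eqI[OF TA.T.is_abelian_group add_hom_comp[OF d_hom d1_hom] TA.T.G.add_hom_0])
  fix x y assume xy: "x \<in> carrier A" "y \<in> carrier A"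
  then show "d (d1 (tp x y)) = \<zero>\<^bsub>T\<^esub>"
    using d_Leibniz[OF D_homog, of x "D y"] by (simp add: d1_tp d_D univ.dd_closed)
qed

lemma d_d: "t \<in> carrier T \<Longrightarrow> d (d t) = \<zero>\<^bsub>T\<^esub>"
proof (induction rule: TA.tensor_alg_induct)
  case zero
  then show ?case by (simp add: d_zero)
next
  case (diff U V)
  then show ?case
    using TA.T.G.diff_eq_iff[of "\<zero>\<^bsub>T\<^esub>" "\<zero>\<^bsub>T\<^esub>" "\<zero>\<^bsub>T\<^esub>"] by (simp add: d_diff d_closed)
next
  case (sc r)
  then show ?case by (simp add: d_sc d_D)
next
  case (emb m U)
  have c: "d1 m \<in> carrier T" "d U \<in> carrier T" "TA.emb m \<in> carrier T"
    using emb by (simp_all add: d1_closed Omega_AA d_closed TA.emb_closed)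
  have "d (d (TA.emb m \<otimes>\<^bsub>T\<^esub> U)) = d (d1 m \<otimes>\<^bsub>T\<^esub> U) \<ominus>\<^bsub>T\<^esub> d (TA.emb m \<otimes>\<^bsub>T\<^esub> d U)"
    using emb c by (simp add: d_emb_mult d_diff)
  also have "d (d1 m \<otimes>\<^bsub>T\<^esub> U) = d1 m \<otimes>\<^bsub>T\<^esub> d U"
    using emb c d_Leibniz[OF d1_homog, of m U] by (simp add: Omega_AA d_d1)
  also have "d (TA.emb m \<otimes>\<^bsub>T\<^esub> d U) = d1 m \<otimes>\<^bsub>T\<^esub> d U"
    using emb c by (simp add: d_emb_mult TA.T.G.minus_eq)
  finally show ?case
    using c by (simp add: TA.T.G.diff_eq_iff)
qed

end



section \<open>The universal property\<close>

context derivation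
begin

lemma form_module: "tensor_module A (Omega1_nc A B) E (\<lambda>r x. g r \<otimes>\<^bsub>E\<^esub> x) (\<lambda>m x. form m \<otimes>\<^bsub>E\<^esub> x)"
proof (intro tensor_module.intro tensor_module_axioms.intro)
  show "tensor_alg A \<Omega>" by (rule TA.tensor_alg_axioms)
  show "abelian_group E" by (rule E.abelian_group_axioms)
  fix x assume x: "x \<in> carrier E"
  show "(\<lambda>r. g r \<otimes>\<^bsub>E\<^esub> x) \<in> add_hom A E"
    by (rule E.add_hom_rmult[OF x g_add_hom])
  show "g \<one> \<otimes>\<^bsub>E\<^esub> x = x" using x by (simp add: ring_hom_one[OF g_hom])
  show "(\<lambda>m. form m \<otimes>\<^bsub>E\<^esub> x) \<in> add_hom \<Omega> E"
    by (rule E.add_hom_rmult[OF x])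
       (use form_hom in \<open>auto simp: add_hom_def Omega_fields Omega_carrier\<close>)
  fix r assume r: "r \<in> carrier A"
  show "g (r \<otimes> s) \<otimes>\<^bsub>E\<^esub> x = g r \<otimes>\<^bsub>E\<^esub> (g s \<otimes>\<^bsub>E\<^esub> x)" if "s \<in> carrier A" for s
    using r that x by (simp add: ring_hom_mult[OF g_hom] E.m_assoc g_closed)
  fix m assume m: "m \<in> carrier \<Omega>"
  show "form (r \<odot>\<^bsub>\<Omega>\<^esub> m) \<otimes>\<^bsub>E\<^esub> x = g r \<otimes>\<^bsub>E\<^esub> (form m \<otimes>\<^bsub>E\<^esub> x)"
    using r m x by (simp add: Omega_fields form_lact Omega_AA E.m_assoc g_closed form_closed)
  have g0: "g \<zero> = \<zero>\<^bsub>E\<^esub>"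
    by (rule add_hom_zero[OF abelian_group_axioms E.abelian_group_axioms g_add_hom])
  have "form (rsmult \<Omega> m r) = form m \<otimes>\<^bsub>E\<^esub> g r"
    using r m by (simp add: Omega_fields form_ract Omega_AA)
      (simp add: Omega_carrier g0 dd_closed g_closed form_closed)
  then show "form (rsmult \<Omega> m r) \<otimes>\<^bsub>E\<^esub> x = form m \<otimes>\<^bsub>E\<^esub> (g r \<otimes>\<^bsub>E\<^esub> x)"
    using r m x by (simp add: E.m_assoc g_closed form_closed Omega_AA)
qed (auto intro!: E.add_hom_lmult add_hom_ident g_closed form_closed simp: Omega_AA)

interpretation N: tensor_module A \<Omega> E "\<lambda>r x. g r \<otimes>\<^bsub>E\<^esub> x" "\<lambda>m x. form m \<otimes>\<^bsub>E\<^esub> x"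
  by (rule form_module)

text \<open>The ring homomorphism on the tensor algebra that extends \<open>g\<close> and sends \<open>\<delta>x\<close> to \<open>dd x\<close>.\<close>

definition ext :: "('a, ('a, 'a) tensor) tensor_word_class \<Rightarrow> 'e" where
  "ext t = N.eval_at \<one>\<^bsub>E\<^esub> t"

lemma ext_hom: "ext \<in> add_hom T E"
  unfolding ext_def [abs_def] by (rule N.eval_at_hom) simp

lemma ext_closed: "t \<in> carrier T \<Longrightarrow> ext t \<in> carrier E"
  using add_hom_closed[OF ext_hom] .

lemma ext_zero: "ext \<zero>\<^bsub>T\<^esub> = \<zero>\<^bsub>E\<^esub>"
  by (rule add_hom_zero[OF TA.T.is_abelian_group E.abelian_group_axioms ext_hom])

lemma ext_diff: "\<lbrakk>s \<in> carrier T; t \<in> carrier T\<rbrakk> \<Longrightarrow> ext (s \<ominus>\<^bsub>T\<^esub> t) = ext s \<ominus>\<^bsub>E\<^esub> ext t"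
  by (rule add_hom_diff[OF TA.T.is_abelian_group E.abelian_group_axioms ext_hom])

lemma ext_sc: "r \<in> carrier A \<Longrightarrow> ext (sc r) = g r"
  by (simp add: ext_def N.eval_at_sc g_closed)

lemma ext_emb: "m \<in> carrier \<Omega> \<Longrightarrow> ext (TA.emb m) = form m"
  by (simp add: ext_def N.eval_at_emb form_closed Omega_AA)

lemma ext_mult:
  assumes "s \<in> carrier T" "t \<in> carrier T"
  shows "ext (s \<otimes>\<^bsub>T\<^esub> t) = ext s \<otimes>\<^bsub>E\<^esub> ext t"
  using assms(1)
proof (induction rule: TA.tensor_alg_induct)
  case zero
  then show ?case using assms(2) by (simp add: ext_zero ext_closed)
next
  case (diff U V)
  have "(U \<ominus>\<^bsub>T\<^esub> V) \<otimes>\<^bsub>T\<^esub> t = U \<otimes>\<^bsub>T\<^esub> t \<ominus>\<^bsub>T\<^esub> V \<otimes>\<^bsub>T\<^esub> t"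
    using diff assms(2) by algebra
  moreover have "(ext U \<ominus>\<^bsub>E\<^esub> ext V) \<otimes>\<^bsub>E\<^esub> ext t = ext U \<otimes>\<^bsub>E\<^esub> ext t \<ominus>\<^bsub>E\<^esub> ext V \<otimes>\<^bsub>E\<^esub> ext t"
    using ext_closed[OF diff(1)] ext_closed[OF diff(2)] ext_closed[OF assms(2)] by algebra
  ultimately show ?case using diff assms(2) by (simp add: ext_diff)
next
  case (sc r)
  then show ?case using assms(2) by (simp add: ext_sc) (simp add: ext_def N.eval_at_sc_mult)
next
  case (emb m U)
  have *: "ext (TA.emb m \<otimes>\<^bsub>T\<^esub> V) = form m \<otimes>\<^bsub>E\<^esub> ext V" if "V \<in> carrier T" for V
    using that emb by (simp add: ext_def N.eval_at_emb_mult)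
  show ?case
    using emb assms(2)
    by (simp add: TA.TR.m_assoc TA.emb_closed * ext_closed E.m_assoc form_closed Omega_AA)
qed

lemma ext_one: "ext \<one>\<^bsub>T\<^esub> = \<one>\<^bsub>E\<^esub>"
  by (simp add: TA.one_eq ext_sc ring_hom_one[OF g_hom])

lemma dd_one: "dd \<one> = \<zero>\<^bsub>E\<^esub>"
  by (rule dd_B[OF one_B])

lemma form_delta: "x \<in> carrier A \<Longrightarrow> form (delta x) = dd x"
  by (simp add: delta_def add_hom_diff[OF AA.P.is_abelian_group E.abelian_group_axioms form_hom]
      tp_closed form_tp dd_one ring_hom_one[OF g_hom] dd_closed g_closed E.minus_eq)

lemma ext_D: "x \<in> carrier A \<Longrightarrow> ext (D x) = dd x"
  by (simp add: D_def ext_emb delta_closed form_delta)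

text \<open>A multiplicative map is determined by its values on \<open>A\<close> and \<open>\<delta>A\<close>, since an element \<open>m\<close> of \<open>\<Omega>\<close> equals \<open>J m\<close>.\<close>

lemma ext_unique:
  assumes "\<psi> \<in> add_hom T E"
    and mult: "\<And>s t. \<lbrakk>s \<in> carrier T; t \<in> carrier T\<rbrakk> \<Longrightarrow> \<psi> (s \<otimes>\<^bsub>T\<^esub> t) = \<psi> s \<otimes>\<^bsub>E\<^esub> \<psi> t"
    and sc: "\<And>r. r \<in> carrier A \<Longrightarrow> \<psi> (sc r) = g r"
    and D: "\<And>r. r \<in> carrier A \<Longrightarrow> \<psi> (D r) = dd r"
    and t: "t \<in> carrier T"
  shows "\<psi> t = ext t"
  using t
proof (induction rule: TA.tensor_alg_induct)
  case zero
  then show ?case using add_hom_zero[OF TA.T.is_abelian_group E.abelian_group_axioms assms(1)] by (simp add: ext_zero)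
next
  case (diff U V)
  then show ?case
    using add_hom_diff[OF TA.T.is_abelian_group E.abelian_group_axioms assms(1)] by (simp add: ext_diff)
next
  case (sc r)
  then show ?case using assms(3) by (simp add: ext_sc)
next
  case (emb m U)
  have "\<psi> (J W) = form W" if "W \<in> carrier AA" for W
    by (rule AA_hom_eqI[OF E.abelian_group_axioms add_hom_comp[OF assms(1) univ.form_hom] form_hom _ that])
       (simp add: univ.form_tp form_tp mult assms(3) D TA.sc_closed univ.dd_closed)
  from this[of m] have "\<psi> (TA.emb m) = form m"
    using emb by (simp add: J_Omega Omega_AA)
  then show ?case
    using emb by (simp add: mult TA.emb_closed ext_mult ext_emb)
qed

end

section \<open>The differential envelope\<close>

context diff_graded_algebra
begin

lemma homog_carrier: "x \<in> homog D n \<Longrightarrow> x \<in> carrier D"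
  using submoduleE(1)[OF homog_submodule] by blast

lemma zero_homog: "\<zero>\<^bsub>D\<^esub> \<in> homog D n"
  using subgroup.one_closed[OF submodule.axioms(1)[OF homog_submodule]] by simp

lemma minus_homog: "\<lbrakk>x \<in> homog D n; y \<in> homog D n\<rbrakk> \<Longrightarrow> x \<ominus>\<^bsub>D\<^esub> y \<in> homog D n"
  using submoduleE(3,5)[OF homog_submodule] by (simp add: a_minus_def)

text \<open>The axioms bound the differential only on homogeneous elements; the decomposition into homogeneous
  components gives the general case.\<close>

lemma diff_closed:
  assumes x: "x \<in> carrier D"
  shows "diff D x \<in> carrier D"
proof -
  obtain p where p: "\<forall>n. p n \<in> homog D n" "finite {n. p n \<noteq> \<zero>\<^bsub>D\<^esub>}" "x = finsum D p {n. p n \<noteq> \<zero>\<^bsub>D\<^esub>}"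
    using homog_direct_sum[OF x] by blast
  have "diff D (finsum D p F) \<in> carrier D" if "finite F" for F
    using that
  proof (induction F rule: finite_induct)
    case empty
    then show ?case using homog_carrier[OF diff_homog[OF zero_homog[of 0]]] by simp
  next
    case (insert i F)
    have "p j \<in> carrier D" for j using p(1) homog_carrier by blast
    then have "diff D (finsum D p (insert i F)) = diff D (p i) \<oplus>\<^bsub>D\<^esub> diff D (finsum D p F)"
      using insert by (simp add: Pi_def diff_add)
    then show ?case using insert homog_carrier[OF diff_homog[OF p(1)[rule_format]]] by simp
  qed
  then show ?thesis using p by simp
qed

end

text \<open>An associative algebra over a field with a unital subalgebra.\<close>

locale algebra_pair = assoc_algebra K A
  for K :: "('k, 'w) ring_scheme" and A :: "('k, 'a, 'x) module_scheme" (structure) +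
  fixes B :: "'a set"
  assumes subalgebra: "unital_subalgebra K A B"
begin

sublocale ring_extension A B
  using subalgebra A.ring_axioms
  by (simp add: ring_extension.intro ring_extension_axioms.intro unital_subalgebra_def)

text \<open>The image \<open>c 1\<close> of a scalar; it lies in \<open>B\<close>, through which scalars pass across \<open>\<otimes>\<^sub>B\<close>.\<close>

abbreviation unit_of :: "'k \<Rightarrow> 'a" where "unit_of c \<equiv> c \<odot>\<^bsub>A\<^esub> \<one>\<^bsub>A\<^esub>"

lemma unit_of_B: "c \<in> carrier K \<Longrightarrow> unit_of c \<in> B"
  using subalgebra one_B submodule.smult_closed[of B K A c] by (simp add: unital_subalgebra_def)

lemma unit_of_closed: "c \<in> carrier K \<Longrightarrow> unit_of c \<in> carrier A"
  using B_carrier[OF unit_of_B] .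

lemma unit_of_left: "\<lbrakk>c \<in> carrier K; x \<in> carrier A\<rbrakk> \<Longrightarrow> unit_of c \<otimes> x = c \<odot>\<^bsub>A\<^esub> x"
  and unit_of_right: "\<lbrakk>c \<in> carrier K; x \<in> carrier A\<rbrakk> \<Longrightarrow> x \<otimes> unit_of c = c \<odot>\<^bsub>A\<^esub> x"
  by (simp_all add: smult_mult_left smult_mult_right)

lemma unit_of_AA:
  assumes c: "c \<in> carrier K" and U: "U \<in> carrier AA"
  shows "unit_of c \<odot>\<^bsub>AA\<^esub> U = rsmult AA U (unit_of c)"
proof (rule AA_hom_eqI[OF AA.P.is_abelian_group lact_hom ract_hom _ U])
  fix x y assume xy: "x \<in> carrier A" "y \<in> carrier A"
  then show "unit_of c \<odot>\<^bsub>AA\<^esub> tp x y = rsmult AA (tp x y) (unit_of c)"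
    using tp_balanced[OF xy(1) unit_of_B[OF c] xy(2)] c unit_of_closed[OF c]
    by (simp add: lact_tp ract_tp unit_of_left unit_of_right)
qed (use unit_of_closed[OF c] in auto)

lemma unit_of_central:
  assumes c: "c \<in> carrier K" and t: "t \<in> carrier T"
  shows "sc (unit_of c) \<otimes>\<^bsub>T\<^esub> t = t \<otimes>\<^bsub>T\<^esub> sc (unit_of c)"
  using t
proof (induction rule: TA.tensor_alg_induct)
  case zero
  then show ?case using c by (simp add: TA.sc_closed unit_of_closed)
next
  case (diff U V)
  have s: "sc (unit_of c) \<in> carrier T" using c by (simp add: TA.sc_closed unit_of_closed)
  have "sc (unit_of c) \<otimes>\<^bsub>T\<^esub> (U \<ominus>\<^bsub>T\<^esub> V) = sc (unit_of c) \<otimes>\<^bsub>T\<^esub> U \<ominus>\<^bsub>T\<^esub> sc (unit_of c) \<otimes>\<^bsub>T\<^esub> V"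
    using diff s by algebra
  also have "\<dots> = U \<otimes>\<^bsub>T\<^esub> sc (unit_of c) \<ominus>\<^bsub>T\<^esub> V \<otimes>\<^bsub>T\<^esub> sc (unit_of c)" using diff by simp
  also have "\<dots> = (U \<ominus>\<^bsub>T\<^esub> V) \<otimes>\<^bsub>T\<^esub> sc (unit_of c)"
    using diff(1,2) s by algebra
  finally show ?case .
next
  case (sc r)
  have "unit_of c \<otimes> r = r \<otimes> unit_of c" using sc c unit_of_left unit_of_right by simp
  then show ?case using sc c by (simp add: unit_of_closed flip: TA.sc_mult)
next
  case (emb m U)
  have s: "sc (unit_of c) \<in> carrier T" using c by (simp add: TA.sc_closed unit_of_closed)
  have e: "sc (unit_of c) \<otimes>\<^bsub>T\<^esub> TA.emb m = TA.emb m \<otimes>\<^bsub>T\<^esub> sc (unit_of c)"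
    using c emb unit_of_AA[OF c Omega_AA[OF emb(1)]]
    by (simp add: unit_of_closed Omega_fields flip: TA.emb_smult TA.emb_rsmult)
  have "sc (unit_of c) \<otimes>\<^bsub>T\<^esub> (TA.emb m \<otimes>\<^bsub>T\<^esub> U) = TA.emb m \<otimes>\<^bsub>T\<^esub> (sc (unit_of c) \<otimes>\<^bsub>T\<^esub> U)"
    using emb(1,2) s by (simp add: TA.emb_closed e flip: TA.TR.m_assoc)
  then show ?case using emb s by (simp add: TA.emb_closed TA.TR.m_assoc)
qed

lemma T_smult: "\<lbrakk>c \<in> carrier K; t \<in> carrier T\<rbrakk> \<Longrightarrow> c \<odot>\<^bsub>T\<^esub> t = sc (unit_of c) \<otimes>\<^bsub>T\<^esub> t"
proof -
  assume c: "c \<in> carrier K" and t: "t \<in> carrier T"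
  have "presented_map (twords A \<Omega>) (tword_relators A \<Omega>) (tword_mult A \<Omega> (Scal (unit_of c))) t
      = TA.lmul (Scal (unit_of c)) t"
    by (rule TA.T.presented_map_eq[OF TA.lmul_Scal_hom _ TA.lmul_Scal_gen t])
       (use unit_of_closed[OF c] TA.word_mult_gen in \<open>auto simp: TA.Scal_mem\<close>)
  then show ?thesis
    using c t by (simp add: TA.sc_mult_lmul unit_of_closed) (simp add: tensor_algebra_def Let_def)
qed

text \<open>The tensor algebra of \<open>\<Omega>\<close> as a differential graded algebra.\<close>

definition env :: "('k, ('a, ('a, 'a) tensor) tensor_word_class) dga" where
  "env = \<lparr>carrier = carrier T, monoid.mult = monoid.mult T, one = one T, ring.zero = ring.zero T, add = add T,
     smult = smult T, homog = homog T, diff = d\<rparr>"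

lemma env_fields [simp]:
  "carrier env = carrier T" "monoid.mult env = monoid.mult T" "\<one>\<^bsub>env\<^esub> = \<one>\<^bsub>T\<^esub>" "\<zero>\<^bsub>env\<^esub> = \<zero>\<^bsub>T\<^esub>"
  "add env = add T" "smult env = smult T" "homog env = homog T" "diff env = d"
  by (simp_all add: env_def)

lemma env_derived [simp]: "a_inv env = a_inv T" "finsum env = finsum T"
  by (simp_all add: fun_eq_iff a_inv_def m_inv_def finsum_def finprod_def)

lemma add_hom_env [simp]: "add_hom env H = add_hom T H" "add_hom H env = add_hom H T"
  by (simp_all add: add_hom_def)

lemma ring_env: "ring env"
proof (rule ringI)
  show "abelian_group env"
    by (rule abelian_groupI) (auto simp: TA.T.G.a_ac intro: bexI[of _ "\<ominus>\<^bsub>T\<^esub> _"] TA.T.G.l_neg)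
  show "monoid env"
    by (rule monoidI) (simp_all add: TA.TR.m_assoc)
qed (simp_all add: TA.TR.l_distr TA.TR.r_distr)

lemma unit_of_add: "\<lbrakk>c \<in> carrier K; e \<in> carrier K\<rbrakk> \<Longrightarrow> unit_of (c \<oplus>\<^bsub>K\<^esub> e) = unit_of c \<oplus> unit_of e"
  by (simp add: smult_l_distr)

lemma unit_of_mult: "\<lbrakk>c \<in> carrier K; e \<in> carrier K\<rbrakk> \<Longrightarrow> unit_of (c \<otimes>\<^bsub>K\<^esub> e) = unit_of c \<otimes> unit_of e"
  by (simp add: smult_assoc1 unit_of_left)

lemma dga_env: "diff_graded_algebra K env"
proof -
  have u: "sc (unit_of c) \<in> carrier T" if "c \<in> carrier K" for c
    using that by (simp add: TA.sc_closed unit_of_closed)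
  have mod: "module K env"
  proof (rule moduleI)
    show "cring K" using K.field_axioms by (simp add: field_def domain_def)
    show "abelian_group env" using ring_env by (rule ring.is_abelian_group)
  qed (simp_all add: T_smult u unit_of_add unit_of_mult add_hom_add[OF TA.sc_hom] unit_of_closed
      TA.TR.l_distr TA.TR.r_distr TA.sc_mult TA.TR.m_assoc flip: TA.one_eq)
  show ?thesis
  proof (intro diff_graded_algebra.intro graded_algebra.intro assoc_algebra.intro
      diff_graded_algebra_axioms.intro graded_algebra_axioms.intro assoc_algebra_axioms.intro)
    show "module K env" by (rule mod)
    show "ring env" by (rule ring_env)
    show "field K" by (rule K.field_axioms)
    fix n
    show "submodule (homog env n) K env"
    proof (rule module.submoduleI[OF mod])
      fix c t assume "c \<in> carrier K" "t \<in> homog env n"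
      then show "c \<odot>\<^bsub>env\<^esub> t \<in> homog env n"
        using TA.homog_mult[OF TA.homog_sc, of "unit_of c" t n]
        by (simp add: T_smult TA.homog_closed unit_of_closed)
    qed (auto simp: TA.homog_closed TA.homog_zero TA.homog_neg TA.homog_add)
  next
    fix c x y assume "c \<in> carrier K" "x \<in> carrier env" "y \<in> carrier env"
    then show "(c \<odot>\<^bsub>env\<^esub> x) \<otimes>\<^bsub>env\<^esub> y = c \<odot>\<^bsub>env\<^esub> (x \<otimes>\<^bsub>env\<^esub> y)"
      by (simp add: T_smult u TA.TR.m_assoc)
  next
    fix c x y assume a: "c \<in> carrier K" "x \<in> carrier env" "y \<in> carrier env"
    have "x \<otimes>\<^bsub>T\<^esub> (sc (unit_of c) \<otimes>\<^bsub>T\<^esub> y) = (sc (unit_of c) \<otimes>\<^bsub>T\<^esub> x) \<otimes>\<^bsub>T\<^esub> y"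
      using a u by (simp add: unit_of_central TA.TR.m_assoc)
    then show "x \<otimes>\<^bsub>env\<^esub> (c \<odot>\<^bsub>env\<^esub> y) = c \<odot>\<^bsub>env\<^esub> (x \<otimes>\<^bsub>env\<^esub> y)"
      using a u by (simp add: T_smult TA.TR.m_assoc)
  next
    fix x assume "x \<in> carrier env"
    then show "\<exists>!p. (\<forall>n. p n \<in> homog env n) \<and> finite {n. p n \<noteq> \<zero>\<^bsub>env\<^esub>} \<and> x = finsum env p {n. p n \<noteq> \<zero>\<^bsub>env\<^esub>}"
      using TA.direct_sum[of x] by simp
  next
    show "\<one>\<^bsub>env\<^esub> \<in> homog env 0" by (simp add: TA.one_eq TA.homog_sc)
  next
    fix x y m n assume "x \<in> homog env m" "y \<in> homog env n"
    then show "x \<otimes>\<^bsub>env\<^esub> y \<in> homog env (m + n)" by (simp add: TA.homog_mult)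
  next
    fix c x assume "c \<in> carrier K" "x \<in> carrier env"
    then show "diff env (c \<odot>\<^bsub>env\<^esub> x) = c \<odot>\<^bsub>env\<^esub> diff env x"
      by (simp add: T_smult d_sc_mult unit_of_closed d_closed univ.dd_B unit_of_B TA.sc_closed)
  qed (simp_all add: add_hom_add[OF d_hom] d_homog d_d d_Leibniz)
qed

lemma env_object: "envelope_object K A B env sc"
  unfolding envelope_object_def algebra_hom_def
proof (intro conjI CollectI ballI)
  show "sc \<in> ring_hom A env"
    using sc_ring_hom by (simp add: ring_hom_def)
  show "sc (c \<odot>\<^bsub>A\<^esub> a) = c \<odot>\<^bsub>env\<^esub> sc a" if "c \<in> carrier K" "a \<in> carrier A" for c a
    using that by (simp add: T_smult TA.sc_closed unit_of_left unit_of_closed flip: TA.sc_mult)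
  show "sc ` carrier A \<subseteq> homog env 0" by (auto intro: TA.homog_sc)
  show "diff env (sc b) = \<zero>\<^bsub>env\<^esub>" if "b \<in> B" for b
    using that by (simp add: d_sc B_carrier univ.dd_B)
qed (rule dga_env)

text \<open>The extension of \<open>g\<close> along the derivation \<open>d \<circ> g\<close> is the unique morphism.\<close>

lemma env_initial:
  fixes E :: "('k, 'e) dga"
  assumes E: "envelope_object K A B E g"
  shows "\<exists>!\<psi>. \<psi> \<in> extensional (carrier env) \<and> envelope_morphism K A env sc E g \<psi>"
proof -
  interpret E: diff_graded_algebra K E using E by (simp add: envelope_object_def)
  have g: "g \<in> ring_hom A E" and gK: "\<And>c a. \<lbrakk>c \<in> carrier K; a \<in> carrier A\<rbrakk> \<Longrightarrow> g (c \<odot>\<^bsub>A\<^esub> a) = c \<odot>\<^bsub>E\<^esub> g a"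
    and g0: "\<And>a. a \<in> carrier A \<Longrightarrow> g a \<in> homog E 0" and gB: "\<And>b. b \<in> B \<Longrightarrow> diff E (g b) = \<zero>\<^bsub>E\<^esub>"
    using E by (auto simp: envelope_object_def algebra_hom_def)
  note hc = E.homog_carrier and hz = E.zero_homog and hd = E.minus_homog and dc = E.diff_closed
  have diff_hom: "diff E \<in> add_hom E E"
    by (rule add_homI) (simp_all add: dc E.diff_add)
  interpret G: derivation A B E g "\<lambda>a. diff E (g a)"
  proof
    show "g \<in> ring_hom A E" by (rule g)
    have gh: "g \<in> add_hom A E"
      by (rule add_homI) (simp_all add: ring_hom_closed[OF g] ring_hom_add[OF g])
    show "(\<lambda>a. diff E (g a)) \<in> add_hom A E"
      by (rule add_hom_comp[OF diff_hom gh])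
    show "diff E (g (x \<otimes> y)) = diff E (g x) \<otimes>\<^bsub>E\<^esub> g y \<oplus>\<^bsub>E\<^esub> g x \<otimes>\<^bsub>E\<^esub> diff E (g y)"
      if "x \<in> carrier A" "y \<in> carrier A" for x y
      using that E.diff_Leibniz[OF g0[OF that(1)], of "g y"]
      by (simp add: ring_hom_mult[OF g] ring_hom_closed[OF g])
  qed (rule gB)
  have form_homog: "G.form U \<in> homog E 1" if "U \<in> carrier AA" for U
    using that
  proof (induction rule: AA.tensor_induct)
    case zero
    then show ?case by (simp add: add_hom_zero[OF AA.P.is_abelian_group E.abelian_group_axioms G.form_hom] hz)
  next
    case (diff U V)
    then show ?case
      by (simp add: add_hom_diff[OF AA.P.is_abelian_group E.abelian_group_axioms G.form_hom] hd)
  next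
    case (pure x y)
    then show ?case
      using E.homog_mult[OF g0 E.diff_homog[OF g0], of x y] by (simp add: G.form_tp)
  qed
  have ext_homog: "G.ext t \<in> homog E n" if "t \<in> homog T n" for t n
    using that
  proof (induction rule: TA.homog_induct)
    case zero
    then show ?case by (simp add: G.ext_zero hz)
  next
    case (diff U V)
    then show ?case by (simp add: G.ext_diff TA.homog_closed hd)
  next
    case (gen w)
    have *: "G.ext (TA.tn (m # ms)) \<in> homog E (int (length (m # ms)))"
      if "m \<in> carrier \<Omega>" "set ms \<subseteq> carrier \<Omega>" for m ms
      using that
    proof (induction ms arbitrary: m)
      case Nil
      then show ?case by (simp add: G.ext_emb form_homog Omega_AA)
    next
      case (Cons m' ms)
      have "G.ext (TA.tn (m # m' # ms)) = G.form m \<otimes>\<^bsub>E\<^esub> G.ext (TA.tn (m' # ms))"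
        using Cons.prems
        by (simp add: TA.tn_Cons[of m "m' # ms"] G.ext_mult TA.emb_closed TA.tn_closed G.ext_emb)
      then show ?case
        using E.homog_mult[OF form_homog Cons.IH, of m m'] Cons.prems by (simp add: Omega_AA)
    qed
    from gen(1) show ?case
    proof (cases rule: TA.twords_cases)
      case (Scal r)
      then show ?thesis using g0[of r] gen(2) by (simp add: G.ext_sc flip: TA.sc_eq)
    next
      case (Tens m ms)
      then have "n = int (length (m # ms))" using gen(2) by simp
      then show ?thesis using Tens *[of m ms] by (simp flip: TA.tn_def)
    qed
  qed
  have gc: "diff E (g x) \<in> carrier E" if "x \<in> carrier A" for x
    using that by (rule G.dd_closed)
  have form_d: "G.ext (d1 U) = diff E (G.form U)" if "U \<in> carrier AA" for U
  proof (rule AA_hom_eqI[OF E.abelian_group_axioms add_hom_comp[OF G.ext_hom d1_hom] add_hom_comp[OF diff_hom G.form_hom] _ that])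
    fix x y assume xy: "x \<in> carrier A" "y \<in> carrier A"
    then show "G.ext (d1 (tp x y)) = diff E (G.form (tp x y))"
      using E.diff_Leibniz[OF g0[OF xy(1)] gc[OF xy(2)]]
      by (simp add: d1_tp G.ext_mult univ.dd_closed G.ext_D G.form_tp E.diff_diff G.g_closed gc)
  qed
  have ext_d: "G.ext (d t) = diff E (G.ext t)" if "t \<in> carrier T" for t
    using that
  proof (induction rule: TA.tensor_alg_induct)
    case zero
    then show ?case
      by (simp add: d_zero G.ext_zero add_hom_zero[OF E.abelian_group_axioms E.abelian_group_axioms diff_hom])
  next
    case (diff U V)
    then show ?case
      by (simp add: d_diff G.ext_diff d_closed G.ext_closed
          add_hom_diff[OF E.abelian_group_axioms E.abelian_group_axioms diff_hom])
  next
    case (sc r)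
    then show ?case by (simp add: d_sc G.ext_D G.ext_sc)
  next
    case (emb m U)
    then show ?case
      using E.diff_Leibniz[OF form_homog[OF Omega_AA[OF emb(1)]] G.ext_closed[OF emb(2)]]
      by (simp add: d_emb_mult G.ext_diff G.ext_mult d1_closed TA.emb_closed Omega_AA d_closed G.ext_emb form_d)
         (simp add: a_minus_def)
  qed
  have ext_K: "G.ext (c \<odot>\<^bsub>T\<^esub> t) = c \<odot>\<^bsub>E\<^esub> G.ext t" if "c \<in> carrier K" "t \<in> carrier T" for c t
    using that E.smult_mult_left[of c "\<one>\<^bsub>E\<^esub>" "G.ext t"]
    by (simp add: T_smult G.ext_mult TA.sc_closed unit_of_closed G.ext_sc gK ring_hom_one[OF g] G.ext_closed)
  have morph: "envelope_morphism K A env sc E g (restrict G.ext (carrier T))"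
    unfolding envelope_morphism_def algebra_hom_def
  proof (intro conjI CollectI ballI allI)
    show "restrict G.ext (carrier T) \<in> ring_hom env E"
      by (rule ring_hom_memI)
         (simp_all add: G.ext_closed G.ext_mult G.ext_one add_hom_add[OF G.ext_hom])
    show "restrict G.ext (carrier T) ` homog env n \<subseteq> homog E n" for n
      by (auto simp: TA.homog_closed ext_homog)
    fix c t assume "c \<in> carrier K" "t \<in> carrier env"
    then show "restrict G.ext (carrier T) (c \<odot>\<^bsub>env\<^esub> t) = c \<odot>\<^bsub>E\<^esub> restrict G.ext (carrier T) t"
      using ext_K T_smult by (simp add: TA.sc_closed unit_of_closed)
  qed (simp_all add: d_closed ext_d TA.sc_closed G.ext_sc)
  show ?thesis
  proof (rule ex1I)
    show "restrict G.ext (carrier T) \<in> extensional (carrier env) \<and> envelope_morphism K A env sc E g (restrict G.ext (carrier T))"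
      using morph by simp
  next
    fix \<psi> assume p: "\<psi> \<in> extensional (carrier env) \<and> envelope_morphism K A env sc E g \<psi>"
    then have ring: "\<psi> \<in> ring_hom env E" and dpsi: "\<And>x. x \<in> carrier T \<Longrightarrow> \<psi> (d x) = diff E (\<psi> x)"
      and psi_sc: "\<And>a. a \<in> carrier A \<Longrightarrow> \<psi> (sc a) = g a"
      by (auto simp: envelope_morphism_def algebra_hom_def)
    have "\<psi> t = G.ext t" if "t \<in> carrier T" for t
    proof (rule G.ext_unique[OF _ _ psi_sc _ that])
      show "\<psi> \<in> add_hom T E"
        using ring_hom_closed[OF ring] ring_hom_add[OF ring] by (auto intro: add_homI)
      show "\<psi> (s \<otimes>\<^bsub>T\<^esub> t) = \<psi> s \<otimes>\<^bsub>E\<^esub> \<psi> t" if "s \<in> carrier T" "t \<in> carrier T" for s t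
        using ring_hom_mult[OF ring] that by simp
      show "\<psi> (D r) = diff E (g r)" if "r \<in> carrier A" for r
        using dpsi[of "sc r"] that by (simp add: TA.sc_closed d_sc psi_sc)
    qed
    then show "\<psi> = restrict G.ext (carrier T)"
      using p by (auto simp: fun_eq_iff extensional_def)
  qed
qed

lemma env_envelope: "rel_diff_envelope TYPE('e) K A B env sc"
  unfolding rel_diff_envelope_def using env_object env_initial by blast

end

lemma envelope_morphism_comp:
  assumes "envelope_morphism K A D f E g \<psi>" "envelope_morphism K A E g F h \<phi>" "envelope_object K A B D f"
  shows "envelope_morphism K A D f F h (compose (carrier D) \<phi> \<psi>)"
proof -
  interpret D: diff_graded_algebra K D using assms(3) by (simp add: envelope_object_def)
  have f: "f a \<in> carrier D" if "a \<in> carrier A" for a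
    using assms(3) that by (auto simp: envelope_object_def algebra_hom_def ring_hom_closed)
  have r: "\<psi> \<in> ring_hom D E" "\<phi> \<in> ring_hom E F"
    using assms by (auto simp: envelope_morphism_def algebra_hom_def)
  note c = ring_hom_closed[OF r(1)]
  show ?thesis
    unfolding envelope_morphism_def algebra_hom_def
  proof (intro conjI CollectI ballI allI)
    show "compose (carrier D) \<phi> \<psi> \<in> ring_hom D F"
      by (rule ring_hom_memI)
         (simp_all add: compose_def ring_hom_closed[OF r(1)] ring_hom_closed[OF r(2)] ring_hom_add[OF r(1)]
           ring_hom_add[OF r(2)] ring_hom_mult[OF r(1)] ring_hom_mult[OF r(2)] ring_hom_one[OF r(1)] ring_hom_one[OF r(2)])
    show "compose (carrier D) \<phi> \<psi> ` homog D n \<subseteq> homog F n" for n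
    proof
      fix y assume "y \<in> compose (carrier D) \<phi> \<psi> ` homog D n"
      then obtain x where x: "x \<in> homog D n" "y = \<phi> (\<psi> x)"
        by (auto simp: compose_def D.homog_carrier)
      have "\<psi> x \<in> homog E n" using assms(1) x(1) by (auto simp: envelope_morphism_def)
      then show "y \<in> homog F n" using assms(2) x(2) by (auto simp: envelope_morphism_def)
    qed
  qed (use assms(1,2) f in \<open>simp_all add: envelope_morphism_def algebra_hom_def compose_def c D.diff_closed\<close>)
qed

lemma envelope_morphism_id:
  assumes "envelope_object K A B D f"
  shows "envelope_morphism K A D f D f (restrict (\<lambda>x. x) (carrier D))"
proof -
  interpret D: diff_graded_algebra K D using assms by (simp add: envelope_object_def)
  have f: "f a \<in> carrier D" if "a \<in> carrier A" for a
    using assms that by (auto simp: envelope_object_def algebra_hom_def ring_hom_closed)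
  show ?thesis
    by (auto simp: envelope_morphism_def algebra_hom_def f D.diff_closed D.homog_carrier intro!: ring_hom_memI)
qed

text \<open>The morphisms between two initial objects are mutually inverse.  Both objects must be initial among
  objects with underlying sets in either type.\<close>

lemma envelope_iso:
  fixes D :: "('k, 'd) dga" and E :: "('k, 'e) dga"
  assumes D: "rel_diff_envelope TYPE('d) K A B D f" "rel_diff_envelope TYPE('e) K A B D f"
    and E: "rel_diff_envelope TYPE('d) K A B E g" "rel_diff_envelope TYPE('e) K A B E g"
  shows "\<exists>\<phi>. graded_algebra_iso K D E \<phi> \<and> (\<forall>a\<in>carrier A. \<phi> (f a) = g a)"
proof -
  have oD: "envelope_object K A B D f" and oE: "envelope_object K A B E g"
    using D E by (auto simp: rel_diff_envelope_def)
  obtain \<phi> where phi: "envelope_morphism K A D f E g \<phi>"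
    using D(2) oE unfolding rel_diff_envelope_def by blast
  obtain \<psi> where psi: "envelope_morphism K A E g D f \<psi>"
    using E(1) oD unfolding rel_diff_envelope_def by blast
  have "compose (carrier D) \<psi> \<phi> = restrict (\<lambda>x. x) (carrier D)"
  proof -
    have "\<exists>!\<chi>. \<chi> \<in> extensional (carrier D) \<and> envelope_morphism K A D f D f \<chi>"
      using D(1) oD unfolding rel_diff_envelope_def by blast
    moreover have "compose (carrier D) \<psi> \<phi> \<in> extensional (carrier D)"
      "restrict (\<lambda>x. x) (carrier D) \<in> extensional (carrier D)" by simp_all
    ultimately show ?thesis
      using envelope_morphism_comp[OF phi psi oD] envelope_morphism_id[OF oD] by blast
  qed
  from fun_cong[OF this] have left: "\<psi> (\<phi> x) = x" if "x \<in> carrier D" for x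
    using that by (metis compose_eq restrict_apply')
  have "compose (carrier E) \<phi> \<psi> = restrict (\<lambda>x. x) (carrier E)"
  proof -
    have "\<exists>!\<chi>. \<chi> \<in> extensional (carrier E) \<and> envelope_morphism K A E g E g \<chi>"
      using E(2) oE unfolding rel_diff_envelope_def by blast
    moreover have "compose (carrier E) \<phi> \<psi> \<in> extensional (carrier E)"
      "restrict (\<lambda>x. x) (carrier E) \<in> extensional (carrier E)" by simp_all
    ultimately show ?thesis
      using envelope_morphism_comp[OF psi phi oE] envelope_morphism_id[OF oE] by blast
  qed
  from fun_cong[OF this] have right: "\<phi> (\<psi> x) = x" if "x \<in> carrier E" for x
    using that by (metis compose_eq restrict_apply')
  interpret E: diff_graded_algebra K E using oE by (simp add: envelope_object_def)
  have r: "\<phi> \<in> ring_hom D E" "\<psi> \<in> ring_hom E D"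
    using phi psi by (auto simp: envelope_morphism_def algebra_hom_def)
  have "graded_algebra_iso K D E \<phi>"
    unfolding graded_algebra_iso_def graded_module_iso_def
  proof (intro conjI ballI allI)
    show "bij_betw \<phi> (carrier D) (carrier E)"
      by (rule bij_betwI[of _ _ _ \<psi>]) (use left right r ring_hom_closed in auto)
    show "\<phi> ` homog D n = homog E n" for n
    proof
      show "\<phi> ` homog D n \<subseteq> homog E n" using phi by (auto simp: envelope_morphism_def)
      show "homog E n \<subseteq> \<phi> ` homog D n"
      proof
        fix y assume y: "y \<in> homog E n"
        then have "\<psi> y \<in> homog D n" using psi by (auto simp: envelope_morphism_def)
        then show "y \<in> \<phi> ` homog D n" using right[OF E.homog_carrier[OF y]] by (metis imageI)
      qed
    qed
  qed (use r phi in \<open>auto simp: envelope_morphism_def algebra_hom_def ring_hom_add\<close>)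
  then show ?thesis using phi by (auto simp: envelope_morphism_def)
qed



section \<open>The tensor algebra as an induced module\<close>

context ring_extension
begin

abbreviation "RB \<equiv> A\<lparr>carrier := B\<rparr>"
abbreviation "Q \<equiv> quotient_bimodule A B"

lemma abelian_subgroup_B: "abelian_subgroup B A"
  using abelian_subgroupI3[of B A] subring.axioms(1)[OF sub] abelian_group_axioms
  by (simp add: additive_subgroup_def)

interpretation QB: abelian_subgroup B A by (rule abelian_subgroup_B)

text \<open>The class of an element of \<open>A\<close> in \<open>A/B\<close>.\<close>

abbreviation qcl :: "'a \<Rightarrow> 'a set" where "qcl a \<equiv> B +>\<^bsub>A\<^esub> a"

lemma B_ops:
  "\<lbrakk>b \<in> B; c \<in> B\<rbrakk> \<Longrightarrow> b \<otimes> c \<in> B" "\<lbrakk>b \<in> B; c \<in> B\<rbrakk> \<Longrightarrow> b \<oplus> c \<in> B"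
  using subringE(6,7)[OF sub] by auto

lemma Q_carrier: "U \<in> carrier Q \<longleftrightarrow> (\<exists>a\<in>carrier A. U = qcl a)"
  by (auto simp: quotient_bimodule_def A_RCOSETS_def')

lemma qcl_closed: "a \<in> carrier A \<Longrightarrow> qcl a \<in> carrier Q"
  by (auto simp: Q_carrier)

lemma qcl_add: "\<lbrakk>a \<in> carrier A; c \<in> carrier A\<rbrakk> \<Longrightarrow> qcl (a \<oplus> c) = qcl a \<oplus>\<^bsub>Q\<^esub> qcl c"
  by (simp add: quotient_bimodule_def QB.a_rcos_sum)

lemma Q_zero: "\<zero>\<^bsub>Q\<^esub> = B"
  by (simp add: quotient_bimodule_def)

lemma qcl_B: "b \<in> B \<Longrightarrow> qcl b = \<zero>\<^bsub>Q\<^esub>"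
  by (simp add: Q_zero QB.a_rcos_const)

lemma mem_qcl: "x \<in> qcl a \<Longrightarrow> a \<in> carrier A \<Longrightarrow> \<exists>b\<in>B. x = b \<oplus> a"
  by (auto simp: a_r_coset_def')

lemma qcl_eqI: "\<lbrakk>b \<in> B; a \<in> carrier A\<rbrakk> \<Longrightarrow> qcl (b \<oplus> a) = qcl a"
  using QB.a_repr_independence'[of "b \<oplus> a" a] by (auto simp: a_r_coset_def')

lemma qcl_smult:
  assumes "b \<in> B" "a \<in> carrier A"
  shows "b \<odot>\<^bsub>Q\<^esub> qcl a = qcl (b \<otimes> a)"
proof -
  have eq: "qcl (b \<otimes> x) = qcl (b \<otimes> a)" if "x \<in> qcl a" for x
  proof -
    obtain c where "c \<in> B" "x = c \<oplus> a" using mem_qcl[OF \<open>x \<in> qcl a\<close> assms(2)] by blast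
    then show ?thesis using assms B_ops B_carrier by (simp add: r_distr qcl_eqI)
  qed
  have "b \<odot>\<^bsub>Q\<^esub> qcl a = (\<Union>x\<in>qcl a. qcl (b \<otimes> x))" by (simp add: quotient_bimodule_def)
  also have "\<dots> = (\<Union>x\<in>qcl a. qcl (b \<otimes> a))" by (intro SUP_cong refl eq)
  also have "\<dots> = qcl (b \<otimes> a)"
    using QB.a_rcos_self[OF assms(2)] by blast
  finally show ?thesis .
qed

lemma qcl_rsmult:
  assumes "b \<in> B" "a \<in> carrier A"
  shows "rsmult Q (qcl a) b = qcl (a \<otimes> b)"
proof -
  have eq: "qcl (x \<otimes> b) = qcl (a \<otimes> b)" if "x \<in> qcl a" for x
  proof -
    obtain c where "c \<in> B" "x = c \<oplus> a" using mem_qcl[OF \<open>x \<in> qcl a\<close> assms(2)] by blast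
    then show ?thesis using assms B_ops B_carrier by (simp add: l_distr qcl_eqI)
  qed
  have "rsmult Q (qcl a) b = (\<Union>x\<in>qcl a. qcl (x \<otimes> b))" by (simp add: quotient_bimodule_def)
  also have "\<dots> = (\<Union>x\<in>qcl a. qcl (a \<otimes> b))" by (intro SUP_cong refl eq)
  also have "\<dots> = qcl (a \<otimes> b)"
    using QB.a_rcos_self[OF assms(2)] by blast
  finally show ?thesis .
qed

text \<open>The actions on cosets are computed on representatives, so the laws are those of \<open>A\<close>.\<close>

lemma bimodule_Q: "bimodule RB Q"
proof (rule bimodule.intro)
  show "ring RB" by (rule subring_is_ring[OF sub])
  show "abelian_group Q"
  proof (rule abelian_groupI)
    have z: "\<zero>\<^bsub>Q\<^esub> = qcl \<zero>" using qcl_B[of \<zero>] subringE(2)[OF sub] by simp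
    show "\<zero>\<^bsub>Q\<^esub> \<in> carrier Q" by (simp add: z qcl_closed)
    fix U assume "U \<in> carrier Q"
    then obtain a where a: "a \<in> carrier A" "U = qcl a" by (auto simp: Q_carrier)
    show "\<zero>\<^bsub>Q\<^esub> \<oplus>\<^bsub>Q\<^esub> U = U" using a by (simp add: z flip: qcl_add)
    show "\<exists>y\<in>carrier Q. y \<oplus>\<^bsub>Q\<^esub> U = \<zero>\<^bsub>Q\<^esub>"
      by (rule bexI[of _ "qcl (\<ominus> a)"]) (use a in \<open>simp_all add: z qcl_closed l_neg flip: qcl_add\<close>)
    fix V assume "V \<in> carrier Q"
    then obtain c where c: "c \<in> carrier A" "V = qcl c" by (auto simp: Q_carrier)
    show "U \<oplus>\<^bsub>Q\<^esub> V \<in> carrier Q" using a c by (simp add: qcl_closed flip: qcl_add)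
    show "U \<oplus>\<^bsub>Q\<^esub> V = V \<oplus>\<^bsub>Q\<^esub> U" using a c by (simp add: a_comm flip: qcl_add)
    fix W assume "W \<in> carrier Q"
    then obtain e where e: "e \<in> carrier A" "W = qcl e" by (auto simp: Q_carrier)
    show "U \<oplus>\<^bsub>Q\<^esub> V \<oplus>\<^bsub>Q\<^esub> W = U \<oplus>\<^bsub>Q\<^esub> (V \<oplus>\<^bsub>Q\<^esub> W)" using a c e by (simp add: a_assoc flip: qcl_add)
  qed
  show "bimodule_axioms RB Q"
    by (rule bimodule_axioms.intro)
       (auto simp: Q_carrier qcl_smult qcl_rsmult B_carrier B_ops one_B m_assoc l_distr r_distr
         intro!: qcl_add bexI simp flip: qcl_add)
qed

sublocale TB: tensor_alg RB Q
  by (rule tensor_alg.intro) (rule bimodule_Q)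

abbreviation "TQ \<equiv> tensor_algebra RB Q"
abbreviation "scB \<equiv> tensor_scalar RB Q"
text \<open>The class of an element of \<open>A\<close> as an element of degree \<open>1\<close> of \<open>T\<^sub>B(A/B)\<close>.\<close>

definition p :: "'a \<Rightarrow> ('a, 'a set) tensor_word_class" where "p a = TB.emb (qcl a)"

lemma p_hom: "p \<in> add_hom A TQ"
  unfolding p_def [abs_def]
  by (rule add_hom_comp[OF TB.emb_hom]) (rule add_homI, simp_all add: qcl_closed qcl_add)

lemma p_closed: "a \<in> carrier A \<Longrightarrow> p a \<in> carrier TQ"
  using add_hom_closed[OF p_hom] .

lemma scB_closed: "b \<in> B \<Longrightarrow> scB b \<in> carrier TQ"
  by (simp add: TB.sc_closed)

lemma p_B_left: "\<lbrakk>b \<in> B; a \<in> carrier A\<rbrakk> \<Longrightarrow> p (b \<otimes> a) = scB b \<otimes>\<^bsub>TQ\<^esub> p a"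
  using TB.emb_smult[of b "qcl a"] by (simp add: p_def qcl_smult qcl_closed)

lemma p_B_right: "\<lbrakk>b \<in> B; a \<in> carrier A\<rbrakk> \<Longrightarrow> p (a \<otimes> b) = p a \<otimes>\<^bsub>TQ\<^esub> scB b"
  using TB.emb_rsmult[of b "qcl a"] by (simp add: p_def qcl_rsmult qcl_closed)

lemma p_B: "b \<in> B \<Longrightarrow> p b = \<zero>\<^bsub>TQ\<^esub>"
  using add_hom_zero[OF TB.M.abelian_group_axioms TB.T.is_abelian_group TB.emb_hom] by (simp add: p_def qcl_B)

lemma TQ_induct [consumes 1, case_names zero diff scB p]:
  assumes "t \<in> carrier TQ" "P \<zero>\<^bsub>TQ\<^esub>"
    "\<And>s t. \<lbrakk>s \<in> carrier TQ; t \<in> carrier TQ; P s; P t\<rbrakk> \<Longrightarrow> P (s \<ominus>\<^bsub>TQ\<^esub> t)"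
    "\<And>b. b \<in> B \<Longrightarrow> P (scB b)"
    "\<And>a t. \<lbrakk>a \<in> carrier A; t \<in> carrier TQ; P t\<rbrakk> \<Longrightarrow> P (p a \<otimes>\<^bsub>TQ\<^esub> t)"
  shows "P t"
  using assms(1)
proof (induction rule: TB.tensor_alg_induct)
  case (emb m U)
  then obtain a where "a \<in> carrier A" "m = qcl a" by (auto simp: Q_carrier)
  then show ?case using assms(5)[of a U] emb by (simp add: p_def)
qed (use assms in auto)

abbreviation "N \<equiv> tensor_algebra_bimodule RB Q"
abbreviation "F \<equiv> tensor_product B (self_bimodule A) N"

lemma N_fields [simp]:
  "carrier N = carrier TQ" "add N = add TQ" "\<zero>\<^bsub>N\<^esub> = \<zero>\<^bsub>TQ\<^esub>" "b \<odot>\<^bsub>N\<^esub> t = scB b \<otimes>\<^bsub>TQ\<^esub> t"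
  by (simp_all add: tensor_algebra_bimodule_def bimodule_via_def)

lemma add_hom_N [simp]: "add_hom N H = add_hom TQ H" "add_hom H N = add_hom H TQ"
  by (simp_all add: add_hom_def)

sublocale FF: tensor B "self_bimodule A" N
proof (intro tensor.intro tensor_axioms.intro)
  show "abelian_group (self_bimodule A)" by (rule AA.M.abelian_group_axioms)
  show "abelian_group N"
    by (rule abelian_groupI) (auto simp: TB.T.G.a_ac intro: bexI[of _ "\<ominus>\<^bsub>TQ\<^esub> _"] TB.T.G.l_neg)
qed (simp_all add: B_carrier scB_closed)

abbreviation "ft \<equiv> FF.pure"

lemmas ft_closed = FF.pure_closed [simplified]
lemmas ft_hom_left = FF.pure_hom_left [simplified]
lemmas ft_hom_right = FF.pure_hom_right [simplified]
lemmas ft_balanced = FF.pure_balanced [simplified]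
lemmas F_hom_eqI = FF.tensor_hom_eqI [simplified]

lemma F_lift:
  assumes "abelian_group H"
    and "\<And>y. y \<in> carrier TQ \<Longrightarrow> (\<lambda>x. h x y) \<in> add_hom A H"
    and "\<And>x. x \<in> carrier A \<Longrightarrow> (\<lambda>y. h x y) \<in> add_hom TQ H"
    and "\<And>x b y. \<lbrakk>x \<in> carrier A; b \<in> B; y \<in> carrier TQ\<rbrakk> \<Longrightarrow> h (x \<otimes> b) y = h x (scB b \<otimes>\<^bsub>TQ\<^esub> y)"
  shows "lift_map H (\<lambda>(x, y). h x y) \<in> add_hom F H"
    and "\<lbrakk>x \<in> carrier A; y \<in> carrier TQ\<rbrakk> \<Longrightarrow> lift_map H (\<lambda>(x, y). h x y) (ft x y) = h x y"
  using FF.tensor_lift_hom[of H h] FF.tensor_lift_pure[of H h] assms by simp_all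

text \<open>The operator \<open>a \<otimes> t \<mapsto> x \<otimes> [ya] t\<close> on \<open>F = A \<otimes>\<^sub>B T\<^sub>B(A/B)\<close>.  It is balanced in \<open>x\<close> and \<open>y\<close>, and hence
  defines the action \<open>act\<close> of \<open>A \<otimes>\<^sub>B A\<close> below.\<close>

definition act2 :: "'a \<Rightarrow> 'a \<Rightarrow> ('a, ('a, 'a set) tensor_word_class) tensor \<Rightarrow> ('a, ('a, 'a set) tensor_word_class) tensor" where
  "act2 x y = lift_map F (\<lambda>(a, t). ft x (p (y \<otimes> a) \<otimes>\<^bsub>TQ\<^esub> t))"

lemma
  assumes xy: "x \<in> carrier A" "y \<in> carrier A"
  shows act2_hom: "act2 x y \<in> add_hom F F"
    and act2_ft: "\<lbrakk>a \<in> carrier A; t \<in> carrier TQ\<rbrakk> \<Longrightarrow> act2 x y (ft a t) = ft x (p (y \<otimes> a) \<otimes>\<^bsub>TQ\<^esub> t)"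
proof -
  have 1: "(\<lambda>a. ft x (p (y \<otimes> a) \<otimes>\<^bsub>TQ\<^esub> t)) \<in> add_hom A F" if "t \<in> carrier TQ" for t
    by (rule add_hom_comp[OF ft_hom_right[OF xy(1)] TB.TR.add_hom_rmult[OF that add_hom_comp[OF p_hom add_hom_mult_left[OF xy(2)]]]])
  have 2: "(\<lambda>t. ft x (p (y \<otimes> a) \<otimes>\<^bsub>TQ\<^esub> t)) \<in> add_hom TQ F" if "a \<in> carrier A" for a
    by (rule add_hom_comp[OF ft_hom_right[OF xy(1)] TB.TR.add_hom_lmult[OF _ add_hom_ident]])
       (use xy that in \<open>simp add: p_closed\<close>)
  have 3: "ft x (p (y \<otimes> (a \<otimes> b)) \<otimes>\<^bsub>TQ\<^esub> t) = ft x (p (y \<otimes> a) \<otimes>\<^bsub>TQ\<^esub> (scB b \<otimes>\<^bsub>TQ\<^esub> t))"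
    if "a \<in> carrier A" "b \<in> B" "t \<in> carrier TQ" for a b t
    using that xy p_B_right[of b "y \<otimes> a"]
    by (simp add: m_assoc B_carrier TB.TR.m_assoc p_closed scB_closed)
  show "act2 x y \<in> add_hom F F"
    unfolding act2_def by (rule F_lift(1)[OF FF.P.is_abelian_group 1 2 3])
  show "act2 x y (ft a t) = ft x (p (y \<otimes> a) \<otimes>\<^bsub>TQ\<^esub> t)" if "a \<in> carrier A" "t \<in> carrier TQ"
    unfolding act2_def by (rule F_lift(2)[OF FF.P.is_abelian_group 1 2 3 that])
qed

definition act :: "('a, 'a) tensor \<Rightarrow> ('a, ('a, 'a set) tensor_word_class) tensor \<Rightarrow> ('a, ('a, 'a set) tensor_word_class) tensor" where
  "act U f = lift_map F (\<lambda>(x, y). act2 x y f) U"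

lemma
  assumes f: "f \<in> carrier F"
  shows act_hom': "(\<lambda>U. act U f) \<in> add_hom AA F"
    and act_tp: "\<lbrakk>x \<in> carrier A; y \<in> carrier A\<rbrakk> \<Longrightarrow> act (tp x y) f = act2 x y f"
proof -
  note eqI = F_hom_eqI[OF FF.P.is_abelian_group]
  have c: "act2 x y f \<in> carrier F" if "x \<in> carrier A" "y \<in> carrier A" for x y
    using add_hom_closed[OF act2_hom[OF that] f] .
  have 1: "(\<lambda>x. act2 x y f) \<in> add_hom A F" if y: "y \<in> carrier A" for y
  proof (rule add_homI)
    fix x x' assume x: "x \<in> carrier A" "x' \<in> carrier A"
    show "act2 (x \<oplus> x') y f = act2 x y f \<oplus>\<^bsub>F\<^esub> act2 x' y f"
      by (rule eqI[OF act2_hom FF.P.G.add_hom_plus[OF act2_hom act2_hom] _ f])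
         (use x y in \<open>simp_all add: act2_ft add_hom_add[OF ft_hom_left] p_closed\<close>)
  qed (use c y in simp)
  have 2: "(\<lambda>y. act2 x y f) \<in> add_hom A F" if x: "x \<in> carrier A" for x
  proof (rule add_homI)
    fix y y' assume y: "y \<in> carrier A" "y' \<in> carrier A"
    show "act2 x (y \<oplus> y') f = act2 x y f \<oplus>\<^bsub>F\<^esub> act2 x y' f"
      by (rule eqI[OF act2_hom FF.P.G.add_hom_plus[OF act2_hom act2_hom] _ f])
         (use x y in \<open>simp_all add: act2_ft add_hom_add[OF ft_hom_right] p_closed l_distr
            add_hom_add[OF p_hom] TB.TR.l_distr\<close>)
  qed (use c x in simp)
  have 3: "act2 (x \<otimes> b) y f = act2 x (b \<otimes> y) f" if xy: "x \<in> carrier A" "b \<in> B" "y \<in> carrier A" for x b y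
    by (rule eqI[OF act2_hom act2_hom _ f])
       (use xy in \<open>simp_all add: B_carrier act2_ft ft_balanced p_closed m_assoc p_B_left TB.TR.m_assoc scB_closed\<close>)
  show "(\<lambda>U. act U f) \<in> add_hom AA F"
    unfolding act_def by (rule AA_lift(1)[OF FF.P.is_abelian_group 1 2 3])
  show "act (tp x y) f = act2 x y f" if "x \<in> carrier A" "y \<in> carrier A"
    unfolding act_def by (rule AA_lift(2)[OF FF.P.is_abelian_group 1 2 3 that])
qed

lemma act_tp_ft: "\<lbrakk>x \<in> carrier A; y \<in> carrier A; a \<in> carrier A; t \<in> carrier TQ\<rbrakk> \<Longrightarrow>
    act (tp x y) (ft a t) = ft x (p (y \<otimes> a) \<otimes>\<^bsub>TQ\<^esub> t)"
  by (simp add: act_tp act2_ft ft_closed)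

lemma act_closed: "\<lbrakk>U \<in> carrier AA; f \<in> carrier F\<rbrakk> \<Longrightarrow> act U f \<in> carrier F"
  using add_hom_closed[OF act_hom'] by blast

lemma act_diff: "\<lbrakk>U \<in> carrier AA; V \<in> carrier AA; f \<in> carrier F\<rbrakk> \<Longrightarrow> act (U \<ominus>\<^bsub>AA\<^esub> V) f = act U f \<ominus>\<^bsub>F\<^esub> act V f"
  using add_hom_diff[OF AA.P.is_abelian_group FF.P.is_abelian_group act_hom'] by blast

lemma act_zero: "f \<in> carrier F \<Longrightarrow> act \<zero>\<^bsub>AA\<^esub> f = \<zero>\<^bsub>F\<^esub>"
  by (rule add_hom_zero[OF AA.P.is_abelian_group FF.P.is_abelian_group act_hom'])

lemma add_hom_cong: "\<lbrakk>f \<in> add_hom G H; \<And>x. x \<in> carrier G \<Longrightarrow> g x = f x; abelian_group G\<rbrakk> \<Longrightarrow> g \<in> add_hom G H"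
  using abelian_groupE(1) by (fastforce simp: add_hom_def)

lemma act_hom: "U \<in> carrier AA \<Longrightarrow> (\<lambda>f. act U f) \<in> add_hom F F"
proof (induction rule: AA.tensor_induct)
  case zero
  show ?case by (rule add_hom_cong[OF FF.P.G.add_hom_0 _ FF.P.is_abelian_group]) (rule act_zero)
next
  case (diff U V)
  show ?case
    by (rule add_hom_cong[OF FF.P.G.add_hom_sub[OF diff(3,4)] _ FF.P.is_abelian_group])
       (use diff in \<open>simp add: act_diff\<close>)
next
  case (pure x y)
  then show ?case
    by (intro add_hom_cong[OF act2_hom _ FF.P.is_abelian_group]) (simp_all add: act_tp)
qed

lemma
  assumes "a \<in> carrier A"
  shows F_smult_hom: "(\<lambda>f. a \<odot>\<^bsub>F\<^esub> f) \<in> add_hom F F"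
    and F_smult_ft: "\<lbrakk>x \<in> carrier A; t \<in> carrier TQ\<rbrakk> \<Longrightarrow> a \<odot>\<^bsub>F\<^esub> ft x t = ft (a \<otimes> x) t"
  using assms FF.tensor_smult_hom[of a] FF.tensor_smult_pure[of a]
  by (simp_all add: add_hom_mult_left m_assoc B_carrier)

lemma F_smult_closed: "\<lbrakk>a \<in> carrier A; f \<in> carrier F\<rbrakk> \<Longrightarrow> a \<odot>\<^bsub>F\<^esub> f \<in> carrier F"
  using add_hom_closed[OF F_smult_hom] .

lemma act_lact:
  assumes "r \<in> carrier A" "U \<in> carrier AA" "f \<in> carrier F"
  shows "act (r \<odot>\<^bsub>AA\<^esub> U) f = r \<odot>\<^bsub>F\<^esub> act U f"
proof (rule F_hom_eqI[OF FF.P.is_abelian_group act_hom add_hom_comp[OF F_smult_hom act_hom] _ assms(3)])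
  fix a t assume at: "a \<in> carrier A" "t \<in> carrier TQ"
  then have c: "ft a t \<in> carrier F" by (rule ft_closed)
  show "act (r \<odot>\<^bsub>AA\<^esub> U) (ft a t) = r \<odot>\<^bsub>F\<^esub> act U (ft a t)"
    by (rule AA_hom_eqI[OF FF.P.is_abelian_group add_hom_comp[OF act_hom'[OF c] lact_hom]
          add_hom_comp[OF F_smult_hom act_hom'[OF c]] _ assms(2)])
       (use at assms in \<open>simp_all add: lact_tp act_tp_ft F_smult_ft p_closed\<close>)
qed (use assms in \<open>simp_all add: lact_closed\<close>)

lemma act_ract:
  assumes "r \<in> carrier A" "U \<in> carrier AA" "f \<in> carrier F"
  shows "act (rsmult AA U r) f = act U (r \<odot>\<^bsub>F\<^esub> f)"
proof (rule F_hom_eqI[OF FF.P.is_abelian_group act_hom add_hom_comp[OF act_hom F_smult_hom] _ assms(3)])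
  fix a t assume at: "a \<in> carrier A" "t \<in> carrier TQ"
  then have c: "ft a t \<in> carrier F" by (rule ft_closed)
  show "act (rsmult AA U r) (ft a t) = act U (r \<odot>\<^bsub>F\<^esub> ft a t)"
    by (rule AA_hom_eqI[OF FF.P.is_abelian_group add_hom_comp[OF act_hom'[OF c] ract_hom]
          act_hom'[OF F_smult_closed[OF assms(1) c]] _ assms(2)])
       (use at assms in \<open>simp_all add: ract_tp act_tp_ft F_smult_ft p_closed m_assoc\<close>)
qed (use assms in \<open>simp_all add: ract_closed\<close>)

lemma F_module: "tensor_module A \<Omega> F (\<lambda>r f. r \<odot>\<^bsub>F\<^esub> f) act"
proof (intro tensor_module.intro tensor_module_axioms.intro)
  note eqI = F_hom_eqI[OF FF.P.is_abelian_group]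
  show "tensor_alg A \<Omega>" by (rule TA.tensor_alg_axioms)
  show "abelian_group F" by (rule FF.P.is_abelian_group)
  fix f assume f: "f \<in> carrier F"
  show "(\<lambda>r. r \<odot>\<^bsub>F\<^esub> f) \<in> add_hom A F"
  proof (rule add_homI)
    fix r s assume rs: "r \<in> carrier A" "s \<in> carrier A"
    show "(r \<oplus> s) \<odot>\<^bsub>F\<^esub> f = r \<odot>\<^bsub>F\<^esub> f \<oplus>\<^bsub>F\<^esub> s \<odot>\<^bsub>F\<^esub> f"
      by (rule eqI[OF F_smult_hom FF.P.G.add_hom_plus[OF F_smult_hom F_smult_hom] _ f])
         (use rs in \<open>simp_all add: F_smult_ft l_distr add_hom_add[OF ft_hom_left]\<close>)
  qed (use f F_smult_closed in simp)
  show "(r \<otimes> s) \<odot>\<^bsub>F\<^esub> f = r \<odot>\<^bsub>F\<^esub> (s \<odot>\<^bsub>F\<^esub> f)" if rs: "r \<in> carrier A" "s \<in> carrier A" for r s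
    by (rule eqI[OF F_smult_hom add_hom_comp[OF F_smult_hom F_smult_hom] _ f])
       (use rs in \<open>simp_all add: F_smult_ft m_assoc\<close>)
  show "\<one> \<odot>\<^bsub>F\<^esub> f = f"
    by (rule eqI[OF F_smult_hom add_hom_ident _ f]) (simp_all add: F_smult_ft)
  show "(\<lambda>m. act m f) \<in> add_hom \<Omega> F"
    using act_hom'[OF f] by (auto simp: add_hom_def Omega_fields Omega_carrier)
qed (simp_all add: F_smult_hom act_hom Omega_AA act_lact act_ract Omega_fields)

sublocale FM: tensor_module A \<Omega> F "\<lambda>r f. r \<odot>\<^bsub>F\<^esub> f" act by (rule F_module)

text \<open>The isomorphism from \<open>T\<close> to \<open>F\<close>: evaluation at \<open>1 \<otimes> 1\<close>.\<close>

definition chi :: "('a, ('a, 'a) tensor) tensor_word_class \<Rightarrow> ('a, ('a, 'a set) tensor_word_class) tensor" where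
  "chi t = FM.eval_at (ft \<one> \<one>\<^bsub>TQ\<^esub>) t"

lemma chi_base: "ft \<one> \<one>\<^bsub>TQ\<^esub> \<in> carrier F"
  by (simp add: ft_closed)

lemma chi_hom: "chi \<in> add_hom T F"
  unfolding chi_def [abs_def] by (rule FM.eval_at_hom[OF chi_base])

lemma chi_closed: "t \<in> carrier T \<Longrightarrow> chi t \<in> carrier F"
  using add_hom_closed[OF chi_hom] .

lemma chi_sc: "r \<in> carrier A \<Longrightarrow> chi (sc r) = ft r \<one>\<^bsub>TQ\<^esub>"
  by (simp add: chi_def FM.eval_at_sc chi_base F_smult_ft)

lemma chi_sc_mult: "\<lbrakk>r \<in> carrier A; t \<in> carrier T\<rbrakk> \<Longrightarrow> chi (sc r \<otimes>\<^bsub>T\<^esub> t) = r \<odot>\<^bsub>F\<^esub> chi t"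
  by (simp add: chi_def FM.eval_at_sc_mult chi_base)

lemma chi_emb_mult: "\<lbrakk>m \<in> carrier \<Omega>; t \<in> carrier T\<rbrakk> \<Longrightarrow> chi (TA.emb m \<otimes>\<^bsub>T\<^esub> t) = act m (chi t)"
  by (simp add: chi_def FM.eval_at_emb_mult chi_base)

lemma chi_emb: "m \<in> carrier \<Omega> \<Longrightarrow> chi (TA.emb m) = act m (ft \<one> \<one>\<^bsub>TQ\<^esub>)"
  by (simp add: chi_def FM.eval_at_emb chi_base)

text \<open>The map from \<open>A/B\<close> induced by \<open>D\<close>, which is constant on cosets of \<open>B\<close>.\<close>

definition DQ :: "'a set \<Rightarrow> ('a, ('a, 'a) tensor) tensor_word_class" where "DQ U = the_elem (D ` U)"

lemma DQ_qcl: "a \<in> carrier A \<Longrightarrow> DQ (qcl a) = D a"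
proof -
  assume a: "a \<in> carrier A"
  have "D x = D a" if "x \<in> qcl a" for x
  proof -
    obtain b where "b \<in> B" "x = b \<oplus> a" using mem_qcl[OF \<open>x \<in> qcl a\<close> a] by blast
    then show ?thesis using a by (simp add: add_hom_add[OF D_hom] B_carrier univ.dd_B univ.dd_closed)
  qed
  moreover have "a \<in> qcl a" using a by (simp add: QB.a_rcos_self)
  ultimately have "D ` qcl a = {D a}" by blast
  then show ?thesis by (simp add: DQ_def)
qed

lemma DQ_module: "tensor_module RB Q T (\<lambda>b t. sc b \<otimes>\<^bsub>T\<^esub> t) (\<lambda>U t. DQ U \<otimes>\<^bsub>T\<^esub> t)"
proof (intro tensor_module.intro tensor_module_axioms.intro)
  have DQ: "DQ \<in> add_hom Q T"
    by (rule add_homI) (auto simp: Q_carrier DQ_qcl univ.dd_closed add_hom_add[OF D_hom] simp flip: qcl_add)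
  note DQc = add_hom_closed[OF DQ]
  have scB: "sc b \<in> carrier T" if "b \<in> B" for b using that by (simp add: TA.sc_closed B_carrier)
  have sc: "sc \<in> add_hom RB T" using TA.sc_hom by (auto simp: add_hom_def B_carrier)
  show "tensor_alg RB Q" by (rule TB.tensor_alg_axioms)
  show "abelian_group T" by (rule TA.T.is_abelian_group)
  fix t assume t: "t \<in> carrier T"
  show "(\<lambda>b. sc b \<otimes>\<^bsub>T\<^esub> t) \<in> add_hom RB T" by (rule TA.TR.add_hom_rmult[OF t sc])
  show "(\<lambda>U. DQ U \<otimes>\<^bsub>T\<^esub> t) \<in> add_hom Q T" by (rule TA.TR.add_hom_rmult[OF t DQ])
  show "sc \<one>\<^bsub>RB\<^esub> \<otimes>\<^bsub>T\<^esub> t = t" using t by (simp flip: TA.one_eq)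
  fix b assume b: "b \<in> carrier RB"
  show "sc (b \<otimes>\<^bsub>RB\<^esub> c) \<otimes>\<^bsub>T\<^esub> t = sc b \<otimes>\<^bsub>T\<^esub> (sc c \<otimes>\<^bsub>T\<^esub> t)" if "c \<in> carrier RB" for c
    using b that t by (simp add: TA.sc_mult B_carrier TA.TR.m_assoc scB)
  fix U assume "U \<in> carrier Q"
  then obtain a where a: "a \<in> carrier A" "U = qcl a" by (auto simp: Q_carrier)
  show "DQ (b \<odot>\<^bsub>Q\<^esub> U) \<otimes>\<^bsub>T\<^esub> t = sc b \<otimes>\<^bsub>T\<^esub> (DQ U \<otimes>\<^bsub>T\<^esub> t)"
    using a b t by (simp add: qcl_smult DQ_qcl B_carrier univ.dd_B_mult univ.dd_closed scB TA.TR.m_assoc)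
  show "DQ (rsmult Q U b) \<otimes>\<^bsub>T\<^esub> t = DQ U \<otimes>\<^bsub>T\<^esub> (sc b \<otimes>\<^bsub>T\<^esub> t)"
    using a b t by (simp add: qcl_rsmult DQ_qcl B_carrier univ.dd_mult_B univ.dd_closed scB TA.TR.m_assoc)
qed (auto intro!: TA.TR.add_hom_lmult add_hom_ident simp: TA.sc_closed B_carrier Q_carrier DQ_qcl univ.dd_closed)

sublocale KM: tensor_module RB Q T "\<lambda>b t. sc b \<otimes>\<^bsub>T\<^esub> t" "\<lambda>U t. DQ U \<otimes>\<^bsub>T\<^esub> t" by (rule DQ_module)

text \<open>The map \<open>[a\<^sub>1] \<dots> [a\<^sub>n] \<mapsto> \<delta>a\<^sub>1 \<dots> \<delta>a\<^sub>n\<close>.\<close>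

definition kappa0 :: "('a, 'a set) tensor_word_class \<Rightarrow> ('a, ('a, 'a) tensor) tensor_word_class" where
  "kappa0 t = KM.eval_at \<one>\<^bsub>T\<^esub> t"

lemma kappa0_hom: "kappa0 \<in> add_hom TQ T"
  unfolding kappa0_def [abs_def] by (rule KM.eval_at_hom) simp

lemma kappa0_closed: "t \<in> carrier TQ \<Longrightarrow> kappa0 t \<in> carrier T"
  using add_hom_closed[OF kappa0_hom] .

lemma kappa0_sc: "b \<in> B \<Longrightarrow> kappa0 (scB b) = sc b"
  by (simp add: kappa0_def KM.eval_at_sc TA.sc_closed B_carrier)

lemma kappa0_sc_mult: "\<lbrakk>b \<in> B; t \<in> carrier TQ\<rbrakk> \<Longrightarrow> kappa0 (scB b \<otimes>\<^bsub>TQ\<^esub> t) = sc b \<otimes>\<^bsub>T\<^esub> kappa0 t"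
  by (simp add: kappa0_def KM.eval_at_sc_mult)

lemma kappa0_p_mult: "\<lbrakk>a \<in> carrier A; t \<in> carrier TQ\<rbrakk> \<Longrightarrow> kappa0 (p a \<otimes>\<^bsub>TQ\<^esub> t) = D a \<otimes>\<^bsub>T\<^esub> kappa0 t"
  by (simp add: kappa0_def p_def KM.eval_at_emb_mult qcl_closed DQ_qcl)

text \<open>The inverse of \<open>chi\<close>.\<close>

definition kappa :: "('a, ('a, 'a set) tensor_word_class) tensor \<Rightarrow> ('a, ('a, 'a) tensor) tensor_word_class" where
  "kappa = lift_map T (\<lambda>(a, t). sc a \<otimes>\<^bsub>T\<^esub> kappa0 t)"

lemma kappa_hom: "kappa \<in> add_hom F T"
  and kappa_ft: "\<lbrakk>a \<in> carrier A; t \<in> carrier TQ\<rbrakk> \<Longrightarrow> kappa (ft a t) = sc a \<otimes>\<^bsub>T\<^esub> kappa0 t"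
proof -
  have 1: "(\<lambda>a. sc a \<otimes>\<^bsub>T\<^esub> kappa0 t) \<in> add_hom A T" if "t \<in> carrier TQ" for t
    by (rule TA.TR.add_hom_rmult[OF kappa0_closed[OF that] TA.sc_hom])
  have 2: "(\<lambda>t. sc a \<otimes>\<^bsub>T\<^esub> kappa0 t) \<in> add_hom TQ T" if "a \<in> carrier A" for a
    by (rule TA.TR.add_hom_lmult[OF TA.sc_closed[OF that] kappa0_hom])
  have 3: "sc (a \<otimes> b) \<otimes>\<^bsub>T\<^esub> kappa0 t = sc a \<otimes>\<^bsub>T\<^esub> kappa0 (scB b \<otimes>\<^bsub>TQ\<^esub> t)"
    if "a \<in> carrier A" "b \<in> B" "t \<in> carrier TQ" for a b t
    using that by (simp add: kappa0_sc_mult TA.sc_mult B_carrier TA.TR.m_assoc TA.sc_closed kappa0_closed)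
  show "kappa \<in> add_hom F T"
    unfolding kappa_def by (rule F_lift(1)[OF TA.T.is_abelian_group 1 2 3])
  show "kappa (ft a t) = sc a \<otimes>\<^bsub>T\<^esub> kappa0 t" if "a \<in> carrier A" "t \<in> carrier TQ"
    unfolding kappa_def by (rule F_lift(2)[OF TA.T.is_abelian_group 1 2 3 that])
qed

lemma kappa_closed: "f \<in> carrier F \<Longrightarrow> kappa f \<in> carrier T"
  using add_hom_closed[OF kappa_hom] .

text \<open>The term \<open>a \<otimes> [1] t\<close> vanishes because \<open>1\<close> lies in \<open>B\<close>.\<close>

lemma act_delta: "\<lbrakk>a \<in> carrier A; t \<in> carrier TQ\<rbrakk> \<Longrightarrow> act (delta a) (ft \<one> t) = ft \<one> (p a \<otimes>\<^bsub>TQ\<^esub> t)"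
proof -
  assume at: "a \<in> carrier A" "t \<in> carrier TQ"
  have "ft a \<zero>\<^bsub>TQ\<^esub> = \<zero>\<^bsub>F\<^esub>"
    by (rule add_hom_zero[OF TB.T.is_abelian_group FF.P.is_abelian_group ft_hom_right[OF at(1)]])
  moreover have "x \<ominus>\<^bsub>F\<^esub> \<zero>\<^bsub>F\<^esub> = x" if "x \<in> carrier F" for x
    using that FF.P.G.diff_eq_iff[of x "\<zero>\<^bsub>F\<^esub>" x] by simp
  ultimately show ?thesis
    using at by (simp add: delta_def act_diff tp_closed ft_closed act_tp_ft p_closed p_B one_B)
qed

lemma chi_kappa0: "t \<in> carrier TQ \<Longrightarrow> chi (kappa0 t) = ft \<one> t"
proof (induction rule: TQ_induct)
  case zero
  have "kappa0 \<zero>\<^bsub>TQ\<^esub> = \<zero>\<^bsub>T\<^esub>"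
    by (rule add_hom_zero[OF TB.T.is_abelian_group TA.T.is_abelian_group kappa0_hom])
  moreover have "chi \<zero>\<^bsub>T\<^esub> = \<zero>\<^bsub>F\<^esub>"
    by (rule add_hom_zero[OF TA.T.is_abelian_group FF.P.is_abelian_group chi_hom])
  moreover have "ft \<one> \<zero>\<^bsub>TQ\<^esub> = \<zero>\<^bsub>F\<^esub>"
    by (rule add_hom_zero[OF TB.T.is_abelian_group FF.P.is_abelian_group ft_hom_right]) simp
  ultimately show ?case by simp
next
  case (diff s t)
  then show ?case
    by (simp add: add_hom_diff[OF TB.T.is_abelian_group TA.T.is_abelian_group kappa0_hom]
        add_hom_diff[OF TA.T.is_abelian_group FF.P.is_abelian_group chi_hom]
        add_hom_diff[OF TB.T.is_abelian_group FF.P.is_abelian_group ft_hom_right] kappa0_closed)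
next
  case (scB b)
  then show ?case
    using ft_balanced[of \<one> b "\<one>\<^bsub>TQ\<^esub>"] by (simp add: kappa0_sc chi_sc B_carrier scB_closed)
next
  case (p a t)
  then show ?case
    by (simp add: kappa0_p_mult D_def chi_emb_mult delta_closed kappa0_closed act_delta)
qed

lemma chi_kappa: "f \<in> carrier F \<Longrightarrow> chi (kappa f) = f"
  by (rule F_hom_eqI[OF FF.P.is_abelian_group add_hom_comp[OF chi_hom kappa_hom] add_hom_ident])
     (simp_all add: kappa_ft chi_sc_mult kappa0_closed chi_kappa0 F_smult_ft)

text \<open>From \<open>x \<delta>(ya) = x \<delta>y a + x y \<delta>a\<close>; the second summand disappears on \<open>\<Omega>\<close>, which makes \<open>kappa\<close> linear
  over \<open>T\<close>.\<close>

lemma kappa_act_ft: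
  assumes "U \<in> carrier AA" "a \<in> carrier A" "t \<in> carrier TQ"
  shows "kappa (act U (ft a t)) = J U \<otimes>\<^bsub>T\<^esub> (sc a \<otimes>\<^bsub>T\<^esub> kappa0 t) \<oplus>\<^bsub>T\<^esub> sc (mu U) \<otimes>\<^bsub>T\<^esub> (D a \<otimes>\<^bsub>T\<^esub> kappa0 t)"
proof -
  have k: "sc a \<otimes>\<^bsub>T\<^esub> kappa0 t \<in> carrier T" "D a \<otimes>\<^bsub>T\<^esub> kappa0 t \<in> carrier T"
    using assms by (simp_all add: TA.sc_closed kappa0_closed univ.dd_closed)
  show ?thesis
    by (rule AA_hom_eqI[OF TA.T.is_abelian_group add_hom_comp[OF kappa_hom act_hom'[OF ft_closed[OF assms(2,3)]]]
          TA.T.G.add_hom_plus[OF TA.TR.add_hom_rmult[OF k(1) univ.form_hom]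
            TA.TR.add_hom_rmult[OF k(2) add_hom_comp[OF TA.sc_hom mu_hom]]] _ assms(1)])
       (use assms in \<open>simp_all add: act_tp_ft kappa_ft p_closed kappa0_p_mult univ.form_tp mu_tp univ.dd_mult
         TA.sc_mult TA.TR.m_assoc TA.TR.l_distr TA.TR.r_distr TA.sc_closed kappa0_closed univ.dd_closed\<close>)
qed

lemma kappa_act:
  assumes "m \<in> carrier \<Omega>" "f \<in> carrier F"
  shows "kappa (act m f) = TA.emb m \<otimes>\<^bsub>T\<^esub> kappa f"
proof (rule F_hom_eqI[OF TA.T.is_abelian_group add_hom_comp[OF kappa_hom act_hom] TA.TR.add_hom_lmult[OF _ kappa_hom] _ assms(2)])
  show "m \<in> carrier AA" using assms by (simp add: Omega_AA)
  show "TA.emb m \<in> carrier T" using assms by (simp add: TA.emb_closed)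
  fix a t assume "a \<in> carrier A" "t \<in> carrier TQ"
  moreover have "sc (mu m) = \<zero>\<^bsub>T\<^esub>"
    using assms add_hom_zero[OF abelian_group_axioms TA.T.is_abelian_group TA.sc_hom] by (simp add: Omega_carrier)
  ultimately show "kappa (act m (ft a t)) = TA.emb m \<otimes>\<^bsub>T\<^esub> kappa (ft a t)"
    using assms
    by (simp add: kappa_act_ft Omega_AA J_Omega kappa_ft TA.emb_closed TA.sc_closed kappa0_closed univ.dd_closed)
qed

lemma kappa_chi: "t \<in> carrier T \<Longrightarrow> kappa (chi t) = t"
proof (induction rule: TA.tensor_alg_induct)
  case zero
  show ?case
    by (simp add: add_hom_zero[OF TA.T.is_abelian_group FF.P.is_abelian_group chi_hom]
        add_hom_zero[OF FF.P.is_abelian_group TA.T.is_abelian_group kappa_hom])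
next
  case (diff U V)
  then show ?case
    by (simp add: add_hom_diff[OF TA.T.is_abelian_group FF.P.is_abelian_group chi_hom]
        add_hom_diff[OF FF.P.is_abelian_group TA.T.is_abelian_group kappa_hom] chi_closed)
next
  case (sc r)
  have "kappa0 \<one>\<^bsub>TQ\<^esub> = \<one>\<^bsub>T\<^esub>"
    using kappa0_sc[OF one_B] TB.one_eq TA.one_eq by simp
  then show ?case using sc by (simp add: chi_sc kappa_ft TA.sc_closed)
next
  case (emb m U)
  then show ?case by (simp add: chi_emb_mult kappa_act chi_closed)
qed

section \<open>Degrees on the induced module\<close>

abbreviation "F_homog n \<equiv> generate (add_monoid F) {ft a t | a t. a \<in> carrier A \<and> t \<in> homog TQ n}"

lemma F_homog_closed:
  "\<zero>\<^bsub>F\<^esub> \<in> F_homog n"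
  "\<lbrakk>f \<in> F_homog n; g \<in> F_homog n\<rbrakk> \<Longrightarrow> f \<oplus>\<^bsub>F\<^esub> g \<in> F_homog n"
  "f \<in> F_homog n \<Longrightarrow> \<ominus>\<^bsub>F\<^esub> f \<in> F_homog n"
  "f \<in> F_homog n \<Longrightarrow> f \<in> carrier F"
  "\<lbrakk>f \<in> F_homog n; g \<in> F_homog n\<rbrakk> \<Longrightarrow> f \<ominus>\<^bsub>F\<^esub> g \<in> F_homog n"
proof -
  let ?H = "{ft a t | a t. a \<in> carrier A \<and> t \<in> homog TQ n}"
  have H: "?H \<subseteq> carrier (add_monoid F)" by (auto intro: ft_closed TB.homog_closed)
  show 1: "\<zero>\<^bsub>F\<^esub> \<in> F_homog n" using generate.one[of "add_monoid F" ?H] by simp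
  show 2: "f \<oplus>\<^bsub>F\<^esub> g \<in> F_homog n" if "f \<in> F_homog n" "g \<in> F_homog n" for f g
    using generate.eng[OF that] by simp
  show 3: "\<ominus>\<^bsub>F\<^esub> f \<in> F_homog n" if "f \<in> F_homog n" for f
    using group.generate_m_inv_closed[OF FF.P.G.a_group H that] by (simp add: a_inv_def)
  show "f \<in> carrier F" if "f \<in> F_homog n"
    using group.generate_in_carrier[OF FF.P.G.a_group H that] by simp
  show "f \<ominus>\<^bsub>F\<^esub> g \<in> F_homog n" if "f \<in> F_homog n" "g \<in> F_homog n"
    using 2[OF that(1) 3[OF that(2)]] by (simp add: a_minus_def)
qed

lemma F_homog_ft: "\<lbrakk>a \<in> carrier A; t \<in> homog TQ n\<rbrakk> \<Longrightarrow> ft a t \<in> F_homog n"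
  by (rule generate.incl) blast

text \<open>An additive map sends the component of degree \<open>n\<close> of \<open>F\<close> into a subgroup if it does so with the generators of
  that component.\<close>

lemma F_homog_map:
  assumes "f \<in> F_homog n" "abelian_group H" "\<phi> \<in> add_hom F H"
    and "\<zero>\<^bsub>H\<^esub> \<in> K" "\<And>x y. \<lbrakk>x \<in> K; y \<in> K\<rbrakk> \<Longrightarrow> x \<oplus>\<^bsub>H\<^esub> y \<in> K" "\<And>x. x \<in> K \<Longrightarrow> \<ominus>\<^bsub>H\<^esub> x \<in> K"
    and ft: "\<And>a t. \<lbrakk>a \<in> carrier A; t \<in> homog TQ n\<rbrakk> \<Longrightarrow> \<phi> (ft a t) \<in> K"
  shows "\<phi> f \<in> K"
  using assms(1)
proof (induction rule: generate.induct)
  case one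
  then show ?case using assms by (simp add: add_hom_zero[OF FF.P.is_abelian_group assms(2,3)])
next
  case (incl h)
  then show ?case using ft by auto
next
  case (inv h)
  then obtain a t where h: "h = ft a t" "a \<in> carrier A" "t \<in> homog TQ n" by blast
  then have "\<phi> (\<ominus>\<^bsub>F\<^esub> h) = \<ominus>\<^bsub>H\<^esub> \<phi> h"
    using add_hom_minus[OF FF.P.is_abelian_group assms(2,3)] by (simp add: ft_closed TB.homog_closed)
  then show ?case using assms(6)[OF ft[OF h(2,3)]] h(1) by (simp add: a_inv_def)
next
  case (eng h1 h2)
  then show ?case using assms(5) by (simp add: add_hom_add[OF assms(3)] F_homog_closed(4))
qed

lemma act_homog: "\<lbrakk>U \<in> carrier AA; f \<in> F_homog n\<rbrakk> \<Longrightarrow> act U f \<in> F_homog (1 + n)"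
proof (induction rule: AA.tensor_induct)
  case zero
  then show ?case by (simp add: act_zero F_homog_closed(1,4))
next
  case (diff U V)
  then show ?case by (simp add: act_diff F_homog_closed(4,5))
next
  case (pure x y)
  then have xy: "x \<in> carrier A" "y \<in> carrier A" by simp_all
  show ?case
  proof (rule F_homog_map[OF pure(3) FF.P.is_abelian_group act_hom])
    fix a t assume at: "a \<in> carrier A" "t \<in> homog TQ n"
    have "p (y \<otimes> a) \<in> homog TQ 1" using xy at by (simp add: p_def TB.homog_emb qcl_closed)
    from TB.homog_mult[OF this at(2)] show "act (tp x y) (ft a t) \<in> F_homog (1 + n)"
      using xy at by (simp add: act_tp_ft TB.homog_closed F_homog_ft)
  qed (use xy in \<open>simp_all add: F_homog_closed tp_closed\<close>)
qed

lemma chi_homog: "t \<in> homog T n \<Longrightarrow> chi t \<in> F_homog n"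
proof (induction rule: TA.homog_induct)
  case zero
  show ?case by (simp add: add_hom_zero[OF TA.T.is_abelian_group FF.P.is_abelian_group chi_hom] F_homog_closed(1))
next
  case (diff U V)
  then show ?case
    by (simp add: add_hom_diff[OF TA.T.is_abelian_group FF.P.is_abelian_group chi_hom] TA.homog_closed F_homog_closed(5))
next
  case (gen w)
  have one: "\<one>\<^bsub>TQ\<^esub> \<in> homog TQ 0" using TB.homog_sc[of \<one>] one_B by (simp add: TB.one_eq)
  have *: "chi (TA.tn (m # ms)) \<in> F_homog (int (length (m # ms)))"
    if "m \<in> carrier \<Omega>" "set ms \<subseteq> carrier \<Omega>" for m ms
    using that
  proof (induction ms arbitrary: m)
    case Nil
    then show ?case
      using act_homog[OF Omega_AA F_homog_ft[OF one_closed one]] by (simp add: chi_emb)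
  next
    case (Cons m' ms)
    then show ?case
      using act_homog[OF Omega_AA Cons.IH, of m m']
      by (simp add: TA.tn_Cons[of m "m' # ms"] chi_emb_mult TA.tn_closed)
  qed
  from gen(1) show ?case
  proof (cases rule: TA.twords_cases)
    case (Scal r)
    then show ?thesis using F_homog_ft[OF _ one, of r] gen(2) by (simp add: chi_sc flip: TA.sc_eq)
  next
    case (Tens m ms)
    then have "n = int (length (m # ms))" using gen(2) by simp
    then show ?thesis using Tens *[of m ms] by (simp flip: TA.tn_def)
  qed
qed

lemma kappa0_homog: "t \<in> homog TQ n \<Longrightarrow> kappa0 t \<in> homog T n"
proof (induction rule: TB.homog_induct)
  case zero
  show ?case by (simp add: add_hom_zero[OF TB.T.is_abelian_group TA.T.is_abelian_group kappa0_hom] TA.homog_zero)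
next
  case (diff U V)
  then show ?case
    by (simp add: add_hom_diff[OF TB.T.is_abelian_group TA.T.is_abelian_group kappa0_hom] TB.homog_closed TA.homog_diff)
next
  case (gen w)
  have *: "kappa0 (TB.tn (m # ms)) \<in> homog T (int (length (m # ms)))"
    if "m \<in> carrier Q" "set ms \<subseteq> carrier Q" for m ms
    using that
  proof (induction ms arbitrary: m)
    case Nil
    then obtain a where a: "a \<in> carrier A" "m = qcl a" by (auto simp: Q_carrier)
    have "kappa0 \<one>\<^bsub>TQ\<^esub> = \<one>\<^bsub>T\<^esub>"
      using kappa0_sc[OF one_B] TB.one_eq TA.one_eq by simp
    then have "kappa0 (p a) = D a"
      using a kappa0_p_mult[of a "\<one>\<^bsub>TQ\<^esub>"] by (simp add: p_closed univ.dd_closed)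
    then show ?case using a D_homog[of a] by (simp add: p_def)
  next
    case (Cons m' ms)
    then obtain a where a: "a \<in> carrier A" "m = qcl a" by (auto simp: Q_carrier)
    have "kappa0 (TB.tn (m # m' # ms)) = D a \<otimes>\<^bsub>T\<^esub> kappa0 (TB.tn (m' # ms))"
      using Cons.prems a kappa0_p_mult[of a "TB.tn (m' # ms)"]
      by (simp add: TB.tn_Cons[of "qcl a" "m' # ms"] TB.tn_closed p_def)
    then show ?case
      using TA.homog_mult[OF D_homog[OF a(1)] Cons.IH, of m'] Cons.prems by simp
  qed
  from gen(1) show ?case
  proof (cases rule: TB.twords_cases)
    case (Scal r)
    then show ?thesis using gen(2) TA.homog_sc[of r] by (simp add: kappa0_sc B_carrier flip: TB.sc_eq)
  next
    case (Tens m ms)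
    then have "n = int (length (m # ms))" using gen(2) by simp
    then show ?thesis using Tens *[of m ms] by (simp flip: TB.tn_def)
  qed
qed

lemma kappa_homog: "f \<in> F_homog n \<Longrightarrow> kappa f \<in> homog T n"
proof (rule F_homog_map[OF _ TA.T.is_abelian_group kappa_hom])
  fix a t assume "a \<in> carrier A" "t \<in> homog TQ n"
  then show "kappa (ft a t) \<in> homog T n"
    using TA.homog_mult[OF TA.homog_sc kappa0_homog, of a t n] by (simp add: kappa_ft TB.homog_closed)
qed (simp_all add: TA.homog_zero TA.homog_add TA.homog_neg)

lemma left_module_iso:
  "graded_module_iso (carrier A) (tensor_algebra_left_module A \<Omega>) (induced_tensor_algebra A B) chi"
  unfolding graded_module_iso_def
proof (intro conjI ballI allI)
  let ?L = "tensor_algebra_left_module A \<Omega>" and ?I = "induced_tensor_algebra A B"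
  have L: "carrier ?L = carrier T" "add ?L = add T" "homog ?L = homog T" "\<And>r t. r \<odot>\<^bsub>?L\<^esub> t = sc r \<otimes>\<^bsub>T\<^esub> t"
    by (simp_all add: tensor_algebra_left_module_def tensor_algebra_bimodule_def bimodule_via_def Let_def)
  have I: "carrier ?I = carrier F" "add ?I = add F" "smult ?I = smult F" "homog ?I = F_homog"
    by (simp_all add: induced_tensor_algebra_def Let_def FF.pure_def fun_eq_iff)
  show "bij_betw chi (carrier ?L) (carrier ?I)"
    unfolding L I by (rule bij_betwI[of _ _ _ kappa]) (auto simp: chi_closed kappa_closed chi_kappa kappa_chi)
  show "chi (x \<oplus>\<^bsub>?L\<^esub> y) = chi x \<oplus>\<^bsub>?I\<^esub> chi y" if "x \<in> carrier ?L" "y \<in> carrier ?L" for x y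
    using that by (simp add: L I add_hom_add[OF chi_hom])
  show "chi (r \<odot>\<^bsub>?L\<^esub> x) = r \<odot>\<^bsub>?I\<^esub> chi x" if "r \<in> carrier A" "x \<in> carrier ?L" for r x
    using that by (simp add: L I chi_sc_mult)
  show "chi ` homog ?L n = homog ?I n" for n
    unfolding L I
  proof
    show "chi ` homog T n \<subseteq> F_homog n" using chi_homog by blast
    show "F_homog n \<subseteq> chi ` homog T n"
    proof
      fix f assume f: "f \<in> F_homog n"
      show "f \<in> chi ` homog T n"
        by (rule image_eqI[of f chi, OF chi_kappa[OF F_homog_closed(4)[OF f], symmetric] kappa_homog[OF f]])
    qed
  qed
qed

end

theorem theorem10p7p1:
  fixes k :: "'k ring" and A :: "('k, 'a) module" and B :: "'a set"
  assumes "algebraically_closed k" and "char_zero k"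
    and "assoc_algebra k A" and "unital_subalgebra k A B"
  shows
    "(\<exists>(E :: ('k, ('a, ('a, 'a) tensor) tensor_word_class) dga) g.
        rel_diff_envelope TYPE('e) k A B E g \<and>
        rel_diff_envelope TYPE(('a, ('a, 'a) tensor) tensor_word_class) k A B E g) \<and>
     (\<forall>(D :: ('k, 'd) dga) f.
        rel_diff_envelope TYPE('d) k A B D f \<longrightarrow>
        rel_diff_envelope TYPE(('a, ('a, 'a) tensor) tensor_word_class) k A B D f \<longrightarrow>
        (\<exists>\<phi>. graded_algebra_iso k D (tensor_algebra A (Omega1_nc A B)) \<phi> \<and>
             (\<forall>a\<in>carrier A. \<phi> (f a) = tensor_scalar A (Omega1_nc A B) a))) \<and>
     (\<exists>\<chi>. graded_module_iso (carrier A)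
        (tensor_algebra_left_module A (Omega1_nc A B)) (induced_tensor_algebra A B) \<chi>)"
proof -
  interpret algebra_pair k A B
    using assms(3,4) by (simp add: algebra_pair.intro algebra_pair_axioms.intro)
  have iso: "\<exists>\<phi>. graded_algebra_iso k D T \<phi> \<and> (\<forall>a\<in>carrier A. \<phi> (f a) = sc a)"
    if D: "rel_diff_envelope TYPE('d) k A B D f"
      "rel_diff_envelope TYPE(('a, ('a, 'a) tensor) tensor_word_class) k A B D f"
    for D :: "('k, 'd) dga" and f
  proof -
    obtain \<phi> where "graded_algebra_iso k D env \<phi>" "\<forall>a\<in>carrier A. \<phi> (f a) = sc a"
      using envelope_iso[OF D env_envelope env_envelope] by blast
    moreover have "graded_algebra_iso k D env \<phi> = graded_algebra_iso k D T \<phi>"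
      by (simp add: graded_algebra_iso_def graded_module_iso_def ring_hom_def)
    ultimately show ?thesis by blast
  qed
  show ?thesis
    by (intro conjI exI[of _ env] exI[of _ sc] exI[of _ chi] allI impI env_envelope iso left_module_iso)
qed

end
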